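(* Let $\mathcal P$ be a finite chiral or directly regular $4$-polytope of type $\{p, q, r\}$, with facets $\mathcal K$ and vertex-figures $\mathcal L$. If $q$ is prime and if $q^2$ does not divide $|\Gamma^+(\mathcal K) \diamond \Gamma^+(\mathcal L^{\delta})|$, then $\mathcal P \diamond \mathcal P^{\delta}$ is polytopal.
   Context: An abstract polytope of rank $n$ (an $n$-polytope) is a ranked poset of faces with ranks from $-1$ to $n$, with a unique least face $F_{-1}$ (rank $-1$) and a unique greatest face $F_n$ (rank $n$), in which every flag (maximal chain) has $n+2$ faces, which satisfies the diamond condition (whenever $F<G$ with ranks $j-1$ and $j+1$ there are exactly two $j$-faces strictly between them), and which is strongly flag-connected (any two flags $\Phi,\Psi$ are joined by a sequence of flags, consecutive ones adjacent, all containing $\Phi\cap\Psi$; two flags are adjacent if they differ in exactly one face). $\Phi^j$ denotes the unique flag differing from $\Phi$ only in its $j$-face, and $\Phi^{i,j}=(\Phi^i)^j$. Each polytope considered has a fixed base flag $\Phi$. $\mathcal P$ is regular if its automorphism group $\Gamma(\mathcal P)$ is transitive on flags; then $\Gamma(\mathcal P)$ is generated by $\rho_0,\dots,\rho_{n-1}$, where $\rho_i$ maps $\Phi$ to $\Phi^i$. Put $\sigma_i=\rho_{i-1}\rho_i$ and $\Gamma^+(\mathcal P)=\langle\sigma_1,\dots,\sigma_{n-1}\rangle$; $\mathcal P$ is directly regular if it is regular and $\Gamma^+(\mathcal P)$ has index $2$ in $\Gamma(\mathcal P)$. $\mathcal P$ is chiral if $\Gamma(\mathcal P)$ has exactly two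 orbits on flags and adjacent flags lie in distinct orbits; then $\Gamma^+(\mathcal P):=\Gamma(\mathcal P)$ is generated by $\sigma_1,\dots,\sigma_{n-1}$, where $\sigma_i$ maps $\Phi$ to $\Phi^{i,i-1}$. In both cases $(\sigma_i\cdots\sigma_j)^2=1$ for $i<j$, and the type of $\mathcal P$ is $\{p_1,\dots,p_{n-1}\}$ where $p_i$ is the order of $\sigma_i$. Facets and vertex-figures: for a chiral or directly regular $4$-polytope $\mathcal P$ with $\Gamma^+(\mathcal P)=\langle\sigma_1,\sigma_2,\sigma_3\rangle$ and base flag $\{F_{-1},F_0,\dots,F_4\}$, the facet $\mathcal K$ is the section $F_3/F_{-1}$ and the vertex-figure $\mathcal L$ is the section $F_4/F_0$ (a section $G/F$ is $\{H: F\le H\le G\}$); both are chiral or directly regular polyhedra, with $\Gamma^+(\mathcal K)=\langle\sigma_1,\sigma_2\rangle$ and $\Gamma^+(\mathcal L)=\langle\sigma_2,\sigma_3\rangle$ (with these specified generators). Dual: for an $n$-polytope $\mathcal P$, $\mathcal P^\delta$ is $\mathcal P$ with reversed order; $\Gamma^+(\mathcal P^\delta)$ is the same group with specified generators $\sigma_i'=\sigma_{n-i}^{-1}$. (So $\Gamma^+(\mathcal L^\delta)$ has specified generators $\sigma_3^{-1},\sigma_2^{-1}$, in this order.) Intersection property: for a group $G$ with specified generators $\sigma_1,\dots,\sigma_{n-1}$, put $\tau_{i,j}=\sigma_i\cdots\sigma_j$ ($1\le i\le j\le n-1$) and, for $I\subseteq\{0,\dots,n-1\}$, $G_I=\langle\tau_{i,j}\mid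 i\le j,\ i-1,j\in I\rangle$. $G$ has the intersection property if $G_I\cap G_J=G_{I\cap J}$ for all $I,J$. Rotation groups of chiral or directly regular polytopes have this property. Mix: for groups with specified generators $\Gamma=\langle x_1,\dots,x_k\rangle$, $\Gamma'=\langle x_1',\dots,x_k'\rangle$, $\Gamma\diamond\Gamma'$ is the subgroup of $\Gamma\times\Gamma'$ generated by $(x_i,x_i')$, $i=1,\dots,k$. $\mathcal P\diamond\mathcal Q$ is the flag-connected pre-polytope (polytope axioms with strong flag-connectedness weakened to flag-connectedness) built from $\Gamma^+(\mathcal P)\diamond\Gamma^+(\mathcal Q)$ with generators $\beta_i=(\sigma_i,\sigma_i')$; it is polytopal (i.e. a polytope) if and only if this group with generators $\beta_i$ has the intersection property. *)

theory Defs
  imports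
    "HOL-Algebra.Bij"
    "HOL-Algebra.Group_Action"
    "HOL-Algebra.Multiplicative_Group"
    "HOL-Computational_Algebra.Primes"
begin

text \<open>
  A finite-rank ranked poset with a distinguished set of faces intended as base flag.
  The order is a relation in the style of Order\_Relation, its carrier being the field of
  that relation; \<open>rk\<close> is only relevant on the carrier.
\<close>

record 'a ranked_poset =
  dim :: nat
  le :: "'a rel"
  rk :: "'a \<Rightarrow> int"
  base :: "'a set"

definition faces :: "'a ranked_poset \<Rightarrow> 'a set" where
  "faces P = Field (le P)"

definition flags :: "'a ranked_poset \<Rightarrow> 'a set set" where
  "flags P = {\<Phi> \<in> Chains (le P). \<forall>\<Psi> \<in> Chains (le P). \<Phi> \<subseteq> \<Psi> \<longrightarrow> \<Psi> = \<Phi>}"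

definition adjacent_flags :: "'a ranked_poset \<Rightarrow> 'a set \<Rightarrow> 'a set \<Rightarrow> bool" where
  "adjacent_flags P \<Phi> \<Psi> \<longleftrightarrow>
     \<Phi> \<in> flags P \<and> \<Psi> \<in> flags P \<and> card (\<Phi> - \<Psi>) = 1 \<and> card (\<Psi> - \<Phi>) = 1"

definition strongly_flag_connected :: "'a ranked_poset \<Rightarrow> bool" where
  "strongly_flag_connected P \<longleftrightarrow>
     (\<forall>\<Phi> \<in> flags P. \<forall>\<Psi> \<in> flags P.
        (\<Phi>, \<Psi>) \<in> {(A, B). adjacent_flags P A B \<and> \<Phi> \<inter> \<Psi> \<subseteq> A \<and> \<Phi> \<inter> \<Psi> \<subseteq> B}\<^sup>*)"

definition diamond_condition :: "'a ranked_poset \<Rightarrow> bool" where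
  "diamond_condition P \<longleftrightarrow>
     (\<forall>F G. (F, G) \<in> le P \<and> rk P G = rk P F + 2 \<longrightarrow>
        card {H. (F, H) \<in> le P \<and> (H, G) \<in> le P \<and> rk P H = rk P F + 1} = 2)"

definition polytope :: "'a ranked_poset \<Rightarrow> bool" where
  "polytope P \<longleftrightarrow>
     Partial_order (le P) \<and>
     (\<forall>F \<in> faces P. - 1 \<le> rk P F \<and> rk P F \<le> int (dim P)) \<and>
     (\<forall>F G. (F, G) \<in> le P \<and> F \<noteq> G \<longrightarrow> rk P F < rk P G) \<and>
     (\<exists>F \<in> faces P. rk P F = - 1 \<and> (\<forall>G \<in> faces P. (F, G) \<in> le P)) \<and>
     (\<exists>F \<in> faces P. rk P F = int (dim P) \<and> (\<forall>G \<in> faces P. (G, F) \<in> le P)) \<and>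
     (\<forall>\<Phi> \<in> flags P. card \<Phi> = dim P + 2) \<and>
     diamond_condition P \<and>
     strongly_flag_connected P \<and>
     base P \<in> flags P"

definition adj_flag :: "'a ranked_poset \<Rightarrow> 'a set \<Rightarrow> int \<Rightarrow> 'a set" where
  "adj_flag P \<Phi> j =
     (THE \<Psi>. \<Psi> \<in> flags P \<and> \<Psi> \<noteq> \<Phi> \<and> (\<forall>F. rk P F \<noteq> j \<longrightarrow> (F \<in> \<Psi> \<longleftrightarrow> F \<in> \<Phi>)))"

text \<open>
  Automorphisms act on the right: the product \<open>\<alpha>\<beta>\<close> applies \<open>\<alpha>\<close> first. Only with this
  convention does \<open>\<sigma>\<^sub>i = \<rho>\<^bsub>i-1\<^esub>\<rho>\<^sub>i\<close> map the base flag to \<open>\<Phi>\<^bsup>i,i-1\<^esup>\<close>, and only then is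
  \<open>\<sigma>\<^sub>i \<dots> \<sigma>\<^sub>j\<close> an involution for \<open>i < j\<close>. This is why \<open>BijGroup\<close>, whose product
  applies the second factor first, is not used.
\<close>

definition aut_group :: "'a ranked_poset \<Rightarrow> ('a \<Rightarrow> 'a) monoid" where
  "aut_group P =
     \<lparr>carrier = {\<gamma> \<in> Bij (faces P). \<forall>F \<in> faces P. \<forall>G \<in> faces P.
                   (\<gamma> F, \<gamma> G) \<in> le P \<longleftrightarrow> (F, G) \<in> le P},
      monoid.mult = (\<lambda>\<alpha> \<beta>. compose (faces P) \<beta> \<alpha>),
      one = (\<lambda>F \<in> faces P. F)\<rparr>"

lemma group_aut_group: "group (aut_group P)"
proof (rule groupI)
  fix x y assume *: "x \<in> carrier (aut_group P)" "y \<in> carrier (aut_group P)"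
  then have "compose (faces P) y x \<in> Bij (faces P)"
    by (simp add: aut_group_def compose_Bij)
  moreover have "x F \<in> faces P" if "F \<in> faces P" for F
    using * that by (auto simp: aut_group_def Bij_def bij_betw_def)
  ultimately show "x \<otimes>\<^bsub>aut_group P\<^esub> y \<in> carrier (aut_group P)"
    using * by (simp add: aut_group_def compose_def)
next
  show "\<one>\<^bsub>aut_group P\<^esub> \<in> carrier (aut_group P)"
    by (simp add: aut_group_def id_Bij)
next
  fix x y z
  assume "x \<in> carrier (aut_group P)" "y \<in> carrier (aut_group P)" "z \<in> carrier (aut_group P)"
  then have "x \<in> faces P \<rightarrow> faces P"
    by (simp add: aut_group_def Bij_imp_funcset)
  then show "x \<otimes>\<^bsub>aut_group P\<^esub> y \<otimes>\<^bsub>aut_group P\<^esub> z = x \<otimes>\<^bsub>aut_group P\<^esub> (y \<otimes>\<^bsub>aut_group P\<^esub> z)"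
    by (simp add: aut_group_def compose_assoc)
next
  fix x assume "x \<in> carrier (aut_group P)"
  then have "x \<in> faces P \<rightarrow> faces P" "x \<in> extensional (faces P)"
    by (simp_all add: aut_group_def Bij_imp_funcset Bij_imp_extensional)
  then show "\<one>\<^bsub>aut_group P\<^esub> \<otimes>\<^bsub>aut_group P\<^esub> x = x"
    by (simp add: aut_group_def compose_Id)
next
  fix x assume x: "x \<in> carrier (aut_group P)"
  then have B: "x \<in> Bij (faces P)" by (simp add: aut_group_def)
  then have bij: "bij_betw x (faces P) (faces P)" by (simp add: Bij_def)
  let ?y = "\<lambda>F \<in> faces P. inv_into (faces P) x F"
  have "?y \<in> carrier (aut_group P)"
    unfolding aut_group_def
  proof (simp add: restrict_inv_into_Bij[OF B], intro ballI)
    fix F G assume F: "F \<in> faces P" and G: "G \<in> faces P"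
    let ?i = "inv_into (faces P) x"
    have "?i F \<in> faces P" "?i G \<in> faces P" "x (?i F) = F" "x (?i G) = G"
      using bij F G by (auto simp: bij_betw_def f_inv_into_f inv_into_into)
    then show "((?i F, ?i G) \<in> le P) = ((F, G) \<in> le P)"
      using x by (simp add: aut_group_def) metis
  qed
  moreover have "?y \<otimes>\<^bsub>aut_group P\<^esub> x = \<one>\<^bsub>aut_group P\<^esub>"
    using bij by (auto simp: aut_group_def compose_def bij_betw_def f_inv_into_f fun_eq_iff)
  ultimately show "\<exists>y \<in> carrier (aut_group P). y \<otimes>\<^bsub>aut_group P\<^esub> x = \<one>\<^bsub>aut_group P\<^esub>"
    by blast
qed

definition regular :: "'a ranked_poset \<Rightarrow> bool" where
  "regular P \<longleftrightarrow>
     (\<forall>\<Phi> \<in> flags P. \<forall>\<Psi> \<in> flags P. \<exists>\<gamma> \<in> carrier (aut_group P). \<gamma> ` \<Phi> = \<Psi>)"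

definition chiral :: "'a ranked_poset \<Rightarrow> bool" where
  "chiral P \<longleftrightarrow>
     card (orbits (aut_group P) (flags P) (`)) = 2 \<and>
     (\<forall>\<Phi> \<Psi>. adjacent_flags P \<Phi> \<Psi> \<longrightarrow>
        orbit (aut_group P) (`) \<Phi> \<noteq> orbit (aut_group P) (`) \<Psi>)"

definition rho :: "'a ranked_poset \<Rightarrow> nat \<Rightarrow> 'a \<Rightarrow> 'a" where
  "rho P i = (THE \<gamma>. \<gamma> \<in> carrier (aut_group P) \<and> \<gamma> ` base P = adj_flag P (base P) (int i))"

definition sigma :: "'a ranked_poset \<Rightarrow> nat \<Rightarrow> 'a \<Rightarrow> 'a" where
  "sigma P i =
     (if regular P then rho P (i - 1) \<otimes>\<^bsub>aut_group P\<^esub> rho P i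
      else (THE \<gamma>. \<gamma> \<in> carrier (aut_group P) \<and>
                    \<gamma> ` base P = adj_flag P (adj_flag P (base P) (int i)) (int i - 1)))"

definition rotation_group :: "'a ranked_poset \<Rightarrow> ('a \<Rightarrow> 'a) monoid" where
  "rotation_group P = subgroup_generated (aut_group P) (sigma P ` {1..dim P - 1})"

definition directly_regular :: "'a ranked_poset \<Rightarrow> bool" where
  "directly_regular P \<longleftrightarrow>
     regular P \<and> card (rcosets\<^bsub>aut_group P\<^esub> carrier (rotation_group P)) = 2"

definition schlafli_type :: "'a ranked_poset \<Rightarrow> nat list" where
  "schlafli_type P = map (\<lambda>i. group.ord (rotation_group P) (sigma P i)) [1..<dim P]"

definition dual :: "'a ranked_poset \<Rightarrow> 'a ranked_poset" where
  "dual P = \<lparr>dim = dim P, le = (le P)\<inverse>, rk = (\<lambda>F. int (dim P) - 1 - rk P F), base = base P\<rparr>"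

text \<open>The section \<open>G/F\<close>, based at the part of the base flag that lies in it.\<close>

definition section_poset :: "'a ranked_poset \<Rightarrow> 'a \<Rightarrow> 'a \<Rightarrow> 'a ranked_poset" where
  "section_poset P G F =
     (let S = {H. (F, H) \<in> le P \<and> (H, G) \<in> le P}
      in \<lparr>dim = nat (rk P G - rk P F - 1), le = Restr (le P) S,
          rk = (\<lambda>H. rk P H - rk P F - 1), base = base P \<inter> S\<rparr>)"

definition base_face :: "'a ranked_poset \<Rightarrow> int \<Rightarrow> 'a" where
  "base_face P j = (THE F. F \<in> base P \<and> rk P F = j)"

definition facet :: "'a ranked_poset \<Rightarrow> 'a ranked_poset" where
  "facet P = section_poset P (base_face P (int (dim P) - 1)) (base_face P (- 1))"

definition vertex_figure :: "'a ranked_poset \<Rightarrow> 'a ranked_poset" where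
  "vertex_figure P = section_poset P (base_face P (int (dim P))) (base_face P 0)"

definition group_mix ::
    "nat \<Rightarrow> 'a monoid \<Rightarrow> (nat \<Rightarrow> 'a) \<Rightarrow> 'b monoid \<Rightarrow> (nat \<Rightarrow> 'b) \<Rightarrow> ('a \<times> 'b) monoid" where
  "group_mix k G x H y = subgroup_generated (G \<times>\<times> H) ((\<lambda>i. (x i, y i)) ` {1..k})"

definition rotation_mix ::
    "'a ranked_poset \<Rightarrow> 'b ranked_poset \<Rightarrow> (('a \<Rightarrow> 'a) \<times> ('b \<Rightarrow> 'b)) monoid" where
  "rotation_mix P Q =
     group_mix (dim P - 1) (rotation_group P) (sigma P) (rotation_group Q) (sigma Q)"

definition tau :: "'g monoid \<Rightarrow> (nat \<Rightarrow> 'g) \<Rightarrow> nat \<Rightarrow> nat \<Rightarrow> 'g" where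
  "tau G x i j = foldr (monoid.mult G) (map x [i..<Suc j]) \<one>\<^bsub>G\<^esub>"

definition gen_subgroup :: "nat \<Rightarrow> 'g monoid \<Rightarrow> (nat \<Rightarrow> 'g) \<Rightarrow> nat set \<Rightarrow> 'g set" where
  "gen_subgroup n G x I =
     generate G {tau G x i j |i j. 1 \<le> i \<and> i \<le> j \<and> j \<le> n - 1 \<and> i - 1 \<in> I \<and> j \<in> I}"

text \<open>
  The ranked poset built from a group with specified generators \<open>x\<^sub>1, \<dots>, x\<^bsub>n-1\<^esub>\<close> (\<open>n \<ge> 3\<close>),
  due to Schulte and Weiss. As \<open>\<tau>\<^bsub>i,k\<^esub>\<close> moves the base flag only in ranks \<open>i - 1\<close> and \<open>k\<close>, the
  stabilizer of the base \<open>j\<close>-face is \<open>G\<^sub>I\<close> with \<open>I = {0, \<dots>, n - 1} - {j}\<close>, which is all of \<open>G\<close>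
  for \<open>j \<in> {-1, n}\<close>; the \<open>j\<close>-faces are its right cosets, two cosets being incident iff they
  meet. Faces carry their rank, since stabilizers of different ranks may coincide as sets.
\<close>

definition face_stabilizer :: "nat \<Rightarrow> 'g monoid \<Rightarrow> (nat \<Rightarrow> 'g) \<Rightarrow> int \<Rightarrow> 'g set" where
  "face_stabilizer n G x j = gen_subgroup n G x {m. m < n \<and> int m \<noteq> j}"

definition coset_poset :: "nat \<Rightarrow> 'g monoid \<Rightarrow> (nat \<Rightarrow> 'g) \<Rightarrow> (int \<times> 'g set) ranked_poset" where
  "coset_poset n G x =
     \<lparr>dim = n,
      le = {((i, A), (j, B)) |i A j B.
              - 1 \<le> i \<and> i \<le> j \<and> j \<le> int n \<and>
              A \<in> rcosets\<^bsub>G\<^esub> face_stabilizer n G x i \<and>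
              B \<in> rcosets\<^bsub>G\<^esub> face_stabilizer n G x j \<and>
              A \<inter> B \<noteq> {}},
      rk = fst,
      base = {(j, face_stabilizer n G x j) |j. - 1 \<le> j \<and> j \<le> int n}\<rparr>"

definition polytope_mix ::
    "'a ranked_poset \<Rightarrow> 'b ranked_poset \<Rightarrow>
       (int \<times> (('a \<Rightarrow> 'a) \<times> ('b \<Rightarrow> 'b)) set) ranked_poset" where
  "polytope_mix P Q = coset_poset (dim P) (rotation_mix P Q) (\<lambda>i. (sigma P i, sigma Q i))"

end

theory Submission
  imports Defs
begin

text \<open>
  Let \<open>\<beta>\<^sub>i = (\<sigma>\<^sub>i, \<sigma>\<^bsub>4-i\<^esub>\<inverse>)\<close> be the generators of the mix and \<open>H\<^sub>j\<close> the stabilizer of the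
  base \<open>j\<close>-face. An element of \<open>H\<^sub>j\<close> has a first component fixing the base \<open>j\<close>-face of \<open>P\<close> and a
  second component fixing its base \<open>(3-j)\<close>-face. A rotation of \<open>P\<close> fixing all base faces but one
  is trivial, so any three of \<open>H\<^sub>0, \<dots>, H\<^sub>3\<close> intersect trivially. Since \<open>H\<^sub>1\<close> and \<open>H\<^sub>2\<close> are
  dihedral, with rotation subgroups generated by \<open>\<beta>\<^sub>3\<close> and \<open>\<beta>\<^sub>1\<close>, this settles every instance of the
  intersection property except \<open>H\<^sub>0 \<inter> H\<^sub>3 = \<langle>\<beta>\<^sub>2\<rangle>\<close>. Now \<open>H\<^sub>0 \<inter> H\<^sub>3\<close> contains \<open>\<beta>\<^sub>2\<close>, of order \<open>q\<close>, and
  lies in \<open>\<langle>\<sigma>\<^sub>2\<rangle> \<times> \<langle>\<sigma>\<^sub>2\<rangle>\<close>, of order \<open>q\<^sup>2\<close>. It also lies in \<open>H\<^sub>3 = \<langle>\<beta>\<^sub>1, \<beta>\<^sub>2\<rangle>\<close>, which restriction to the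
  facet and the vertex-figure identifies with the mix of \<open>K\<close> and the dual of \<open>L\<close>; hence its order
  is not \<open>q\<^sup>2\<close>, and as \<open>q\<close> is prime it is \<open>q\<close>.
\<close>

section \<open>Coset geometries of rank four\<close>

text \<open>The passage from these intersections to the polytope axioms is carried out directly on
  cosets. The obstacle is that a rotation group reaches only half of the flags, so the cosets
  forming a flag need not have a common element. After one proper face is dropped, at most three
  proper cosets remain, and these do have one; hence the arguments about chains omit one proper rank
  and repair it afterwards. A rotation fixing all base faces but the one of rank \<open>j\<close>
  maps the base flag to itself or to its \<open>j\<close>-adjacent flag. In the first case it is
  trivial, because automorphisms act freely on flags. The second case would make adjacent flags
  equivalent under rotations, which chirality excludes by its orbits and direct regularity by the
  index 2. Reflections need not exist, so both kinds of polytope are handled through elements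
  \<open>T a b\<close> that behave like products of two reflections. These exist in either case, and
  their calculus is all that the mix inherits.\<close>

locale group_with_generators = group G for G :: "'g monoid" (structure) +
  fixes x :: "nat \<Rightarrow> 'g"
begin

abbreviation H :: "int \<Rightarrow> 'g set" where "H \<equiv> face_stabilizer 4 G x"

end

text \<open>
  \<open>H_factor\<close> makes incidence transitive, \<open>H_index\<close> is the diamond condition, and \<open>H_generated\<close>,
  whose generators move a base flag in at most two ranks, gives strong flag-connectedness.
\<close>

locale coset_geometry = group_with_generators G x for G :: "'g monoid" (structure) and x +
  assumes H_subgroup: "subgroup (H j) G"
    and H_improper: "j < 0 \<or> 3 < j \<Longrightarrow> H j = carrier G"
    and H_factor: "\<lbrakk>0 \<le> i; i < j; j < k; k \<le> 3; h \<in> H j\<rbrakk> \<Longrightarrow>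
      \<exists>u \<in> H j \<inter> H k.
      \<exists>v \<in> H i \<inter> H j. h = u \<otimes> v"
    and H_index: "\<lbrakk>-1 \<le> i; i \<le> 2\<rbrakk> \<Longrightarrow>
      \<exists>s \<in> H i \<inter> H (i + 2).
        s \<notin> H (i + 1) \<and>
        (\<forall>h \<in> H i \<inter> H (i + 2).
           h \<in> H (i + 1) \<or> h \<otimes> inv s \<in> H (i + 1))"
    and H_generated: "\<lbrakk>I \<subseteq> {0..3}; g \<in> carrier G; \<forall>j \<in> {0..3} - I. g \<in> H j\<rbrakk> \<Longrightarrow>
      g \<in> generate G {t \<in> carrier G. \<exists>a \<in> I. \<exists>b \<in> I.
        (\<forall>j \<in> {0..3} - {a, b}. t \<in> H j) \<and>
        t \<in> H b <#> H a}"
begin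

abbreviation \<Q> :: "(int \<times> 'g set) ranked_poset" where "\<Q> \<equiv> coset_poset 4 G x"

text \<open>
  The group has two orbits on flags: the flags \<open>coset_flag b\<close> form one of them, and the flags
  adjacent to these the other, so a flag is of this form only up to one of its faces.
\<close>

definition coset_flag :: "'g \<Rightarrow> (int \<times> 'g set) set" where
  "coset_flag b = {(j, H j #> b) |j. -1 \<le> j \<and> j \<le> 4}"

lemma le_iff: "((i, A), (j, B)) \<in> le \<Q> \<longleftrightarrow>
    -1 \<le> i \<and> i \<le> j \<and> j \<le> 4 \<and> A \<in> rcosets (H i) \<and> B \<in> rcosets (H j) \<and> A \<inter> B \<noteq> {}"
  by (simp add: coset_poset_def)

lemma rk_Q [simp]: "rk \<Q> = fst" and dim_Q [simp]: "dim \<Q> = 4"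
  by (simp_all add: coset_poset_def)

lemma H_subset: "H j \<subseteq> carrier G"
  using H_subgroup subgroup.subset by blast

lemma mem_coset_self: "b \<in> carrier G \<Longrightarrow> b \<in> H j #> b"
  using H_subgroup rcos_self by blast

lemma coset_eq: "\<lbrakk>A \<in> rcosets (H j); b \<in> A\<rbrakk> \<Longrightarrow> A = H j #> b"
proof -
  assume A: "A \<in> rcosets (H j)" and b: "b \<in> A"
  from A obtain y where "y \<in> carrier G" "A = H j #> y" by (auto simp: RCOSETS_def)
  then show ?thesis using b repr_independence[OF _ _ H_subgroup] by blast
qed

lemma coset_subset: "A \<in> rcosets (H j) \<Longrightarrow> A \<subseteq> carrier G"
  using H_subgroup subgroup.rcosets_carrier[OF _ is_group] by blast

lemma coset_in: "b \<in> carrier G \<Longrightarrow> H j #> b \<in> rcosets (H j)"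
  using H_subset rcosetsI by blast

lemma coset_nonempty: "A \<in> rcosets (H j) \<Longrightarrow> A \<noteq> {}"
  by (auto simp: RCOSETS_def dest: mem_coset_self)

lemma coset_eq_iff: "\<lbrakk>b \<in> carrier G; c \<in> carrier G\<rbrakk> \<Longrightarrow> H j #> b = H j #> c \<longleftrightarrow> c \<otimes> inv b \<in> H j"
  by (metis H_subgroup coset_eq coset_in mem_coset_self subgroup.rcos_module is_group)

lemma coset_improper: "\<lbrakk>j < 0 \<or> 3 < j; b \<in> carrier G\<rbrakk> \<Longrightarrow> H j #> b = carrier G"
  by (metis H_improper coset_join2 subgroup_self)

lemma coset_absorb: "\<lbrakk>h \<in> H j; b \<in> carrier G\<rbrakk> \<Longrightarrow> H j #> (h \<otimes> b) = H j #> b"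
  using coset_eq[OF coset_in[of b j], of "h \<otimes> b"] by (auto simp: r_coset_def)

text \<open>The improper stabilizers of ranks -1 and 4 and coinciding ranks are degenerate cases, in
  which one of the factors is \<open>\<one>\<close>.\<close>

lemma H_factor':
  assumes "-1 \<le> i" "i \<le> j" "j \<le> k" "k \<le> 4" "h \<in> H j"
  shows "\<exists>u \<in> H j \<inter> H k. \<exists>v \<in> H i \<inter> H j. h = u \<otimes> v"
proof -
  have one: "\<one> \<in> H j" for j using H_subgroup subgroup.one_closed by blast
  have hc: "h \<in> carrier G" using assms H_subset by blast
  consider "i < 0 \<or> i = j" | "k > 3 \<or> k = j" | "0 \<le> i" "i < j" "j < k" "k \<le> 3"
    using assms by linarith
  then show ?thesis
  proof cases
    case 1
    then have "h \<in> H i \<inter> H j" using assms(5) hc H_improper by auto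
    moreover have "h = \<one> \<otimes> h" using hc by simp
    ultimately show ?thesis using one by blast
  next
    case 2
    then have "h \<in> H j \<inter> H k" using assms(5) hc H_improper by auto
    moreover have "h = h \<otimes> \<one>" using hc by simp
    ultimately show ?thesis using one by blast
  next
    case 3 then show ?thesis using H_factor assms(5) by blast
  qed
qed

text \<open>Some \<open>h\<close> in \<open>H j\<close> carries a point \<open>g\<close> of
  \<open>A\<close> and \<open>B\<close> to a point of \<open>B\<close> and \<open>C\<close>. In
  \<open>h = u \<otimes> v\<close> the factor \<open>u\<close> also lies in \<open>H k\<close> and
  is absorbed by the coset \<open>C\<close>, while \<open>v\<close> lies in \<open>H i\<close> and
  \<open>H j\<close> and keeps \<open>g\<close> inside \<open>A\<close> and \<open>B\<close>; so
  \<open>v \<otimes> g\<close> is common to all three. This yields transitivity of incidence as well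
  as representatives of chains.\<close>

lemma incident_triple:
  assumes "((i, A), (j, B)) \<in> le \<Q>" "((j, B), (k, C)) \<in> le \<Q>"
  obtains b where "b \<in> A" "b \<in> B" "b \<in> C"
proof -
  obtain g c where g: "g \<in> A" "g \<in> B" and c: "c \<in> B" "c \<in> C"
    using assms by (auto simp: le_iff)
  have A: "A = H i #> g" and B: "B = H j #> g" and C: "C = H k #> c"
    using assms g c coset_eq by (auto simp: le_iff)
  have gc: "g \<in> carrier G" using assms g coset_subset by (auto simp: le_iff)
  obtain h where h: "h \<in> H j" "c = h \<otimes> g" using c(1) B by (auto simp: r_coset_def)
  obtain u v where uv: "u \<in> H j" "u \<in> H k" "v \<in> H i" "v \<in> H j" "h = u \<otimes> v"
    using H_factor'[of i j k h] assms h by (auto simp: le_iff)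
  have uc: "u \<in> carrier G" "v \<in> carrier G" using uv H_subset by blast+
  have "C = H k #> (u \<otimes> (v \<otimes> g))" using C h uv uc gc by (simp add: m_assoc)
  then have "C = H k #> (v \<otimes> g)" using coset_absorb uv uc gc by simp
  then have "v \<otimes> g \<in> C" using mem_coset_self uc gc by simp
  moreover have "v \<otimes> g \<in> A" "v \<otimes> g \<in> B"
    using A B uv by (auto simp: r_coset_def)
  ultimately show thesis using that by blast
qed

lemma faces_iff: "(i, A) \<in> faces \<Q> \<longleftrightarrow> -1 \<le> i \<and> i \<le> 4 \<and> A \<in> rcosets (H i)"
proof
  assume "(i, A) \<in> faces \<Q>"
  then show "-1 \<le> i \<and> i \<le> 4 \<and> A \<in> rcosets (H i)"
    by (auto simp: faces_def Field_def le_iff)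
next
  assume "-1 \<le> i \<and> i \<le> 4 \<and> A \<in> rcosets (H i)"
  then have "((i, A), (i, A)) \<in> le \<Q>" using coset_nonempty[of A i] by (simp add: le_iff)
  then show "(i, A) \<in> faces \<Q>" by (auto simp: faces_def Field_def)
qed

lemma same_rank_eq: "\<lbrakk>((i, A), (i, B)) \<in> le \<Q>\<rbrakk> \<Longrightarrow> A = B"
  by (metis coset_eq disjoint_iff le_iff)

lemma partial_order_Q: "Partial_order (le \<Q>)"
proof -
  have "refl_on (Field (le \<Q>)) (le \<Q>)"
    unfolding refl_on_def
  proof (intro ballI)
    fix F assume "F \<in> Field (le \<Q>)"
    moreover obtain i A where "F = (i, A)" by force
    ultimately show "(F, F) \<in> le \<Q>"
      using faces_iff coset_nonempty[of A i] by (simp add: le_iff faces_def[symmetric])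
  qed
  moreover have "trans (le \<Q>)"
  proof (rule transI)
    fix F F' F'' assume *: "(F, F') \<in> le \<Q>" "(F', F'') \<in> le \<Q>"
    obtain i A j B k C where e: "F = (i, A)" "F' = (j, B)" "F'' = (k, C)" by (metis surj_pair)
    obtain b where "b \<in> A" "b \<in> B" "b \<in> C" using incident_triple * e by metis
    then show "(F, F'') \<in> le \<Q>" using * e by (auto simp: le_iff)
  qed
  moreover have "antisym (le \<Q>)"
  proof (rule antisymI)
    fix F F' assume *: "(F, F') \<in> le \<Q>" "(F', F) \<in> le \<Q>"
    obtain i A j B where e: "F = (i, A)" "F' = (j, B)" by (metis surj_pair)
    have "i = j" using * e by (auto simp: le_iff)
    then show "F = F'" using same_rank_eq * e by blast
  qed
  ultimately show ?thesis
    by (auto simp: partial_order_on_def preorder_on_def Field_def)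
qed

lemma chain_same_rank: "\<lbrakk>\<Psi> \<in> Chains (le \<Q>); (i, A) \<in> \<Psi>; (i, B) \<in> \<Psi>\<rbrakk> \<Longrightarrow> A = B"
  unfolding Chains_def using same_rank_eq by blast

lemma chain_inj: "\<Psi> \<in> Chains (le \<Q>) \<Longrightarrow> inj_on fst \<Psi>"
  using chain_same_rank by (fastforce intro: inj_onI)

lemma chain_faces: "\<lbrakk>\<Psi> \<in> Chains (le \<Q>); (i, A) \<in> \<Psi>\<rbrakk> \<Longrightarrow> -1 \<le> i \<and> i \<le> 4 \<and> A \<in> rcosets (H i)"
  unfolding Chains_def using le_iff[of i A i A] by blast

lemma chain_le: "\<lbrakk>\<Psi> \<in> Chains (le \<Q>); (i, A) \<in> \<Psi>; (j, B) \<in> \<Psi>; i \<le> j\<rbrakk> \<Longrightarrow> ((i, A), (j, B)) \<in> le \<Q>"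
  using chain_faces[of \<Psi> i A] chain_faces[of \<Psi> j B]
  unfolding Chains_def using le_iff[of i A j B] le_iff[of j B i A] by blast

lemma coset_flag_chain: "b \<in> carrier G \<Longrightarrow> coset_flag b \<in> Chains (le \<Q>)"
proof -
  assume b: "b \<in> carrier G"
  then have "(H i #> b) \<inter> (H j #> b) \<noteq> {}" for i j using mem_coset_self by blast
  then show ?thesis
    unfolding Chains_def coset_flag_def using coset_in[OF b] by (auto simp: le_iff)
qed

lemma carrier_coset: "j < 0 \<or> 3 < j \<Longrightarrow> A \<in> rcosets (H j) \<longleftrightarrow> A = carrier G"
  by (auto simp: RCOSETS_def coset_improper)

lemma le_bottom: "F \<in> faces \<Q> \<Longrightarrow> ((-1, carrier G), F) \<in> le \<Q>"
  and le_top: "F \<in> faces \<Q> \<Longrightarrow> (F, (4, carrier G)) \<in> le \<Q>"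
  using coset_nonempty[of "snd F" "fst F"] coset_subset[of "snd F" "fst F"]
    carrier_coset[of "-1" "carrier G"] carrier_coset[of 4 "carrier G"]
  by (cases F; auto simp: faces_iff le_iff)+

text \<open>With a proper rank missing, at most three proper faces remain, few enough for
  \<open>incident_triple\<close>; its common element is \<open>b\<close>. A chain with all four
  proper ranks need not have a common element, since it may belong to the other orbit.\<close>

lemma chain_missing_rank:
  assumes \<Psi>: "\<Psi> \<in> Chains (le \<Q>)" and a: "a \<in> {0..3}" and missing: "\<And>A. (a, A) \<notin> \<Psi>"
  obtains b where "b \<in> carrier G" "\<Psi> \<subseteq> coset_flag b"
proof -
  obtain i j k :: int where ijk: "{0..3} - {a} = {i, j, k}" "0 \<le> i" "i < j" "j < k" "k \<le> 3"
  proof -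
    have e: "{0..3::int} = {0, 1, 2, 3}" by auto
    have "a = 0 \<or> a = 1 \<or> a = 2 \<or> a = 3" using a by auto
    then show thesis
    proof (elim disjE)
      assume "a = 0" then show thesis by (intro that[of 1 2 3]) (auto simp: e)
    next
      assume "a = 1" then show thesis by (intro that[of 0 2 3]) (auto simp: e)
    next
      assume "a = 2" then show thesis by (intro that[of 0 1 3]) (auto simp: e)
    next
      assume "a = 3" then show thesis by (intro that[of 0 1 2]) (auto simp: e)
    qed
  qed
  \<comment> \<open>An absent lower face is replaced by the least face, an absent upper one by the
    greatest face, and an absent middle one by \<open>F1\<close> itself, so that
    \<open>incident_triple\<close> always applies and the substitutes impose nothing new.\<close>
  define F1 where "F1 = (if \<exists>A. (i, A) \<in> \<Psi> then (i, SOME A. (i, A) \<in> \<Psi>) else (-1, carrier G))"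
  define F3 where "F3 = (if \<exists>A. (k, A) \<in> \<Psi> then (k, SOME A. (k, A) \<in> \<Psi>) else (4, carrier G))"
  define F2 where "F2 = (if \<exists>A. (j, A) \<in> \<Psi> then (j, SOME A. (j, A) \<in> \<Psi>) else F1)"
  have F1: "F1 \<in> \<Psi> \<and> fst F1 = i \<or> F1 = (-1, carrier G)" and
    F3: "F3 \<in> \<Psi> \<and> fst F3 = k \<or> F3 = (4, carrier G)" and
    F2: "F2 \<in> \<Psi> \<and> fst F2 = j \<or> F2 = F1"
    unfolding F1_def F2_def F3_def by (auto intro: someI)
  have f: "F \<in> faces \<Q>" if "F \<in> \<Psi>" for F
    using chain_faces[OF \<Psi>] that by (cases F) (auto simp: faces_iff)
  have cl: "(F, F') \<in> le \<Q>" if "F \<in> \<Psi>" "F' \<in> \<Psi>" "fst F \<le> fst F'" for F F'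
    using chain_le[OF \<Psi>] that by (cases F; cases F') auto
  have f13: "F1 \<in> faces \<Q>" "F3 \<in> faces \<Q>"
  proof -
    have "(-1, carrier G) \<in> faces \<Q>" "(4, carrier G) \<in> faces \<Q>"
      by (auto simp: faces_iff carrier_coset)
    then show "F1 \<in> faces \<Q>" "F3 \<in> faces \<Q>" using F1 F3 f by metis+
  qed
  have rfl: "(F1, F1) \<in> le \<Q>" using f13(1) coset_nonempty by (cases F1) (auto simp: faces_iff le_iff)
  have le12: "(F1, F2) \<in> le \<Q>" 
    using F1 F2 cl ijk le_bottom f rfl by (metis less_imp_le)
  have le23: "(F2, F3) \<in> le \<Q>"
  proof (cases "F2 \<in> \<Psi>")
    case True
    then have "fst F2 \<le> fst F3 \<or> F3 = (4, carrier G)"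
      using F1 F2 F3 ijk by (metis less_imp_le less_trans fst_conv neg_le_0_iff_le zero_le_one order_trans)
    then show ?thesis using True F3 cl le_top f by metis
  next
    case False then show ?thesis using F1 F2 F3 cl ijk le_bottom f13 by metis
  qed
  obtain b where b: "b \<in> snd F1" "b \<in> snd F2" "b \<in> snd F3"
    using incident_triple[of "fst F1" "snd F1" "fst F2" "snd F2" "fst F3" "snd F3"] le12 le23 by auto
  have bc: "b \<in> carrier G" using b f13 coset_subset by (cases F1) (auto simp: faces_iff)
  have "F \<in> coset_flag b" if F: "F \<in> \<Psi>" for F
  proof -
    obtain m A where FA: "F = (m, A)" by force
    note mA = chain_faces[OF \<Psi> F[unfolded FA]]
    have "A = H m #> b"
    proof (cases "m < 0 \<or> 3 < m")
      case True then show ?thesis using mA carrier_coset coset_improper bc by simp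
    next
      case False
      then have "m \<in> {i, j, k}" using missing F FA ijk(1) by auto
      moreover have "A = (SOME A. (m, A) \<in> \<Psi>)"
        using chain_same_rank[OF \<Psi>] F FA by (metis someI)
      ultimately have "b \<in> A" using b F FA by (auto simp: F1_def F2_def F3_def split: if_splits)
      then show ?thesis using coset_eq mA by blast
    qed
    then show ?thesis using FA mA by (auto simp: coset_flag_def)
  qed
  then show thesis using that bc by blast
qed

lemma fst_coset_flag: "fst ` coset_flag b = {-1..4}"
  by (force simp: coset_flag_def)

text \<open>A maximal chain without a face of some proper rank would lie in a
  \<open>coset_flag\<close>, hence equal it by maximality; but a \<open>coset_flag\<close> has faces
  of all ranks. Conversely, two faces of one rank in a chain coincide, so a chain meeting all ranks
  cannot be enlarged.\<close>

lemma flag_iff: "\<Psi> \<in> flags \<Q> \<longleftrightarrow> \<Psi> \<in> Chains (le \<Q>) \<and> fst ` \<Psi> = {-1..4}"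
proof
  assume fl: "\<Psi> \<in> flags \<Q>"
  then have ch: "\<Psi> \<in> Chains (le \<Q>)" and mx: "\<And>\<Psi>'. \<lbrakk>\<Psi>' \<in> Chains (le \<Q>); \<Psi> \<subseteq> \<Psi>'\<rbrakk> \<Longrightarrow> \<Psi>' = \<Psi>"
    by (auto simp: flags_def)
  have "F \<in> faces \<Q>" if "F \<in> \<Psi>" for F
    using chain_faces[OF ch] that by (cases F) (auto simp: faces_iff)
  moreover have "(-1, carrier G) \<in> faces \<Q>" "(4, carrier G) \<in> faces \<Q>"
    by (auto simp: faces_iff carrier_coset)
  ultimately have "insert (-1, carrier G) \<Psi> \<in> Chains (le \<Q>)" "insert (4, carrier G) \<Psi> \<in> Chains (le \<Q>)"
    using ch le_bottom le_top unfolding Chains_def by auto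
  then have "(-1, carrier G) \<in> \<Psi>" "(4, carrier G) \<in> \<Psi>" using mx by blast+
  then have m: "-1 \<in> fst ` \<Psi>" "4 \<in> fst ` \<Psi>" by force+
  have "a \<in> fst ` \<Psi>" if a: "a \<in> {0..3}" for a
  proof (rule ccontr)
    assume na: "a \<notin> fst ` \<Psi>"
    then have "(a, A) \<notin> \<Psi>" for A by (metis fst_conv image_eqI)
    then obtain b where "b \<in> carrier G" "\<Psi> \<subseteq> coset_flag b" using chain_missing_rank[OF ch a] by metis
    then have "coset_flag b = \<Psi>" using mx coset_flag_chain by blast
    then have "fst ` \<Psi> = {-1..4}" using fst_coset_flag by blast
    then show False using a na by simp
  qed
  then have "{0..3} \<subseteq> fst ` \<Psi>" by blast
  moreover have "{-1..4} = insert (-1) (insert 4 {0..3::int})" by auto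
  moreover have "fst ` \<Psi> \<subseteq> {-1..4}" using chain_faces[OF ch] by auto
  ultimately have "fst ` \<Psi> = {-1..4}" using m by (intro subset_antisym) simp_all
  then show "\<Psi> \<in> Chains (le \<Q>) \<and> fst ` \<Psi> = {-1..4}" using ch by simp
next
  assume *: "\<Psi> \<in> Chains (le \<Q>) \<and> fst ` \<Psi> = {-1..4}"
  have "\<Psi>' = \<Psi>" if "\<Psi>' \<in> Chains (le \<Q>)" "\<Psi> \<subseteq> \<Psi>'" for \<Psi>'
  proof -
    have sub: "fst ` \<Psi>' \<subseteq> fst ` \<Psi>" using * chain_faces[OF that(1)] by auto
    have "\<Psi>' \<subseteq> \<Psi>"
    proof
      fix F assume F: "F \<in> \<Psi>'"
      then obtain F' where F': "F' \<in> \<Psi>" "fst F = fst F'" using sub by blast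
      then have "F = F'" using chain_inj[OF that(1)] F that(2) by (meson inj_onD subsetD)
      then show "F \<in> \<Psi>" using F' by simp
    qed
    then show ?thesis using that(2) by blast
  qed
  then show "\<Psi> \<in> flags \<Q>" using * by (auto simp: flags_def)
qed

lemma coset_flag_flag: "b \<in> carrier G \<Longrightarrow> coset_flag b \<in> flags \<Q>"
  by (simp add: flag_iff coset_flag_chain fst_coset_flag)

lemma card_flag: "\<Psi> \<in> flags \<Q> \<Longrightarrow> card \<Psi> = 6"
  using chain_inj[of \<Psi>] card_image[of fst \<Psi>] by (simp add: flag_iff)

text \<open>For a common point \<open>b\<close> of the two given cosets, the cosets in between are
  those of \<open>h \<otimes> b\<close> with \<open>h\<close> in
  \<open>H i \<inter> H (i + 2)\<close>. By \<open>H_index\<close> such \<open>h\<close> fall into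
  just two cosets of \<open>H (i + 1)\<close>, represented by \<open>\<one>\<close> and
  \<open>s\<close>.\<close>

lemma diamond_Q: "diamond_condition \<Q>"
  unfolding diamond_condition_def
proof (intro allI impI)
  fix F F' assume *: "(F, F') \<in> le \<Q> \<and> rk \<Q> F' = rk \<Q> F + 2"
  then obtain i A B where e: "F = (i, A)" "F' = (i + 2, B)" by (metis rk_Q prod.collapse)
  have i: "-1 \<le> i" "i \<le> 2" and A: "A \<in> rcosets (H i)" and B: "B \<in> rcosets (H (i + 2))"
    using * e by (auto simp: le_iff)
  obtain b where b: "b \<in> A" "b \<in> B" using * e by (auto simp: le_iff)
  have bc: "b \<in> carrier G" using b A coset_subset by blast
  have Ab: "A = H i #> b" and Bb: "B = H (i + 2) #> b" using coset_eq A B b by auto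
  obtain s where s: "s \<in> H i" "s \<in> H (i + 2)" "s \<notin> H (i + 1)"
    and s2: "\<And>h. \<lbrakk>h \<in> H i; h \<in> H (i + 2)\<rbrakk> \<Longrightarrow> h \<in> H (i + 1) \<or> h \<otimes> inv s \<in> H (i + 1)"
    using H_index[OF i] by blast
  have sc: "s \<in> carrier G" using s H_subset by blast
  let ?M = "{K. (F, K) \<in> le \<Q> \<and> (K, F') \<in> le \<Q> \<and> rk \<Q> K = rk \<Q> F + 1}"
  have sb: "s \<otimes> b \<in> A" "s \<otimes> b \<in> B" using Ab Bb s by (auto simp: r_coset_def)
  have "?M = {(i + 1, H (i + 1) #> b), (i + 1, H (i + 1) #> (s \<otimes> b))}"
  proof (intro subset_antisym subsetI)
    fix K assume K: "K \<in> ?M"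
    obtain C where C: "K = (i + 1, C)" using K e by (metis (mono_tags) mem_Collect_eq rk_Q fst_conv prod.collapse)
    have Cc: "C \<in> rcosets (H (i + 1))" using K C e by (auto simp: le_iff)
    obtain c where c: "c \<in> A" "c \<in> C" "c \<in> B" using incident_triple K C e by (metis (mono_tags, lifting) mem_Collect_eq)
    have cc: "c \<in> carrier G" using c A coset_subset by blast
    have h: "c \<otimes> inv b \<in> H i" "c \<otimes> inv b \<in> H (i + 2)"
      using coset_eq[OF A c(1)] coset_eq[OF B c(3)] Ab Bb coset_eq_iff bc cc by auto
    from s2[OF h] show "K \<in> {(i + 1, H (i + 1) #> b), (i + 1, H (i + 1) #> (s \<otimes> b))}"
    proof
      assume "c \<otimes> inv b \<in> H (i + 1)"
      then have "H (i + 1) #> b = H (i + 1) #> c" using coset_eq_iff bc cc by blast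
      then show ?thesis using C coset_eq[OF Cc c(2)] by simp
    next
      assume "c \<otimes> inv b \<otimes> inv s \<in> H (i + 1)"
      then have "H (i + 1) #> (s \<otimes> b) = H (i + 1) #> c"
        using coset_eq_iff bc cc sc by (simp add: m_assoc inv_mult_group)
      then show ?thesis using C coset_eq[OF Cc c(2)] by simp
    qed
  next
    fix K assume K: "K \<in> {(i + 1, H (i + 1) #> b), (i + 1, H (i + 1) #> (s \<otimes> b))}"
    have "b \<in> H (i + 1) #> b" "s \<otimes> b \<in> H (i + 1) #> (s \<otimes> b)" using mem_coset_self bc sc by auto
    then show "K \<in> ?M" using K e A B b sb i coset_in bc sc by (auto simp: le_iff)
  qed
  moreover have "H (i + 1) #> b \<noteq> H (i + 1) #> (s \<otimes> b)"
    using s(3) bc sc by (simp add: coset_eq_iff m_assoc)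
  ultimately show "card ?M = 2" by simp
qed

lemma flag_missing_rank:
  assumes "\<Psi> \<in> flags \<Q>" "a \<in> {0..3}"
  obtains b where "b \<in> carrier G" "\<And>F. fst F \<noteq> a \<Longrightarrow> F \<in> \<Psi> \<longleftrightarrow> F \<in> coset_flag b"
proof -
  have "{F \<in> \<Psi>. fst F \<noteq> a} \<in> Chains (le \<Q>)"
    using assms(1) by (auto simp: flag_iff Chains_def)
  then obtain b where b: "b \<in> carrier G" "{F \<in> \<Psi>. fst F \<noteq> a} \<subseteq> coset_flag b"
    using chain_missing_rank[OF _ assms(2)] by (metis (mono_tags, lifting) fst_conv mem_Collect_eq)
  moreover have "F \<in> \<Psi>" if F: "fst F \<noteq> a" "F \<in> coset_flag b" for F
  proof -
    have "fst F \<in> fst ` \<Psi>" using F fst_coset_flag[of b] assms(1) by (auto simp: flag_iff)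
    then obtain F' where F': "F' \<in> \<Psi>" "fst F' = fst F" by auto
    then have "F' \<in> coset_flag b" using b F by auto
    then have "F' = F" using chain_inj[OF coset_flag_chain[OF b(1)]] F F' by (auto dest: inj_onD)
    then show ?thesis using F' by simp
  qed
  ultimately show thesis using that by blast
qed

lemma flags_agree_step:
  assumes "A \<in> flags \<Q>" "B \<in> flags \<Q>" "\<And>F. fst F \<noteq> j \<Longrightarrow> F \<in> A \<longleftrightarrow> F \<in> B" "D \<subseteq> A" "D \<subseteq> B"
  shows "(A, B) \<in> {(A, B). adjacent_flags \<Q> A B \<and> D \<subseteq> A \<and> D \<subseteq> B}\<^sup>*"
proof (cases "A = B")
  case False
  have *: "card (X - Y) = 1" if XY: "X \<in> flags \<Q>" "Y \<in> flags \<Q>" "X \<noteq> Y"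
    "\<And>F. fst F \<noteq> j \<Longrightarrow> F \<in> X \<longleftrightarrow> F \<in> Y" for X Y
  proof -
    have inj: "inj_on fst X" using XY(1) chain_inj by (auto simp: flag_iff)
    have "\<not> X \<subseteq> Y" using XY(1-3) by (auto simp: flags_def)
    then obtain F where F: "F \<in> X" "F \<notin> Y" by blast
    have "X - Y = {F}"
    proof -
      have "F' = F" if "F' \<in> X" "F' \<notin> Y" for F'
        using that F XY(4) inj by (metis inj_onD)
      then show ?thesis using F by blast
    qed
    then show ?thesis by simp
  qed
  have "card (A - B) = 1" "card (B - A) = 1" using *[of A B] *[of B A] assms False by auto
  then show ?thesis using assms by (intro r_into_rtrancl) (simp add: adjacent_flags_def)
qed simp

text \<open>The element \<open>t\<close> moves only the faces of ranks \<open>a\<close> and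
  \<open>c\<close>, and these are changed one after the other. The factorization of \<open>t\<close>
  ensures that the flag halfway really is a flag: with \<open>t = u \<otimes> v\<close>, the point
  \<open>v \<otimes> b\<close> lies in the old \<open>a\<close>-face and in the new
  \<open>c\<close>-face.\<close>

lemma rotation_step:
  assumes b: "b \<in> carrier G" and t: "t \<in> carrier G" and I: "a \<in> I" "c \<in> I" "I \<subseteq> {0..3}"
    and fix_t: "\<forall>j \<in> {0..3} - {a, c}. t \<in> H j" and prod: "t \<in> H c <#> H a"
    and D: "D \<subseteq> coset_flag b" "\<And>F. F \<in> D \<Longrightarrow> fst F \<notin> I"
  shows "(coset_flag b, coset_flag (t \<otimes> b)) \<in> {(A, B). adjacent_flags \<Q> A B \<and> D \<subseteq> A \<and> D \<subseteq> B}\<^sup>*"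
proof -
  let ?R = "{(A, B). adjacent_flags \<Q> A B \<and> D \<subseteq> A \<and> D \<subseteq> B}"
  \<comment> \<open>The flag \<open>X\<close> halfway has the new face in rank \<open>c\<close> and
    the old faces elsewhere; it may lie in the other orbit, so it is given face by face.\<close>
  define f where "f j = (if j = c then H j #> (t \<otimes> b) else H j #> b)" for j
  define X where "X = {(j, f j) |j. -1 \<le> j \<and> j \<le> 4}"
  have tb: "t \<otimes> b \<in> carrier G" using t b by simp
  have same: "H j #> (t \<otimes> b) = H j #> b" if "j \<noteq> a" "j \<noteq> c" for j
  proof (cases "j \<in> {0..3}")
    case True then show ?thesis using fix_t that b by (simp add: coset_absorb)
  next
    case False then show ?thesis using coset_improper b tb by auto
  qed
  obtain u v where uv: "t = u \<otimes> v" "u \<in> H c" "v \<in> H a" using prod by (auto simp: set_mult_def)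
  have uvc: "u \<in> carrier G" "v \<in> carrier G" using uv H_subset by blast+
  have "v \<otimes> b \<in> H a #> b" using uv by (auto simp: r_coset_def)
  moreover have "v \<otimes> b \<in> H c #> (t \<otimes> b)"
  proof -
    have "H c #> (t \<otimes> b) = H c #> (v \<otimes> b)" using uv uvc b by (simp add: m_assoc coset_absorb)
    then show ?thesis using mem_coset_self uvc b by simp
  qed
  ultimately have va: "f a \<inter> f c \<noteq> {}" unfolding f_def by auto
  have meet: "f i \<inter> f j \<noteq> {}" for i j
  proof -
    have bb: "b \<in> H m #> b" "t \<otimes> b \<in> H m #> (t \<otimes> b)" for m using mem_coset_self b tb by auto
    then show ?thesis using va same unfolding f_def
      by (cases "i = c"; cases "j = c"; cases "i = a"; cases "j = a")
         (auto; metis disjoint_iff)+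
  qed
  have "f j \<in> rcosets (H j)" for j unfolding f_def using coset_in b tb by simp
  then have "X \<in> Chains (le \<Q>)"
    unfolding Chains_def X_def using meet by (auto simp: le_iff)
  moreover have "fst ` X = {-1..4}" unfolding X_def by force
  ultimately have X: "X \<in> flags \<Q>" by (simp add: flag_iff)
  have DX: "D \<subseteq> X"
  proof
    fix F assume "F \<in> D"
    then show "F \<in> X" using D I unfolding X_def coset_flag_def f_def by fastforce
  qed
  have Dt: "D \<subseteq> coset_flag (t \<otimes> b)"
  proof
    fix F assume F: "F \<in> D"
    then obtain j where j: "F = (j, H j #> b)" "-1 \<le> j" "j \<le> 4" using D by (auto simp: coset_flag_def)
    then have "j \<noteq> a" "j \<noteq> c" using D(2)[OF F] I by auto
    then show "F \<in> coset_flag (t \<otimes> b)" using j same by (auto simp: coset_flag_def)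
  qed
  have "(coset_flag b, X) \<in> ?R\<^sup>*"
    by (rule flags_agree_step[of _ _ c]) (use X DX D coset_flag_flag[OF b] in \<open>auto simp: X_def f_def coset_flag_def\<close>)
  moreover have "(X, coset_flag (t \<otimes> b)) \<in> ?R\<^sup>*"
    by (rule flags_agree_step[of _ _ a])
       (use X DX Dt coset_flag_flag[OF tb] same in \<open>auto simp: X_def f_def coset_flag_def\<close>)
  ultimately show ?thesis by (rule rtrancl_trans)
qed

text \<open>A \<open>rotation_step\<close> starts at an arbitrary representative, so a word in the
  generators can be walked letter by letter, the rightmost first; this is why \<open>b\<close> is
  generalized in the induction. An inverse letter is a step traversed backwards, using symmetry of
  adjacency.\<close>

lemma rotation_path:
  assumes h: "h \<in> generate G {t \<in> carrier G. \<exists>a \<in> I. \<exists>c \<in> I.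
        (\<forall>j \<in> {0..3} - {a, c}. t \<in> H j) \<and> t \<in> H c <#> H a}" and I: "I \<subseteq> {0..3}"
    and b: "b \<in> carrier G"
    and D: "D \<subseteq> coset_flag b" "\<And>F. F \<in> D \<Longrightarrow> fst F \<notin> I"
  shows "(coset_flag b, coset_flag (h \<otimes> b)) \<in> {(A, B). adjacent_flags \<Q> A B \<and> D \<subseteq> A \<and> D \<subseteq> B}\<^sup>*"
    (is "_ \<in> ?R\<^sup>*")
proof -
  let ?S = "{t \<in> carrier G. \<exists>a \<in> I. \<exists>c \<in> I.
        (\<forall>j \<in> {0..3} - {a, c}. t \<in> H j) \<and> t \<in> H c <#> H a}"
  have sym: "sym (?R\<^sup>*)" by (rule sym_rtrancl) (auto simp: sym_def adjacent_flags_def)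
  have stay: "D \<subseteq> B" if "(A, B) \<in> ?R\<^sup>*" "D \<subseteq> A" for A B
    using that by (induction rule: rtrancl_induct) auto
  have S: "?S \<subseteq> carrier G" by blast
  from h b D(1) show ?thesis
  proof (induction arbitrary: b rule: generate.induct)
    case one then show ?case by simp
  next
    case (incl t)
    then show ?case using rotation_step[OF incl(2)] I D(2) by blast
  next
    case (inv t)
    then have t: "t \<in> carrier G" by simp
    have "D \<subseteq> coset_flag (inv t \<otimes> b)"
    proof
      fix F assume F: "F \<in> D"
      then obtain j where j: "F = (j, H j #> b)" "-1 \<le> j" "j \<le> 4" using inv by (auto simp: coset_flag_def)
      have "t \<in> H j" if "j \<in> {0..3}"
        using inv(1) D(2)[OF F] j that by auto
      then have "H j #> (inv t \<otimes> b) = H j #> b"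
        using inv(2) t coset_improper[of j] H_subgroup[of j]
        by (cases "j \<in> {0..3}") (auto simp: coset_absorb subgroup.m_inv_closed)
      then show "F \<in> coset_flag (inv t \<otimes> b)" using j by (auto simp: coset_flag_def)
    qed
    then have "(coset_flag (inv t \<otimes> b), coset_flag (t \<otimes> (inv t \<otimes> b))) \<in> ?R\<^sup>*"
      using rotation_step[of "inv t \<otimes> b" t] inv t I D(2) by blast
    moreover have "t \<otimes> (inv t \<otimes> b) = b" using t inv(2) by (simp flip: m_assoc)
    ultimately have "(coset_flag (inv t \<otimes> b), coset_flag b) \<in> ?R\<^sup>*" by simp
    then show ?case by (rule symD[OF sym])
  next
    case (eng h1 h2)
    have hc: "h1 \<in> carrier G" "h2 \<in> carrier G"
      using eng generate_in_carrier[OF S] by blast+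
    have p2: "(coset_flag b, coset_flag (h2 \<otimes> b)) \<in> ?R\<^sup>*" using eng by blast
    then have "D \<subseteq> coset_flag (h2 \<otimes> b)" using stay eng by blast
    then have "(coset_flag (h2 \<otimes> b), coset_flag (h1 \<otimes> (h2 \<otimes> b))) \<in> ?R\<^sup>*" using eng hc by blast
    with p2 show ?case using hc eng(5) by (simp add: m_assoc)
  qed
qed

text \<open>Let \<open>I\<close> be the set of proper ranks in which the flags share no face. At a
  rank \<open>a\<close> in \<open>I\<close> the faces may be changed freely, which turns both flags
  into flags \<open>coset_flag b\<close> and \<open>coset_flag b'\<close>. The quotient
  \<open>b' \<otimes> inv b\<close> fixes all shared base faces, so \<open>H_generated\<close>
  writes it in rotations that move only ranks in \<open>I\<close>, and \<open>rotation_path\<close>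
  joins the two.\<close>

lemma strongly_connected_Q: "strongly_flag_connected \<Q>"
  unfolding strongly_flag_connected_def
proof (intro ballI)
  fix \<Theta> \<Theta>' assume fl: "\<Theta> \<in> flags \<Q>" "\<Theta>' \<in> flags \<Q>"
  let ?D = "\<Theta> \<inter> \<Theta>'"
  let ?R = "{(A, B). adjacent_flags \<Q> A B \<and> ?D \<subseteq> A \<and> ?D \<subseteq> B}"
  define I where "I = {j \<in> {0..3}. j \<notin> fst ` ?D}"
  show "(\<Theta>, \<Theta>') \<in> ?R\<^sup>*"
  proof (cases "I = {}")
    case True
    have "\<Theta> \<subseteq> \<Theta>'"
    proof
      fix F assume F: "F \<in> \<Theta>"
      obtain j A where jA: "F = (j, A)" by force
      have ch: "\<Theta> \<in> Chains (le \<Q>)" "\<Theta>' \<in> Chains (le \<Q>)" using fl by (auto simp: flag_iff)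
      note jA' = chain_faces[OF ch(1) F[unfolded jA]]
      show "F \<in> \<Theta>'"
      proof (cases "j \<in> {0..3}")
        case True
        then obtain F' where "F' \<in> ?D" "fst F' = j" using \<open>I = {}\<close> unfolding I_def by blast
        then show ?thesis using F jA chain_inj[OF ch(1)] by (metis IntE fst_conv inj_onD)
      next
        case False
        then have A: "A = carrier G" using jA' carrier_coset by auto
        have "j \<in> fst ` \<Theta>'" using fl(2) jA' by (simp add: flag_iff)
        then obtain B where "(j, B) \<in> \<Theta>'" by auto
        moreover from this have "B = carrier G" using chain_faces[OF ch(2), of j B] False carrier_coset[of j B] by auto
        ultimately show ?thesis using A jA by simp
      qed
    qed
    then have "\<Theta> = \<Theta>'" using fl by (auto simp: flags_def)
    then show ?thesis by simp
  next
    case False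
    then obtain a where a: "a \<in> I" by blast
    then have a3: "a \<in> {0..3}" and aD: "a \<notin> fst ` ?D" by (auto simp: I_def)
    obtain b where b: "b \<in> carrier G" "\<And>F. fst F \<noteq> a \<Longrightarrow> F \<in> \<Theta> \<longleftrightarrow> F \<in> coset_flag b"
      using flag_missing_rank[OF fl(1) a3] by metis
    obtain b' where b': "b' \<in> carrier G" "\<And>F. fst F \<noteq> a \<Longrightarrow> F \<in> \<Theta>' \<longleftrightarrow> F \<in> coset_flag b'"
      using flag_missing_rank[OF fl(2) a3] by metis
    have Db: "?D \<subseteq> coset_flag b" "?D \<subseteq> coset_flag b'" 
    proof -
      have "fst F \<noteq> a" if "F \<in> ?D" for F using aD that by blast
      then show "?D \<subseteq> coset_flag b" "?D \<subseteq> coset_flag b'" using b(2) b'(2) by blast+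
    qed
    have 1: "(\<Theta>, coset_flag b) \<in> ?R\<^sup>*"
      by (rule flags_agree_step[of _ _ a]) (use fl b coset_flag_flag Db in auto)
    have 3: "(coset_flag b', \<Theta>') \<in> ?R\<^sup>*"
      by (rule flags_agree_step[of _ _ a]) (use fl b' coset_flag_flag Db in auto)
    define g where "g = b' \<otimes> inv b"
    have gc: "g \<in> carrier G" using b b' by (simp add: g_def)
    have "g \<in> H j" if j: "j \<in> {0..3} - I" for j
    proof -
      obtain A where "(j, A) \<in> ?D" using j unfolding I_def by auto
      then have "(j, A) \<in> coset_flag b" "(j, A) \<in> coset_flag b'" using Db by auto
      then have "H j #> b = H j #> b'" by (auto simp: coset_flag_def)
      then show ?thesis using coset_eq_iff b b' by (simp add: g_def)
    qed
    then have "g \<in> generate G {t \<in> carrier G. \<exists>a \<in> I. \<exists>c \<in> I.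
        (\<forall>j \<in> {0..3} - {a, c}. t \<in> H j) \<and> t \<in> H c <#> H a}"
      by (intro H_generated) (auto simp: gc I_def)
    then have "(coset_flag b, coset_flag (g \<otimes> b)) \<in> ?R\<^sup>*"
      by (rule rotation_path) (use b Db in \<open>auto simp: I_def\<close>)
    moreover have "g \<otimes> b = b'" using b b' by (simp add: g_def m_assoc)
    ultimately have 2: "(coset_flag b, coset_flag b') \<in> ?R\<^sup>*" by simp
    show ?thesis using 1 2 3 by (meson rtrancl_trans)
  qed
qed

theorem polytope_coset_poset: "polytope \<Q>"
proof -
  have bt: "(-1, carrier G) \<in> faces \<Q>" "(4, carrier G) \<in> faces \<Q>"
    by (auto simp: faces_iff carrier_coset)
  have "base \<Q> = coset_flag \<one>"
    using H_subset by (auto simp: coset_poset_def coset_flag_def coset_mult_one)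
  then have "base \<Q> \<in> flags \<Q>" using coset_flag_flag by simp
  moreover have "rk \<Q> F < rk \<Q> F'" if "(F, F') \<in> le \<Q>" "F \<noteq> F'" for F F'
    using that same_rank_eq by (cases F; cases F') (auto simp: le_iff order.order_iff_strict)
  moreover have "- 1 \<le> rk \<Q> F \<and> rk \<Q> F \<le> int (dim \<Q>)" if "F \<in> faces \<Q>" for F
    using that by (cases F) (auto simp: faces_iff)
  moreover have "\<exists>F \<in> faces \<Q>. rk \<Q> F = - 1 \<and> (\<forall>F' \<in> faces \<Q>. (F, F') \<in> le \<Q>)"
    using bt(1) le_bottom by (intro bexI[of _ "(-1, carrier G)"]) auto
  moreover have "\<exists>F \<in> faces \<Q>. rk \<Q> F = int (dim \<Q>) \<and> (\<forall>F' \<in> faces \<Q>. (F', F) \<in> le \<Q>)"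
    using bt(2) le_top by (intro bexI[of _ "(4, carrier G)"]) auto
  ultimately show ?thesis
    using partial_order_Q diamond_Q strongly_connected_Q card_flag by (auto simp: polytope_def)
qed

end

section \<open>Groups generated by rotations\<close>

lemma (in group) inv_mult_cancel:
  "\<lbrakk>a \<in> carrier G; b \<in> carrier G\<rbrakk> \<Longrightarrow> inv a \<otimes> (a \<otimes> b) = b"
  "\<lbrakk>a \<in> carrier G; b \<in> carrier G\<rbrakk> \<Longrightarrow> a \<otimes> (inv a \<otimes> b) = b"
  by (simp_all flip: m_assoc)

text \<open>The two relations say that conjugation by \<open>s\<close> inverts \<open>c\<close>, so
  \<open>s\<close> normalizes the cyclic group generated by \<open>c\<close>.\<close>

lemma (in group) generate_commute_involution:
  assumes s: "s \<in> carrier G" and c: "c \<in> carrier G"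
    and "s \<otimes> s = \<one>" and "(s \<otimes> c) \<otimes> (s \<otimes> c) = \<one>" and k: "k \<in> generate G {c}"
  shows "\<exists>k' \<in> generate G {c}. k \<otimes> s = s \<otimes> k'"
proof -
  have inv_s: "inv s = s" using assms inv_equality by blast
  have "inv (s \<otimes> c) = s \<otimes> c" using assms by (simp add: inv_equality)
  then have e: "s \<otimes> c = inv c \<otimes> s" using s c inv_s by (simp add: inv_mult_group)
  have cs: "c \<otimes> s = s \<otimes> inv c"
  proof -
    have "c \<otimes> s = c \<otimes> (s \<otimes> c) \<otimes> inv c" using s c by (simp add: m_assoc)
    also have "\<dots> = s \<otimes> inv c" using s c by (simp add: e flip: m_assoc)
    finally show ?thesis .
  qed
  from k show ?thesis
  proof induction
    case one then show ?case using s generate.one[of G "{c}"] by (intro bexI[of _ \<one>]) auto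
  next
    case (incl h)
    then show ?case using cs generate.inv[of c "{c}" G] by (intro bexI[of _ "inv c"]) auto
  next
    case (inv h)
    then show ?case using e generate.incl[of c "{c}" G] by (intro bexI[of _ c]) auto
  next
    case (eng h1 h2)
    then obtain k1 k2 where k: "k1 \<in> generate G {c}" "h1 \<otimes> s = s \<otimes> k1"
      "k2 \<in> generate G {c}" "h2 \<otimes> s = s \<otimes> k2" by blast
    have car: "h1 \<in> carrier G" "h2 \<in> carrier G" "k1 \<in> carrier G" "k2 \<in> carrier G"
      using eng k c generate_in_carrier[of "{c}"] by auto
    have "h1 \<otimes> h2 \<otimes> s = h1 \<otimes> (s \<otimes> k2)" using car s by (simp only: m_assoc k(4))
    also have "\<dots> = h1 \<otimes> s \<otimes> k2" using car s by (simp only: m_assoc)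
    also have "\<dots> = s \<otimes> (k1 \<otimes> k2)" using car s by (simp only: k(2) m_assoc)
    finally show ?case using generate.eng[OF k(1,3)] by blast
  qed
qed

text \<open>The cyclic group generated by \<open>c\<close> is normalized by the involution
  \<open>s\<close>, so together with one coset it exhausts the group. Both orders are recorded
  because the coset arguments need the involution on a prescribed side.\<close>

lemma (in group) dihedral_normal_form:
  assumes s: "s \<in> carrier G" and c: "c \<in> carrier G"
    and ss: "s \<otimes> s = \<one>" and sc: "(s \<otimes> c) \<otimes> (s \<otimes> c) = \<one>" and h: "h \<in> generate G {s, c}"
  shows "\<exists>k \<in> generate G {c}. h = k \<or> h = s \<otimes> k"
    and "\<exists>k \<in> generate G {c}. h = k \<or> h = k \<otimes> s"
proof -
  let ?C = "generate G {c}"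
  note comm = generate_commute_involution[OF assms(1-4)]
  have C: "?C \<subseteq> carrier G" using generate_in_carrier[of "{c}"] c by auto
  have inv_s: "inv s = s" using assms inv_equality by blast
  from h show L: "\<exists>k \<in> ?C. h = k \<or> h = s \<otimes> k"
  proof induction
    case one then show ?case using generate.one by blast
  next
    case (incl h)
    then consider "h = s" | "h = c" by blast
    then show ?case
    proof cases
      case 1 then show ?thesis using s generate.one[of G "{c}"] by (intro bexI[of _ \<one>]) auto
    next
      case 2 then show ?thesis using generate.incl[of c "{c}" G] by blast
    qed
  next
    case (inv h)
    then consider "h = s" | "h = c" by blast
    then show ?case
    proof cases
      case 1 then show ?thesis using s inv_s generate.one[of G "{c}"] by (intro bexI[of _ \<one>]) auto
    next
      case 2 then show ?thesis using generate.inv[of c "{c}" G] by blast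
    qed
  next
    case (eng h1 h2)
    obtain k1 k2 where k: "k1 \<in> ?C" "h1 = k1 \<or> h1 = s \<otimes> k1" "k2 \<in> ?C" "h2 = k2 \<or> h2 = s \<otimes> k2"
      using eng by blast
    obtain k' where k': "k' \<in> ?C" "k1 \<otimes> s = s \<otimes> k'" using comm[OF k(1)] by blast
    have car: "k1 \<in> carrier G" "k2 \<in> carrier G" "k' \<in> carrier G" using k k' C by auto
    have in_C: "k1 \<otimes> k2 \<in> ?C" "k' \<otimes> k2 \<in> ?C" using k k' generate.eng by auto
    have "k1 \<otimes> (s \<otimes> k2) = s \<otimes> (k' \<otimes> k2)" using k'(2) car s by (simp flip: m_assoc)
    moreover from this have "s \<otimes> k1 \<otimes> (s \<otimes> k2) = k' \<otimes> k2" using car s ss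
      by (simp add: m_assoc) (simp flip: m_assoc)
    moreover have "s \<otimes> k1 \<otimes> k2 = s \<otimes> (k1 \<otimes> k2)" using car s by (simp add: m_assoc)
    ultimately show ?case using k in_C by metis
  qed
  have "\<exists>k' \<in> ?C. s \<otimes> k = k' \<otimes> s" if k: "k \<in> ?C" for k
  proof -
    obtain k' where k': "k' \<in> ?C" "k \<otimes> s = s \<otimes> k'" using comm[OF k] by blast
    have car: "k \<in> carrier G" "k' \<in> carrier G" using k k' C by auto
    have "s \<otimes> k = s \<otimes> (k \<otimes> s) \<otimes> s" using car s ss by (simp add: m_assoc)
    also have "\<dots> = k' \<otimes> s" using car s ss k' by (simp flip: m_assoc)
    finally show ?thesis using k' by blast
  qed
  then show "\<exists>k \<in> ?C. h = k \<or> h = k \<otimes> s" using L by metis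
qed

text \<open>This collects what remains to be checked for a concrete group. The relations make
  \<open>H 1\<close> and \<open>H 2\<close> dihedral; \<open>nontrivial\<close>, together with
  \<open>triple_trivial\<close>, keeps the involutions \<open>x 1 \<otimes> x 2\<close> and
  \<open>x 2 \<otimes> x 3\<close> out of the stabilizers of the faces they should move;
  \<open>middle_intersection\<close> is the one pairwise intersection to be supplied from
  outside.\<close>

locale rotation_generators = group_with_generators G x for G :: "'g monoid" (structure) and x +
  assumes x_closed: "x 1 \<in> carrier G" "x 2 \<in> carrier G" "x 3 \<in> carrier G"
    and carrier_generated: "carrier G = generate G {x 1, x 2, x 3}"
    and rel12: "(x 1 \<otimes> x 2) \<otimes> (x 1 \<otimes> x 2) = \<one>"
    and rel23: "(x 2 \<otimes> x 3) \<otimes> (x 2 \<otimes> x 3) = \<one>"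
    and rel13: "(x 1 \<otimes> x 2 \<otimes> x 3) \<otimes> (x 1 \<otimes> x 2 \<otimes> x 3) = \<one>"
    and nontrivial: "x 1 \<otimes> x 2 \<noteq> \<one>" "x 2 \<otimes> x 3 \<noteq> \<one>"
    and triple_trivial: "\<lbrakk>a \<in> {0..3}; \<forall>j \<in> {0..3} - {a}. g \<in> H j\<rbrakk> \<Longrightarrow> g = \<one>"
    and middle_intersection:
      "H 0 \<inter> H 3 \<subseteq> generate G {x 2}"
begin

abbreviation t12 where "t12 \<equiv> x 1 \<otimes> x 2"
abbreviation t23 where "t23 \<equiv> x 2 \<otimes> x 3"
abbreviation t13 where "t13 \<equiv> x 1 \<otimes> x 2 \<otimes> x 3"

lemma H_eq: "H j = generate G {y. y = x 1 \<and> j \<noteq> 0 \<and> j \<noteq> 1 \<or> y = x 2 \<and> j \<noteq> 1 \<and> j \<noteq> 2 \<or>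
    y = x 3 \<and> j \<noteq> 2 \<and> j \<noteq> 3 \<or> y = t12 \<and> j \<noteq> 0 \<and> j \<noteq> 2 \<or>
    y = t23 \<and> j \<noteq> 1 \<and> j \<noteq> 3 \<or> y = t13 \<and> j \<noteq> 0 \<and> j \<noteq> 3}"
proof -
  have tau: "tau G x 1 1 = x 1" "tau G x 2 2 = x 2" "tau G x 3 3 = x 3"
    "tau G x 1 2 = t12" "tau G x 2 3 = t23" "tau G x 1 3 = t13"
    using x_closed by (simp_all add: tau_def upt_rec m_assoc numeral_2_eq_2 numeral_3_eq_3)
  have ik: "1 \<le> i \<and> i \<le> k \<and> k \<le> 4 - 1 \<longleftrightarrow> i = 1 \<and> k = 1 \<or> i = 2 \<and> k = 2 \<or> i = 3 \<and> k = 3 \<or>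
      i = 1 \<and> k = 2 \<or> i = 2 \<and> k = 3 \<or> i = 1 \<and> k = 3" for i k :: nat
    by arith
  have "{tau G x i k |i k. 1 \<le> i \<and> i \<le> k \<and> k \<le> 4 - 1 \<and> i - 1 \<in> {m. m < 4 \<and> int m \<noteq> j} \<and>
          k \<in> {m. m < 4 \<and> int m \<noteq> j}} =
    {y. \<exists>i k. (i = 1 \<and> k = 1 \<or> i = 2 \<and> k = 2 \<or> i = 3 \<and> k = 3 \<or>
      i = 1 \<and> k = 2 \<or> i = 2 \<and> k = 3 \<or> i = 1 \<and> k = 3) \<and> (y = tau G x i k \<and>
      i - 1 < 4 \<and> int (i - 1) \<noteq> j \<and> k < 4 \<and> int k \<noteq> j)}"
    unfolding ik[symmetric] by blast
  also have "\<dots> = {y. y = tau G x 1 1 \<and> j \<noteq> 0 \<and> j \<noteq> 1 \<or> y = tau G x 2 2 \<and> j \<noteq> 1 \<and> j \<noteq> 2 \<or>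
    y = tau G x 3 3 \<and> j \<noteq> 2 \<and> j \<noteq> 3 \<or> y = tau G x 1 2 \<and> j \<noteq> 0 \<and> j \<noteq> 2 \<or>
    y = tau G x 2 3 \<and> j \<noteq> 1 \<and> j \<noteq> 3 \<or> y = tau G x 1 3 \<and> j \<noteq> 0 \<and> j \<noteq> 3}"
    unfolding conj_disj_distribR ex_disj_distrib conj_assoc by (rule Collect_cong) (simp; blast)
  finally show ?thesis unfolding face_stabilizer_def gen_subgroup_def tau by simp
qed

lemma H0: "H 0 = generate G {x 2, x 3, t23}"
  and H1: "H 1 = generate G {t12, x 3, t13}"
  and H2: "H 2 = generate G {x 1, t23, t13}"
  and H3: "H 3 = generate G {x 1, x 2, t12}"
  by (simp_all add: H_eq) (rule arg_cong[of _ _ "generate G"]; blast)+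

lemma t_closed: "t12 \<in> carrier G" "t23 \<in> carrier G" "t13 \<in> carrier G"
  using x_closed by simp_all

lemma H_subgroup: "subgroup (H j) G"
  unfolding H_eq by (rule generate_is_subgroup) (use x_closed in auto)

lemma H_subset: "H j \<subseteq> carrier G"
  using H_subgroup subgroup.subset by blast

lemma H_improper: "j < 0 \<or> 3 < j \<Longrightarrow> H j = carrier G"
proof -
  assume j: "j < 0 \<or> 3 < j"
  then have "j \<noteq> 0" "j \<noteq> 1" "j \<noteq> 2" "j \<noteq> 3" by auto
  then have "generate G {x 1, x 2, x 3} \<subseteq> H j"
    unfolding H_eq by (intro mono_generate) simp
  then show ?thesis using H_subset[of j] by (metis carrier_generated subset_antisym)
qed

lemma mem_H:
  "x 1 \<in> H 2" "x 1 \<in> H 3" "x 2 \<in> H 0" "x 2 \<in> H 3" "x 3 \<in> H 0" "x 3 \<in> H 1"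
  "t12 \<in> H 1" "t12 \<in> H 3" "t23 \<in> H 0" "t23 \<in> H 2" "t13 \<in> H 1" "t13 \<in> H 2"
  unfolding H0 H1 H2 H3 by (auto intro: generate.incl)

lemma generate_x_subset:
  "generate G {x 1} \<subseteq> H 2" "generate G {x 1} \<subseteq> H 3" "generate G {x 3} \<subseteq> H 0" "generate G {x 3} \<subseteq> H 1"
  unfolding H0 H1 H2 H3 by (rule mono_generate; simp)+

lemma generate_x_carrier: "generate G {x 1} \<subseteq> carrier G" "generate G {x 3} \<subseteq> carrier G"
  using generate_x_subset H_subset by blast+

lemma H_mult: "\<lbrakk>a \<in> H j; b \<in> H j\<rbrakk> \<Longrightarrow> a \<otimes> b \<in> H j"
  using H_subgroup subgroup.m_closed by metis

lemma H_inv: "a \<in> H j \<Longrightarrow> inv a \<in> H j"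
  using H_subgroup subgroup.m_inv_closed by metis

lemma H_cancel_right: "\<lbrakk>a \<otimes> b \<in> H j; b \<in> H j; a \<in> carrier G\<rbrakk> \<Longrightarrow> a \<in> H j"
  using H_mult[of "a \<otimes> b" j "inv b"] H_inv[of b j] H_subset[of j] by (auto simp: m_assoc subset_iff)

lemma H_cancel_left: "\<lbrakk>a \<otimes> b \<in> H j; a \<in> H j; b \<in> carrier G\<rbrakk> \<Longrightarrow> b \<in> H j"
  using H_mult[of "inv a" j "a \<otimes> b"] H_inv[of a j] H_subset[of j] by (auto simp: subset_iff simp flip: m_assoc)

text \<open>Since \<open>t13 = t12 \<otimes> x 3\<close>, the group is generated by
  \<open>t12\<close> and \<open>x 3\<close>, and \<open>rel12\<close> and \<open>rel13\<close> are
  the dihedral relations for this pair. The nontrivial coset of the cyclic part can be represented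
  by \<open>t12\<close> or by \<open>t13\<close>; both are recorded, as \<open>t12\<close> lies in
  \<open>H 3\<close> but \<open>t13\<close> in \<open>H 2\<close>.\<close>

lemma H1_forms:
  assumes "h \<in> H 1"
  shows "\<exists>k \<in> generate G {x 3}. h = k \<or> h = t12 \<otimes> k"
    and "\<exists>k \<in> generate G {x 3}. h = k \<or> h = k \<otimes> t12"
    and "\<exists>k \<in> generate G {x 3}. h = k \<or> h = t13 \<otimes> k"
proof -
  have "t12 \<in> generate G {t12, x 3}" "x 3 \<in> generate G {t12, x 3}"
    by (auto intro: generate.incl)
  then have "{t12, x 3, t13} \<subseteq> generate G {t12, x 3}"
    using generate.eng by auto
  moreover have "subgroup (generate G {t12, x 3}) G"
    using generate_is_subgroup x_closed by simp
  ultimately have "generate G {t12, x 3, t13} \<subseteq> generate G {t12, x 3}"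
    by (rule generate_subgroup_incl)
  then have h: "h \<in> generate G {t12, x 3}" using assms H1 by blast
  note forms = dihedral_normal_form[OF t_closed(1) x_closed(3) rel12 rel13 h]
  show left: "\<exists>k \<in> generate G {x 3}. h = k \<or> h = t12 \<otimes> k" by (fact forms(1))
  show "\<exists>k \<in> generate G {x 3}. h = k \<or> h = k \<otimes> t12" by (fact forms(2))
  have "inv (x 3) \<otimes> k \<in> generate G {x 3}" if "k \<in> generate G {x 3}" for k
    using that generate.inv[of "x 3" "{x 3}" G] generate.eng by auto
  moreover have "t12 \<otimes> k = t13 \<otimes> (inv (x 3) \<otimes> k)" if "k \<in> generate G {x 3}" for k
  proof -
    have "k \<in> carrier G" using that generate_x_carrier by blast
    then have "t13 \<otimes> (inv (x 3) \<otimes> k) = t12 \<otimes> (x 3 \<otimes> inv (x 3)) \<otimes> k"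
      using x_closed by (simp add: m_assoc inv_mult_cancel)
    then show ?thesis using x_closed by simp
  qed
  ultimately show "\<exists>k \<in> generate G {x 3}. h = k \<or> h = t13 \<otimes> k" using left by metis
qed

text \<open>The mirror image of \<open>H1_forms\<close>: now \<open>t13 = x 1 \<otimes> t23\<close>,
  the cyclic part is generated by \<open>x 1\<close>, and the involution stands on the right. Here
  \<open>t23\<close> lies in \<open>H 0\<close> and \<open>t13\<close> in
  \<open>H 1\<close>.\<close>

lemma H2_forms:
  assumes "h \<in> H 2"
  shows "\<exists>k \<in> generate G {x 1}. h = k \<or> h = k \<otimes> t23"
    and "\<exists>k \<in> generate G {x 1}. h = k \<or> h = k \<otimes> t13"
proof -
  have "t23 \<in> generate G {t23, x 1}" "x 1 \<in> generate G {t23, x 1}"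
    by (auto intro: generate.incl)
  moreover have t13_eq: "t13 = x 1 \<otimes> t23" using x_closed by (simp add: m_assoc)
  ultimately have "{x 1, t23, t13} \<subseteq> generate G {t23, x 1}"
    using generate.eng by auto
  moreover have "subgroup (generate G {t23, x 1}) G"
    using generate_is_subgroup x_closed by simp
  ultimately have "generate G {x 1, t23, t13} \<subseteq> generate G {t23, x 1}"
    by (rule generate_subgroup_incl)
  then have h: "h \<in> generate G {t23, x 1}" using assms H2 by blast
  \<comment> \<open>The dihedral relation is needed for \<open>t23 \<otimes> x 1\<close>, whereas
    \<open>rel13\<close> concerns \<open>x 1 \<otimes> t23\<close>; the two squares are conjugate by
    \<open>x 1\<close>.\<close>
  have "(t23 \<otimes> x 1) \<otimes> (t23 \<otimes> x 1) = inv (x 1) \<otimes> (t13 \<otimes> t13) \<otimes> x 1"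
  proof -
    have "inv (x 1) \<otimes> (t13 \<otimes> t13) \<otimes> x 1 = (inv (x 1) \<otimes> x 1) \<otimes> (t23 \<otimes> x 1 \<otimes> (t23 \<otimes> x 1))"
      unfolding t13_eq using x_closed t_closed by (simp add: m_assoc inv_mult_cancel)
    then show ?thesis using x_closed by simp
  qed
  then have rel: "(t23 \<otimes> x 1) \<otimes> (t23 \<otimes> x 1) = \<one>" using rel13 x_closed by simp
  show right: "\<exists>k \<in> generate G {x 1}. h = k \<or> h = k \<otimes> t23"
    by (fact dihedral_normal_form(2)[OF t_closed(2) x_closed(1) rel23 rel h])
  have "k \<otimes> inv (x 1) \<in> generate G {x 1}" if "k \<in> generate G {x 1}" for k
    using that generate.inv[of "x 1" "{x 1}" G] generate.eng by auto
  moreover have "k \<otimes> t23 = k \<otimes> inv (x 1) \<otimes> t13" if "k \<in> generate G {x 1}" for k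
  proof -
    have "k \<in> carrier G" using that generate_x_carrier by blast
    then have "k \<otimes> inv (x 1) \<otimes> t13 = k \<otimes> ((inv (x 1) \<otimes> x 1) \<otimes> t23)"
      unfolding t13_eq using x_closed t_closed by (simp add: m_assoc inv_mult_cancel)
    then show ?thesis using x_closed by simp
  qed
  ultimately show "\<exists>k \<in> generate G {x 1}. h = k \<or> h = k \<otimes> t13" using right by metis
qed

lemma triple_trivial':
  "\<lbrakk>g \<in> H 1; g \<in> H 2; g \<in> H 3\<rbrakk> \<Longrightarrow> g = \<one>" "\<lbrakk>g \<in> H 0; g \<in> H 2; g \<in> H 3\<rbrakk> \<Longrightarrow> g = \<one>"
  "\<lbrakk>g \<in> H 0; g \<in> H 1; g \<in> H 3\<rbrakk> \<Longrightarrow> g = \<one>" "\<lbrakk>g \<in> H 0; g \<in> H 1; g \<in> H 2\<rbrakk> \<Longrightarrow> g = \<one>"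
proof -
  have e: "{0..3::int} = {0, 1, 2, 3}" by auto
  show "\<lbrakk>g \<in> H 1; g \<in> H 2; g \<in> H 3\<rbrakk> \<Longrightarrow> g = \<one>" using triple_trivial[of 0 g] by (auto simp: e)
  show "\<lbrakk>g \<in> H 0; g \<in> H 2; g \<in> H 3\<rbrakk> \<Longrightarrow> g = \<one>" using triple_trivial[of 1 g] by (auto simp: e)
  show "\<lbrakk>g \<in> H 0; g \<in> H 1; g \<in> H 3\<rbrakk> \<Longrightarrow> g = \<one>" using triple_trivial[of 2 g] by (auto simp: e)
  show "\<lbrakk>g \<in> H 0; g \<in> H 1; g \<in> H 2\<rbrakk> \<Longrightarrow> g = \<one>" using triple_trivial[of 3 g] by (auto simp: e)
qed

text \<open>Apart from the assumed second claim, one of the two stabilizers is dihedral, and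
  \<open>g\<close> is taken in normal form there. For a cyclic intersection, an occurring involution
  would lie in a third stabilizer and be trivial; for an intersection of order two, the cyclic part
  lies in a third stabilizer and is trivial.\<close>

lemma pair_intersections:
  "\<lbrakk>g \<in> H 2; g \<in> H 3\<rbrakk> \<Longrightarrow> g \<in> generate G {x 1}"
  "\<lbrakk>g \<in> H 0; g \<in> H 3\<rbrakk> \<Longrightarrow> g \<in> generate G {x 2}"
  "\<lbrakk>g \<in> H 0; g \<in> H 1\<rbrakk> \<Longrightarrow> g \<in> generate G {x 3}"
  "\<lbrakk>g \<in> H 1; g \<in> H 3\<rbrakk> \<Longrightarrow> g = \<one> \<or> g = t12"
  "\<lbrakk>g \<in> H 0; g \<in> H 2\<rbrakk> \<Longrightarrow> g = \<one> \<or> g = t23"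
  "\<lbrakk>g \<in> H 1; g \<in> H 2\<rbrakk> \<Longrightarrow> g = \<one> \<or> g = t13"
proof -
  note sub = generate_x_subset[THEN subsetD] generate_x_carrier[THEN subsetD]
  show "g \<in> generate G {x 1}" if g: "g \<in> H 2" "g \<in> H 3"
  proof -
    obtain k where k: "k \<in> generate G {x 1}" "g = k \<or> g = k \<otimes> t23" using H2_forms(1)[OF g(1)] by blast
    have "g \<noteq> k \<otimes> t23"
    proof
      assume "g = k \<otimes> t23"
      then have "t23 \<in> H 3" using H_cancel_left g(2) k(1) sub t_closed by metis
      then show False using triple_trivial'(2)[of t23] mem_H nontrivial by blast
    qed
    then show ?thesis using k by blast
  qed
  show "g \<in> generate G {x 2}" if "g \<in> H 0" "g \<in> H 3" using that middle_intersection by blast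
  show "g \<in> generate G {x 3}" if g: "g \<in> H 0" "g \<in> H 1"
  proof -
    obtain k where k: "k \<in> generate G {x 3}" "g = k \<or> g = t12 \<otimes> k" using H1_forms(1)[OF g(2)] by blast
    have "g \<noteq> t12 \<otimes> k"
    proof
      assume "g = t12 \<otimes> k"
      then have "t12 \<in> H 0" using H_cancel_right g(1) k(1) sub t_closed by metis
      then show False using triple_trivial'(3)[of t12] mem_H nontrivial by blast
    qed
    then show ?thesis using k by blast
  qed
  show "g = \<one> \<or> g = t12" if g: "g \<in> H 1" "g \<in> H 3"
  proof -
    obtain k where k: "k \<in> generate G {x 3}" "g = k \<or> g = t12 \<otimes> k" using H1_forms(1)[OF g(1)] by blast
    have "k \<in> H 3" using k g(2) H_cancel_left mem_H(8) sub by metis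
    then have "k = \<one>" using triple_trivial'(3) k(1) sub by blast
    then show ?thesis using k t_closed by auto
  qed
  show "g = \<one> \<or> g = t23" if g: "g \<in> H 0" "g \<in> H 2"
  proof -
    obtain k where k: "k \<in> generate G {x 1}" "g = k \<or> g = k \<otimes> t23" using H2_forms(1)[OF g(2)] by blast
    have "k \<in> H 0" using k g(1) H_cancel_right mem_H(9) sub by metis
    then have "k = \<one>" using triple_trivial'(2) k(1) sub by blast
    then show ?thesis using k t_closed by auto
  qed
  show "g = \<one> \<or> g = t13" if g: "g \<in> H 1" "g \<in> H 2"
  proof -
    obtain k where k: "k \<in> generate G {x 3}" "g = k \<or> g = t13 \<otimes> k" using H1_forms(3)[OF g(1)] by blast
    have "k \<in> H 2" using k g(2) H_cancel_left mem_H(12) sub by metis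
    then have "k = \<one>" using triple_trivial'(4) k(1) sub by blast
    then show ?thesis using k t_closed by auto
  qed
qed

text \<open>The middle rank can only be 1 or 2, where the stabilizer is dihedral. The cyclic part
  fixes both further faces on one side; of the available involutions the one is chosen that fixes
  the required face on the other side.\<close>

lemma H_factor:
  assumes "0 \<le> i" "i < j" "j < k" "k \<le> 3" and h: "h \<in> H j"
  shows "\<exists>u \<in> H j \<inter> H k. \<exists>v \<in> H i \<inter> H j. h = u \<otimes> v"
proof -
  note sub = generate_x_subset[THEN subsetD] generate_x_carrier[THEN subsetD]
  have one: "\<one> \<in> H j" for j using H_subgroup subgroup.one_closed by blast
  have l: "h = \<one> \<otimes> h" "h = h \<otimes> \<one>" using h H_subset[of j] by auto
  consider "i = 0" "j = 1" "k = 2" | "i = 0" "j = 1" "k = 3" | "i = 0" "j = 2" "k = 3" | "i = 1" "j = 2" "k = 3"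
    using assms by linarith
  then show ?thesis
  proof cases
    case 1
    obtain c where c: "c \<in> generate G {x 3}" "h = c \<or> h = t13 \<otimes> c" using H1_forms(3) h 1 by blast
    have "c \<in> H i \<inter> H j" using c sub 1 by blast
    then show ?thesis using c l one mem_H 1 by blast
  next
    case 2
    obtain c where c: "c \<in> generate G {x 3}" "h = c \<or> h = t12 \<otimes> c" using H1_forms(1) h 2 by blast
    have "c \<in> H i \<inter> H j" using c sub 2 by blast
    then show ?thesis using c l one mem_H 2 by blast
  next
    case 3
    obtain c where c: "c \<in> generate G {x 1}" "h = c \<or> h = c \<otimes> t23" using H2_forms(1) h 3 by blast
    have "c \<in> H j \<inter> H k" using c sub 3 by blast
    then show ?thesis using c l one mem_H 3 by blast
  next
    case 4
    obtain c where c: "c \<in> generate G {x 1}" "h = c \<or> h = c \<otimes> t13" using H2_forms(2) h 4 by blast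
    have "c \<in> H j \<inter> H k" using c sub 4 by blast
    then show ?thesis using c l one mem_H 4 by blast
  qed
qed

text \<open>The witness is \<open>t12\<close> (moving ranks 0 and 2) or \<open>t23\<close> (moving
  ranks 1 and 3), whichever moves rank \<open>i + 1\<close>. For \<open>i\<close> equal to 0 or 1
  the intersection consists of \<open>\<one>\<close> and this involution. For -1 and 2 one
  stabilizer is improper, so all of \<open>H 1\<close> or \<open>H 2\<close> is divided into the
  cyclic part, generated by \<open>x 3\<close> inside \<open>H 0\<close> or by \<open>x 1\<close>
  inside \<open>H 3\<close>, and its other coset.\<close>

lemma H_index:
  assumes "-1 \<le> i" "i \<le> 2"
  shows "\<exists>s \<in> H i \<inter> H (i + 2). s \<notin> H (i + 1) \<and>
    (\<forall>h \<in> H i \<inter> H (i + 2). h \<in> H (i + 1) \<or> h \<otimes> inv s \<in> H (i + 1))"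
proof -
  note sub = generate_x_subset[THEN subsetD] generate_x_carrier[THEN subsetD]
  have one: "\<one> \<in> H j" for j using H_subgroup subgroup.one_closed by blast
  have imp: "H (-1) = carrier G" "H 4 = carrier G" using H_improper by auto
  consider "i = -1" | "i = 0" | "i = 1" | "i = 2" using assms by linarith
  then show ?thesis
  proof cases
    case 1
    have "h \<in> H 0 \<or> h \<otimes> inv t12 \<in> H 0" if h: "h \<in> H 1" for h
    proof -
      obtain c where c: "c \<in> generate G {x 3}" "h = c \<or> h = c \<otimes> t12" using H1_forms(2)[OF h] by blast
      have "c \<otimes> t12 \<otimes> inv t12 = c" using sub(6)[OF c(1)] t_closed by (simp add: m_assoc)
      then show ?thesis using c sub(3) by metis
    qed
    moreover have "t12 \<notin> H 0" using triple_trivial'(3)[of t12] mem_H nontrivial by blast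
    ultimately show ?thesis using 1 imp mem_H t_closed by (intro bexI[of _ t12]) auto
  next
    case 2
    have "h \<in> H 1 \<or> h \<otimes> inv t23 \<in> H 1" if "h \<in> H 0" "h \<in> H 2" for h
      using pair_intersections(5)[OF that] one t_closed by auto
    moreover have "t23 \<notin> H 1" using triple_trivial'(4)[of t23] mem_H nontrivial by blast
    ultimately show ?thesis using 2 mem_H by (intro bexI[of _ t23]) auto
  next
    case 3
    have "h \<in> H 2 \<or> h \<otimes> inv t12 \<in> H 2" if "h \<in> H 1" "h \<in> H 3" for h
      using pair_intersections(4)[OF that] one t_closed by auto
    moreover have "t12 \<notin> H 2" using triple_trivial'(1)[of t12] mem_H nontrivial by blast
    ultimately show ?thesis using 3 mem_H by (intro bexI[of _ t12]) auto
  next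
    case 4
    have "h \<in> H 3 \<or> h \<otimes> inv t23 \<in> H 3" if h: "h \<in> H 2" for h
    proof -
      obtain c where c: "c \<in> generate G {x 1}" "h = c \<or> h = c \<otimes> t23" using H2_forms(1)[OF h] by blast
      have "c \<otimes> t23 \<otimes> inv t23 = c" using sub(5)[OF c(1)] t_closed by (simp add: m_assoc)
      then show ?thesis using c sub(2) by metis
    qed
    moreover have "t23 \<notin> H 3" using triple_trivial'(2)[of t23] mem_H nontrivial by blast
    ultimately show ?thesis using 4 imp mem_H t_closed by (intro bexI[of _ t23]) auto
  qed
qed

text \<open>A case distinction over the subsets \<open>I\<close>. Four ranks give the whole group,
  three ranks a single stabilizer, whose defining generators all move ranks in \<open>I\<close>
  only; two ranks are covered by \<open>pair_intersections\<close>. With at most one rank in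
  \<open>I\<close>, \<open>g\<close> lies in three stabilizers and is trivial.\<close>

lemma H_generated:
  assumes I: "I \<subseteq> {0..3}" and g: "g \<in> carrier G" "\<forall>j \<in> {0..3} - I. g \<in> H j"
  shows "g \<in> generate G {t \<in> carrier G. \<exists>a \<in> I. \<exists>b \<in> I.
    (\<forall>j \<in> {0..3} - {a, b}. t \<in> H j) \<and> t \<in> H b <#> H a}" (is "g \<in> generate G ?S")
proof -
  have e: "{0..3::int} = {0, 1, 2, 3}" by auto
  have prod: "u \<otimes> v \<in> H b <#> H a" if "u \<in> H b" "v \<in> H a" for u v a b
    using that by (auto simp: set_mult_def)
  have prods: "x 1 \<in> H 1 <#> H 0" "x 2 \<in> H 2 <#> H 1" "x 3 \<in> H 3 <#> H 2"
    "t12 \<in> H 2 <#> H 0" "t23 \<in> H 3 <#> H 1" "t13 \<in> H 3 <#> H 0"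
  proof -
    show "t12 \<in> H 2 <#> H 0" "t23 \<in> H 3 <#> H 1" "t13 \<in> H 3 <#> H 0"
      using prod mem_H by auto
    \<comment> \<open>The elements \<open>t12\<close>, \<open>t23\<close> and \<open>t13\<close> are
      visibly products of the right shape, but a single generator moves two consecutive ranks and
      must first be split into two rotations fixing one of these ranks each.\<close>
    have "x 1 = t12 \<otimes> inv (x 2)" "x 2 = inv (x 1) \<otimes> t12" "x 3 = inv (x 2) \<otimes> t23"
      using x_closed by (simp_all add: m_assoc) (simp_all flip: m_assoc)
    then show "x 1 \<in> H 1 <#> H 0" "x 2 \<in> H 2 <#> H 1" "x 3 \<in> H 3 <#> H 2"
      using prod H_inv mem_H by metis+
  qed
  have S1: "x 1 \<in> ?S" if "0 \<in> I" "1 \<in> I"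
    using that prods mem_H x_closed unfolding e by blast
  have S2: "x 2 \<in> ?S" if "1 \<in> I" "2 \<in> I"
    using that prods mem_H x_closed unfolding e by blast
  have S3: "x 3 \<in> ?S" if "2 \<in> I" "3 \<in> I"
    using that prods mem_H x_closed unfolding e by blast
  have S12: "t12 \<in> ?S" if "0 \<in> I" "2 \<in> I"
    using that prods mem_H t_closed unfolding e by blast
  have S23: "t23 \<in> ?S" if "1 \<in> I" "3 \<in> I"
    using that prods mem_H t_closed unfolding e by blast
  have S13: "t13 \<in> ?S" if "0 \<in> I" "3 \<in> I"
    using that prods mem_H t_closed unfolding e by blast
  have mono: "g \<in> generate G ?S" if "g \<in> generate G T" "T \<subseteq> ?S" for T
    using that mono_generate by blast
  have one: "g \<in> generate G ?S" if "g = \<one>" using that generate.one by blast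
  have incl: "g \<in> generate G ?S" if "g \<in> ?S" by (rule generate.incl[OF that])
  have gH: "g \<in> H j" if "j \<in> {0, 1, 2, 3}" "j \<notin> I" for j using g(2) that e by blast
  note pi = pair_intersections[of g] and tt = triple_trivial'[of g]
  show ?thesis
  proof (cases "0 \<in> I"; cases "1 \<in> I"; cases "2 \<in> I"; cases "3 \<in> I")
    assume "0 \<in> I" "1 \<in> I" "2 \<in> I" "3 \<in> I"
    then show ?thesis using mono[of "{x 1, x 2, x 3}"] carrier_generated g(1) S1 S2 S3 by auto
  next
    assume "0 \<in> I" "1 \<in> I" "2 \<in> I" "3 \<notin> I"
    then show ?thesis using mono[of "{x 1, x 2, t12}"] H3 gH[of 3] S1 S2 S12 by auto
  next
    assume "0 \<in> I" "1 \<in> I" "2 \<notin> I" "3 \<in> I"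
    then show ?thesis using mono[of "{x 1, t23, t13}"] H2 gH[of 2] S1 S23 S13 by auto
  next
    assume "0 \<in> I" "1 \<notin> I" "2 \<in> I" "3 \<in> I"
    then show ?thesis using mono[of "{t12, x 3, t13}"] H1 gH[of 1] S12 S3 S13 by auto
  next
    assume "0 \<notin> I" "1 \<in> I" "2 \<in> I" "3 \<in> I"
    then show ?thesis using mono[of "{x 2, x 3, t23}"] H0 gH[of 0] S2 S3 S23 by auto
  next
    assume "0 \<in> I" "1 \<in> I" "2 \<notin> I" "3 \<notin> I"
    then show ?thesis using mono[of "{x 1}"] pi(1) gH S1 by blast
  next
    assume "0 \<notin> I" "1 \<in> I" "2 \<in> I" "3 \<notin> I"
    then show ?thesis using mono[of "{x 2}"] pi(2) gH S2 by blast
  next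
    assume "0 \<notin> I" "1 \<notin> I" "2 \<in> I" "3 \<in> I"
    then show ?thesis using mono[of "{x 3}"] pi(3) gH S3 by blast
  next
    assume "0 \<in> I" "1 \<notin> I" "2 \<in> I" "3 \<notin> I"
    then show ?thesis using pi(4) gH S12 one incl by blast
  next
    assume "0 \<notin> I" "1 \<in> I" "2 \<notin> I" "3 \<in> I"
    then show ?thesis using pi(5) gH S23 one incl by blast
  next
    assume "0 \<in> I" "1 \<notin> I" "2 \<notin> I" "3 \<in> I"
    then show ?thesis using pi(6) gH S13 one incl by blast
  qed (use tt one gH in blast)+
qed

lemma polytope_coset_poset: "polytope (coset_poset 4 G x)"
proof -
  interpret CG: coset_geometry G x
    by (intro coset_geometry.intro coset_geometry_axioms.intro group_with_generators_axioms)
       (fact H_subgroup H_improper H_factor H_index H_generated)+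
  show ?thesis by (fact CG.polytope_coset_poset)
qed

end

section \<open>Flags and automorphisms of abstract polytopes\<close>

locale abstract_polytope =
  fixes P :: "'a ranked_poset"
  assumes polytope: "polytope P"
begin

abbreviation n :: int where "n \<equiv> int (dim P)"

abbreviation adj :: "'a set \<Rightarrow> int \<Rightarrow> 'a set" where "adj \<equiv> adj_flag P"

lemma le_refl: "F \<in> faces P \<Longrightarrow> (F, F) \<in> le P"
  and le_trans: "\<lbrakk>(F, G) \<in> le P; (G, K) \<in> le P\<rbrakk> \<Longrightarrow> (F, K) \<in> le P"
  and le_antisym: "\<lbrakk>(F, G) \<in> le P; (G, F) \<in> le P\<rbrakk> \<Longrightarrow> F = G"
  using polytope
  by (auto simp: polytope_def partial_order_on_def preorder_on_def faces_def
      intro: refl_onD transD antisymD dest: antisymD)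

lemma le_faces: "(F, G) \<in> le P \<Longrightarrow> F \<in> faces P \<and> G \<in> faces P"
  by (auto simp: faces_def Field_def)

lemma rk_range: "F \<in> faces P \<Longrightarrow> rk P F \<in> {-1..n}"
  using polytope by (auto simp: polytope_def)

lemma rk_less: "\<lbrakk>(F, G) \<in> le P; F \<noteq> G\<rbrakk> \<Longrightarrow> rk P F < rk P G"
  using polytope by (auto simp: polytope_def)

lemma rk_mono: "(F, G) \<in> le P \<Longrightarrow> rk P F \<le> rk P G"
  using rk_less by (cases "F = G") (auto intro: less_imp_le)

lemma flag_card: "\<Phi> \<in> flags P \<Longrightarrow> card \<Phi> = dim P + 2"
  using polytope by (auto simp: polytope_def)

lemma base_flag: "base P \<in> flags P"
  using polytope by (auto simp: polytope_def)

lemma bottom_unique: "\<lbrakk>F \<in> faces P; G \<in> faces P; rk P F = -1; rk P G = -1\<rbrakk> \<Longrightarrow> F = G"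
proof -
  obtain B where B: "\<And>G. G \<in> faces P \<Longrightarrow> (B, G) \<in> le P" "rk P B = -1"
    using polytope unfolding polytope_def by blast
  show "F = G" if "F \<in> faces P" "G \<in> faces P" "rk P F = -1" "rk P G = -1"
    using B rk_less that by (metis less_irrefl)
qed

lemma top_unique: "\<lbrakk>F \<in> faces P; G \<in> faces P; rk P F = n; rk P G = n\<rbrakk> \<Longrightarrow> F = G"
proof -
  obtain B where B: "\<And>G. G \<in> faces P \<Longrightarrow> (G, B) \<in> le P" "rk P B = n"
    using polytope unfolding polytope_def by blast
  show "F = G" if "F \<in> faces P" "G \<in> faces P" "rk P F = n" "rk P G = n"
    using B rk_less that by (metis less_irrefl)
qed

lemma chain_faces: "\<Phi> \<in> Chains (le P) \<Longrightarrow> \<Phi> \<subseteq> faces P"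
  unfolding Chains_def using le_faces by blast

lemma chain_le: "\<lbrakk>\<Phi> \<in> Chains (le P); F \<in> \<Phi>; G \<in> \<Phi>; rk P F \<le> rk P G\<rbrakk> \<Longrightarrow> (F, G) \<in> le P"
  unfolding Chains_def using rk_less le_refl le_faces by (metis (no_types, lifting) mem_Collect_eq not_le)

lemma chain_inj: "\<Phi> \<in> Chains (le P) \<Longrightarrow> inj_on (rk P) \<Phi>"
  by (rule inj_onI) (metis chain_le le_antisym order_refl)

lemma chain_rk: "\<Phi> \<in> Chains (le P) \<Longrightarrow> rk P ` \<Phi> \<subseteq> {-1..n}"
  using chain_faces rk_range by blast

lemma chain_finite: "\<Phi> \<in> Chains (le P) \<Longrightarrow> finite \<Phi>"
  using chain_inj chain_rk finite_imageD finite_subset by (metis finite_atLeastAtMost_int)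

lemma chain_card: "\<Phi> \<in> Chains (le P) \<Longrightarrow> card \<Phi> \<le> dim P + 2"
  using card_mono[OF _ chain_rk, of \<Phi>] card_image[OF chain_inj, of \<Phi>] by simp

lemma flag_chain: "\<Phi> \<in> flags P \<Longrightarrow> \<Phi> \<in> Chains (le P)"
  by (simp add: flags_def)

lemma flag_iff: "\<Phi> \<in> flags P \<longleftrightarrow> \<Phi> \<in> Chains (le P) \<and> card \<Phi> = dim P + 2"
proof
  assume "\<Phi> \<in> Chains (le P) \<and> card \<Phi> = dim P + 2"
  moreover from this have "\<Psi> = \<Phi>" if "\<Psi> \<in> Chains (le P)" "\<Phi> \<subseteq> \<Psi>" for \<Psi>
    using chain_card[OF that(1)] chain_finite[OF that(1)] that(2) by (metis card_seteq)
  ultimately show "\<Phi> \<in> flags P" by (auto simp: flags_def)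
qed (simp add: flag_chain flag_card)

lemma flag_faces: "\<Phi> \<in> flags P \<Longrightarrow> \<Phi> \<subseteq> faces P"
  using chain_faces flag_chain by blast

lemma flag_rk: "\<Phi> \<in> flags P \<Longrightarrow> rk P ` \<Phi> = {-1..n}"
  using card_image[OF chain_inj, of \<Phi>] chain_rk[of \<Phi>] by (intro card_seteq) (auto simp: flag_iff)

lemma flag_inj: "\<lbrakk>\<Phi> \<in> flags P; F \<in> \<Phi>; G \<in> \<Phi>; rk P F = rk P G\<rbrakk> \<Longrightarrow> F = G"
  using chain_inj flag_chain by (meson inj_onD)

lemma flag_subset_eq: "\<lbrakk>\<Phi> \<in> flags P; \<Psi> \<in> flags P; \<Phi> \<subseteq> \<Psi>\<rbrakk> \<Longrightarrow> \<Phi> = \<Psi>"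
  by (auto simp: flags_def)

lemma flag_face_ex1:
  assumes "\<Phi> \<in> flags P" "-1 \<le> j" "j \<le> n"
  shows "\<exists>!F. F \<in> \<Phi> \<and> rk P F = j"
proof -
  have "j \<in> rk P ` \<Phi>" using assms flag_rk by simp
  then show ?thesis using flag_inj[OF assms(1)] by blast
qed

lemma flag_replace:
  assumes \<Phi>: "\<Phi> \<in> flags P" and F: "F \<in> \<Phi>" and rk: "rk P F' = rk P F"
    and A: "A \<in> \<Phi>" "rk P A = rk P F - 1" "(A, F') \<in> le P"
    and B: "B \<in> \<Phi>" "rk P B = rk P F + 1" "(F', B) \<in> le P"
  shows "insert F' (\<Phi> - {F}) \<in> flags P"
proof -
  note ch = flag_chain[OF \<Phi>]
  have cmp: "(G, F') \<in> le P \<or> (F', G) \<in> le P" if "G \<in> \<Phi> - {F}" for G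
  proof -
    have "rk P G \<noteq> rk P F" using that F flag_inj[OF \<Phi>] by blast
    then consider "rk P G \<le> rk P A" | "rk P B \<le> rk P G" using A B by linarith
    then show ?thesis using chain_le[OF ch] that A B le_trans by cases blast+
  qed
  moreover have "(F', F') \<in> le P" using A le_faces le_refl by blast
  ultimately have "insert F' (\<Phi> - {F}) \<in> Chains (le P)"
    using ch unfolding Chains_def by blast
  moreover have "F' \<notin> \<Phi> - {F}" using F rk flag_inj[OF \<Phi>] by blast
  then have "card (insert F' (\<Phi> - {F})) = card \<Phi>"
    using chain_finite[OF ch] F by (metis card_insert_disjoint card_Suc_Diff1 finite_Diff)
  ultimately show ?thesis using \<Phi> by (simp add: flag_iff)
qed

text \<open>The faces of ranks \<open>j - 1\<close> and \<open>j + 1\<close> bound a diamond. It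
  contains one \<open>j\<close>-face \<open>F'\<close> besides the one in the flag, and any flag
  agreeing in the other ranks takes its \<open>j\<close>-face from this diamond.\<close>

lemma adj_ex1:
  assumes \<Phi>: "\<Phi> \<in> flags P" and j: "0 \<le> j" "j < n"
  shows "\<exists>!\<Psi>. \<Psi> \<in> flags P \<and> \<Psi> \<noteq> \<Phi> \<and> (\<forall>F. rk P F \<noteq> j \<longrightarrow> (F \<in> \<Psi> \<longleftrightarrow> F \<in> \<Phi>))"
proof -
  obtain A F B where AFB: "A \<in> \<Phi>" "rk P A = j - 1" "F \<in> \<Phi>" "rk P F = j" "B \<in> \<Phi>" "rk P B = j + 1"
    using flag_face_ex1[OF \<Phi>, of "j - 1"] flag_face_ex1[OF \<Phi>, of j] flag_face_ex1[OF \<Phi>, of "j + 1"] j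
    by auto
  note ch = flag_chain[OF \<Phi>]
  define M where "M = {H. (A, H) \<in> le P \<and> (H, B) \<in> le P \<and> rk P H = rk P A + 1}"
  have "(A, B) \<in> le P" using chain_le[OF ch] AFB by simp
  moreover have "rk P B = rk P A + 2" using AFB by simp
  ultimately have "card M = 2"
    using polytope unfolding M_def polytope_def diamond_condition_def by blast
  moreover have FM: "F \<in> M" using AFB chain_le[OF ch] by (simp add: M_def)
  ultimately obtain F' where F': "M = {F, F'}" "F' \<noteq> F" by (auto simp: card_2_iff)
  have "F' \<in> M" using F' by blast
  then have F'_props: "rk P F' = j" "(A, F') \<in> le P" "(F', B) \<in> le P" using AFB by (auto simp: M_def)
  let ?\<Psi> = "insert F' (\<Phi> - {F})"
  have \<Psi>: "?\<Psi> \<in> flags P" using flag_replace[OF \<Phi> AFB(3)] AFB F'_props by simp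
  have F'_notin: "F' \<notin> \<Phi>" using F' F'_props flag_inj[OF \<Phi>] AFB by blast
  show ?thesis
  proof (rule ex1I[of _ ?\<Psi>])
    show "?\<Psi> \<in> flags P \<and> ?\<Psi> \<noteq> \<Phi> \<and> (\<forall>K. rk P K \<noteq> j \<longrightarrow> (K \<in> ?\<Psi> \<longleftrightarrow> K \<in> \<Phi>))"
      using \<Psi> F'_notin F'_props AFB by auto
  next
    fix \<Psi>' assume \<Psi>': "\<Psi>' \<in> flags P \<and> \<Psi>' \<noteq> \<Phi> \<and> (\<forall>K. rk P K \<noteq> j \<longrightarrow> (K \<in> \<Psi>' \<longleftrightarrow> K \<in> \<Phi>))"
    obtain G where G: "G \<in> \<Psi>'" "rk P G = j" using flag_face_ex1[of \<Psi>' j] \<Psi>' j by auto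
    have AB: "A \<in> \<Psi>'" "B \<in> \<Psi>'" using \<Psi>' AFB by auto
    have "G \<in> M" using chain_le[OF flag_chain, of \<Psi>'] \<Psi>' AB G AFB by (simp add: M_def)
    moreover have "G \<noteq> F"
    proof
      assume "G = F"
      have "\<Phi> \<subseteq> \<Psi>'"
      proof
        fix K assume K: "K \<in> \<Phi>"
        show "K \<in> \<Psi>'"
        proof (cases "rk P K = j")
          case True then have "K = F" using K AFB flag_inj[OF \<Phi>] by blast
          then show ?thesis using \<open>G = F\<close> G by simp
        next
          case False then show ?thesis using \<Psi>' K by blast
        qed
      qed
      then show False using flag_subset_eq \<Phi> \<Psi>' by blast
    qed
    ultimately have "G = F'" using F' by blast
    moreover have "K \<in> \<Psi>'" if "K \<in> \<Phi> - {F}" for K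
    proof -
      have "rk P K \<noteq> j" using that AFB flag_inj[OF \<Phi>] by blast
      then show ?thesis using that \<Psi>' by blast
    qed
    ultimately have "?\<Psi> \<subseteq> \<Psi>'" using G by blast
    then show "\<Psi>' = ?\<Psi>" using flag_subset_eq \<Psi> \<Psi>' by blast
  qed
qed

lemma
  assumes "\<Phi> \<in> flags P" "0 \<le> j" "j < n"
  shows adj_flag_flag: "adj \<Phi> j \<in> flags P"
    and adj_neq: "adj \<Phi> j \<noteq> \<Phi>"
    and adj_agree: "rk P F \<noteq> j \<Longrightarrow> F \<in> adj \<Phi> j \<longleftrightarrow> F \<in> \<Phi>"
  using theI'[OF adj_ex1[OF assms]] unfolding adj_flag_def by auto

lemma adj_unique:
  assumes "\<Phi> \<in> flags P" "0 \<le> j" "j < n" "\<Psi> \<in> flags P" "\<Psi> \<noteq> \<Phi>"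
    "\<And>F. rk P F \<noteq> j \<Longrightarrow> F \<in> \<Psi> \<longleftrightarrow> F \<in> \<Phi>"
  shows "adj \<Phi> j = \<Psi>"
  using the1_equality[OF adj_ex1[OF assms(1-3)]] assms unfolding adj_flag_def by blast

lemma adj_adj: "\<lbrakk>\<Phi> \<in> flags P; 0 \<le> j; j < n\<rbrakk> \<Longrightarrow> adj (adj \<Phi> j) j = \<Phi>"
  by (intro adj_unique adj_flag_flag) (auto simp: adj_agree dest: adj_neq)

lemma adj_rank_neq:
  assumes "\<Phi> \<in> flags P" "0 \<le> j" "j < n" "F \<in> \<Phi>" "rk P F = j"
  shows "F \<notin> adj \<Phi> j"
proof
  assume F: "F \<in> adj \<Phi> j"
  have "\<Phi> \<subseteq> adj \<Phi> j"
  proof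
    fix G assume "G \<in> \<Phi>"
    then show "G \<in> adj \<Phi> j"
      using F adj_agree[OF assms(1-3)] flag_inj[OF assms(1)] assms(4,5) by (cases "rk P G = j") auto
  qed
  then show False using flag_subset_eq adj_flag_flag adj_neq assms by metis
qed

text \<open>Put the original \<open>i\<close>-face \<open>A\<close> back into \<open>X\<close>. This
  is legitimate because the neighbours of ranks \<open>i - 1\<close> and \<open>i + 1\<close> were
  never changed. The resulting flag differs from \<open>X\<close> only in rank \<open>i\<close> and
  from \<open>\<Phi>\<close> only in rank \<open>j\<close>, so uniqueness of adjacent flags
  identifies it twice.\<close>

lemma adj_commute:
  assumes \<Phi>: "\<Phi> \<in> flags P" and i: "0 \<le> i" "i < n" and j: "0 \<le> j" "j < n" and ij: "i \<le> j - 2 \<or> j \<le> i - 2"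
  shows "adj (adj \<Phi> i) j = adj (adj \<Phi> j) i"
proof -
  define X where "X = adj (adj \<Phi> i) j"
  have \<Phi>i: "adj \<Phi> i \<in> flags P" using adj_flag_flag \<Phi> i by blast
  have X: "X \<in> flags P" using adj_flag_flag \<Phi>i j by (simp add: X_def)
  have XF: "G \<in> X \<longleftrightarrow> G \<in> \<Phi>" if "rk P G \<noteq> i" "rk P G \<noteq> j" for G
    using that adj_agree[OF \<Phi> i] adj_agree[OF \<Phi>i j] by (simp add: X_def)
  obtain A where A: "A \<in> \<Phi>" "rk P A = i" using flag_face_ex1[OF \<Phi>, of i] i by auto
  obtain A' where A': "A' \<in> X" "rk P A' = i" using flag_face_ex1[OF X, of i] i by auto
  have "A' \<in> adj \<Phi> i" using A' adj_agree[OF \<Phi>i j] ij by (auto simp: X_def)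
  then have AA': "A \<notin> X" using A A' adj_rank_neq[OF \<Phi> i A] flag_inj[OF X] by metis
  obtain B C where BC: "B \<in> \<Phi>" "rk P B = i - 1" "C \<in> \<Phi>" "rk P C = i + 1"
    using flag_face_ex1[OF \<Phi>, of "i - 1"] flag_face_ex1[OF \<Phi>, of "i + 1"] i by auto
  have BCX: "B \<in> X" "C \<in> X" using BC XF[of B] XF[of C] ij by auto
  have le: "(B, A) \<in> le P" "(A, C) \<in> le P" using chain_le[OF flag_chain[OF \<Phi>]] A BC by auto
  have Y: "insert A (X - {A'}) \<in> flags P"
    using flag_replace[OF X A'(1), of A B C] A A' BC BCX le by simp
  have "adj X i = insert A (X - {A'})"
    by (rule adj_unique[OF X i Y]) (use AA' A A' in auto)
  moreover have "adj \<Phi> j = insert A (X - {A'})"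
  proof (rule adj_unique[OF \<Phi> j Y])
    obtain D where D: "D \<in> adj \<Phi> i" "rk P D = j" using flag_face_ex1[OF \<Phi>i, of j] j by auto
    then have "D \<notin> X" using adj_rank_neq[OF \<Phi>i j] by (simp add: X_def)
    moreover have "D \<in> \<Phi>" using D adj_agree[OF \<Phi> i, of D] ij by auto
    moreover have "D \<noteq> A" using D A ij by auto
    ultimately show "insert A (X - {A'}) \<noteq> \<Phi>" by blast
  next
    fix G assume G: "rk P G \<noteq> j"
    show "G \<in> insert A (X - {A'}) \<longleftrightarrow> G \<in> \<Phi>"
    proof (cases "rk P G = i")
      case True
      then show ?thesis using A A' flag_inj[OF X, of G A'] flag_inj[OF \<Phi>, of G A] by auto
    next
      case False then show ?thesis using XF[OF False G] A A' by auto
    qed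
  qed
  ultimately have "adj X i = adj \<Phi> j" by simp
  then have "adj (adj X i) i = adj (adj \<Phi> j) i" by simp
  then show ?thesis using adj_adj[OF X i] by (simp add: X_def)
qed

text \<open>Adjacency is defined by counting faces. As every flag has one face of each rank, the two
  exchanged faces have the same rank, and uniqueness of the least and greatest face makes this rank
  proper.\<close>

lemma adjacent_flags_adj:
  assumes "adjacent_flags P \<Phi> \<Psi>"
  obtains j where "0 \<le> j" "j < n" "\<Psi> = adj \<Phi> j"
proof -
  have fl: "\<Phi> \<in> flags P" "\<Psi> \<in> flags P" using assms by (auto simp: adjacent_flags_def)
  obtain F G where FG: "\<Phi> - \<Psi> = {F}" "\<Psi> - \<Phi> = {G}"
    using assms by (auto simp: adjacent_flags_def card_1_singleton_iff)
  have F: "F \<in> \<Phi>" "F \<notin> \<Psi>" and G: "G \<in> \<Psi>" "G \<notin> \<Phi>" using FG by auto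
  have fF: "F \<in> faces P" "G \<in> faces P" using F G fl flag_faces by auto
  obtain G' where G': "G' \<in> \<Psi>" "rk P G' = rk P F"
    using flag_face_ex1[OF fl(2), of "rk P F"] rk_range[OF fF(1)] by auto
  have "G' \<notin> \<Phi>" using G' F flag_inj[OF fl(1)] by metis
  then have "G' = G" using FG G' by blast
  then have rk: "rk P G = rk P F" using G' by simp
  have j: "0 \<le> rk P F" "rk P F < n"
  proof -
    have "rk P F \<noteq> -1" using bottom_unique[OF fF] rk F G by auto
    moreover have "rk P F \<noteq> n" using top_unique[OF fF] rk F G by auto
    ultimately show "0 \<le> rk P F" "rk P F < n" using rk_range[OF fF(1)] by auto
  qed
  have "adj \<Phi> (rk P F) = \<Psi>"
  proof (rule adj_unique[OF fl(1) j fl(2)])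
    show "\<Psi> \<noteq> \<Phi>" using F by blast
  next
    fix K assume "rk P K \<noteq> rk P F"
    then have "K \<noteq> F" "K \<noteq> G" using rk by auto
    then show "K \<in> \<Psi> \<longleftrightarrow> K \<in> \<Phi>" using FG by blast
  qed
  then show thesis using that j by blast
qed

text \<open>Strong flag-connectedness as an induction principle. The invariant that common faces are
  kept is what confines the steps \<open>j\<close> to ranks in which the two flags differ.\<close>

lemma flags_connected:
  assumes "\<Phi> \<in> flags P" "\<Psi> \<in> flags P" "Q \<Phi>"
    and "\<And>\<Theta> j. \<lbrakk>\<Theta> \<in> flags P; Q \<Theta>; \<Phi> \<inter> \<Psi> \<subseteq> \<Theta>; 0 \<le> j; j < n; \<Phi> \<inter> \<Psi> \<subseteq> adj \<Theta> j\<rbrakk> \<Longrightarrow> Q (adj \<Theta> j)"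
  shows "Q \<Psi>"
proof -
  have "(\<Phi>, \<Psi>) \<in> {(A, B). adjacent_flags P A B \<and> \<Phi> \<inter> \<Psi> \<subseteq> A \<and> \<Phi> \<inter> \<Psi> \<subseteq> B}\<^sup>*"
    using polytope assms(1,2) by (auto simp: polytope_def strongly_flag_connected_def)
  then show ?thesis
  proof (induction rule: rtrancl_induct)
    case base then show ?case using assms by blast
  next
    case (step A B)
    then have AB: "adjacent_flags P A B" "\<Phi> \<inter> \<Psi> \<subseteq> A" "\<Phi> \<inter> \<Psi> \<subseteq> B" by auto
    then obtain j where "0 \<le> j" "j < n" "B = adj A j" using adjacent_flags_adj by metis
    moreover have "A \<in> flags P" using AB by (simp add: adjacent_flags_def)
    ultimately show ?case using assms(4) step.IH AB by blast
  qed
qed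

lemma chain_in_flag:
  assumes "C \<in> Chains (le P)"
  obtains \<Phi> where "\<Phi> \<in> flags P" "C \<subseteq> \<Phi>"
proof -
  let ?Q = "\<lambda>\<Psi>. \<Psi> \<in> Chains (le P) \<and> C \<subseteq> \<Psi>"
  have "\<exists>\<Phi>. ?Q \<Phi> \<and> (\<forall>\<Psi>. ?Q \<Psi> \<longrightarrow> card \<Psi> \<le> card \<Phi>)"
    by (rule ex_has_greatest_nat[of ?Q C _ "dim P + 3"])
       (use assms chain_card in \<open>fastforce simp: less_Suc_eq_le\<close>)+
  then obtain \<Phi> where \<Phi>: "?Q \<Phi>" "\<And>\<Psi>. ?Q \<Psi> \<Longrightarrow> card \<Psi> \<le> card \<Phi>" by blast
  have "\<Phi> \<in> flags P"
    unfolding flags_def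
  proof (safe)
    show "\<Phi> \<in> Chains (le P)" using \<Phi> by blast
  next
    fix \<Psi> F assume \<Psi>: "\<Psi> \<in> Chains (le P)" "\<Phi> \<subseteq> \<Psi>" "F \<in> \<Psi>"
    then have "card \<Psi> \<le> card \<Phi>" using \<Phi> by blast
    then show "F \<in> \<Phi>" using card_seteq[OF chain_finite[OF \<Psi>(1)] \<Psi>(2)] \<Psi>(3) by blast
  qed
  then show thesis using that \<Phi> by blast
qed

lemma face_in_flag:
  assumes "F \<in> faces P"
  obtains \<Phi> where "\<Phi> \<in> flags P" "F \<in> \<Phi>"
  using chain_in_flag[of "{F}"] assms le_refl by (auto simp: Chains_def)

end

section \<open>Automorphisms and their action on flags\<close>

context abstract_polytope
begin

abbreviation \<Gamma> :: "('a \<Rightarrow> 'a) monoid" where "\<Gamma> \<equiv> aut_group P"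

lemma aut_bij: "\<gamma> \<in> carrier \<Gamma> \<Longrightarrow> bij_betw \<gamma> (faces P) (faces P)"
  by (simp add: aut_group_def Bij_def)

lemma aut_face: "\<lbrakk>\<gamma> \<in> carrier \<Gamma>; F \<in> faces P\<rbrakk> \<Longrightarrow> \<gamma> F \<in> faces P"
  using aut_bij bij_betwE by blast

lemma aut_inj: "\<gamma> \<in> carrier \<Gamma> \<Longrightarrow> inj_on \<gamma> (faces P)"
  using aut_bij bij_betw_imp_inj_on by blast

lemma aut_le: "\<lbrakk>\<gamma> \<in> carrier \<Gamma>; F \<in> faces P; G \<in> faces P\<rbrakk> \<Longrightarrow> (\<gamma> F, \<gamma> G) \<in> le P \<longleftrightarrow> (F, G) \<in> le P"
  by (simp add: aut_group_def)

lemma aut_flag: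
  assumes \<gamma>: "\<gamma> \<in> carrier \<Gamma>" and \<Phi>: "\<Phi> \<in> flags P"
  shows "\<gamma> ` \<Phi> \<in> flags P"
proof -
  have "\<gamma> ` \<Phi> \<in> Chains (le P)"
    using flag_chain[OF \<Phi>] flag_faces[OF \<Phi>] aut_le[OF \<gamma>] unfolding Chains_def by blast
  moreover have "card (\<gamma> ` \<Phi>) = card \<Phi>"
    using aut_inj[OF \<gamma>] flag_faces[OF \<Phi>] by (intro card_image) (rule inj_on_subset)
  ultimately show ?thesis using \<Phi> by (simp add: flag_iff)
qed

text \<open>Automorphisms are only required to preserve the order. This count recovers the rank from
  the order, which makes it invariant; the summand 2 is there because ranks start at -1.\<close>

lemma card_below:
  assumes \<Phi>: "\<Phi> \<in> flags P" and F: "F \<in> \<Phi>"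
  shows "int (card {G \<in> \<Phi>. (G, F) \<in> le P}) = rk P F + 2"
proof -
  have e: "{G \<in> \<Phi>. (G, F) \<in> le P} = {G \<in> \<Phi>. rk P G \<le> rk P F}"
    using chain_le[OF flag_chain[OF \<Phi>]] rk_mono F by blast
  have r: "rk P F \<in> {-1..n}" using rk_range flag_faces \<Phi> F by blast
  have "rk P ` {G \<in> \<Phi>. rk P G \<le> rk P F} = {j \<in> rk P ` \<Phi>. j \<le> rk P F}" by blast
  also have "\<dots> = {-1..rk P F}" using flag_rk[OF \<Phi>] r by auto
  finally have im: "rk P ` {G \<in> \<Phi>. rk P G \<le> rk P F} = {-1..rk P F}" .
  have "inj_on (rk P) {G \<in> \<Phi>. rk P G \<le> rk P F}"
    using chain_inj[OF flag_chain[OF \<Phi>]] by (rule inj_on_subset) blast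
  from card_image[OF this] show ?thesis using r by (auto simp: im e)
qed

lemma aut_rk:
  assumes \<gamma>: "\<gamma> \<in> carrier \<Gamma>" and F: "F \<in> faces P"
  shows "rk P (\<gamma> F) = rk P F"
proof -
  obtain \<Phi> where \<Phi>: "\<Phi> \<in> flags P" "F \<in> \<Phi>" using face_in_flag F by blast
  have "{G \<in> \<gamma> ` \<Phi>. (G, \<gamma> F) \<in> le P} = \<gamma> ` {G \<in> \<Phi>. (G, F) \<in> le P}"
    using aut_le[OF \<gamma>] F flag_faces[OF \<Phi>(1)] by blast
  moreover have "inj_on \<gamma> {G \<in> \<Phi>. (G, F) \<in> le P}"
    using aut_inj[OF \<gamma>] flag_faces[OF \<Phi>(1)] by (auto intro: inj_on_subset)
  ultimately have "card {G \<in> \<gamma> ` \<Phi>. (G, \<gamma> F) \<in> le P} = card {G \<in> \<Phi>. (G, F) \<in> le P}"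
    by (simp add: card_image)
  then show ?thesis using card_below[OF \<Phi>] card_below[OF aut_flag[OF \<gamma> \<Phi>(1)], of "\<gamma> F"] \<Phi>(2) by auto
qed

lemma aut_adj:
  assumes \<gamma>: "\<gamma> \<in> carrier \<Gamma>" and \<Phi>: "\<Phi> \<in> flags P" and j: "0 \<le> j" "j < n"
  shows "\<gamma> ` adj \<Phi> j = adj (\<gamma> ` \<Phi>) j"
proof -
  note ad = adj_flag_flag[OF \<Phi> j]
  note sub = flag_faces[OF \<Phi>] flag_faces[OF ad]
  have "adj (\<gamma> ` \<Phi>) j = \<gamma> ` adj \<Phi> j"
  proof (rule adj_unique[OF aut_flag[OF \<gamma> \<Phi>] j aut_flag[OF \<gamma> ad]])
    show "\<gamma> ` adj \<Phi> j \<noteq> \<gamma> ` \<Phi>"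
      using inj_on_image_eq_iff[OF aut_inj[OF \<gamma>] sub(2) sub(1)] adj_neq[OF \<Phi> j] by simp
  next
    fix F assume F: "rk P F \<noteq> j"
    have "\<gamma> G \<noteq> F" if "G \<in> faces P" "rk P G = j" for G using aut_rk[OF \<gamma>] that F by blast
    then show "F \<in> \<gamma> ` adj \<Phi> j \<longleftrightarrow> F \<in> \<gamma> ` \<Phi>" using adj_agree[OF \<Phi> j] sub by blast
  qed
  then show ?thesis by simp
qed

lemma aut_image_eq_pointwise:
  assumes "\<alpha> \<in> carrier \<Gamma>" "\<beta> \<in> carrier \<Gamma>" "\<Phi> \<in> flags P" "\<alpha> ` \<Phi> = \<beta> ` \<Phi>" "F \<in> \<Phi>"
  shows "\<alpha> F = \<beta> F"
proof -
  have F: "F \<in> faces P" using assms flag_faces by blast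
  have "\<alpha> F \<in> \<alpha> ` \<Phi>" "\<beta> F \<in> \<alpha> ` \<Phi>" using assms by auto
  then show ?thesis using flag_inj[OF aut_flag[OF assms(1,3)]] aut_rk assms(1,2) F by simp
qed

text \<open>Automorphisms act freely on flags: they commute with taking adjacent flags, so equality
  of the two images spreads from \<open>\<Phi>\<close> to every flag by connectedness. Ranks are
  preserved, so equal images of a flag mean pointwise agreement on it, and every face lies in a
  flag.\<close>

lemma aut_eqI:
  assumes \<alpha>: "\<alpha> \<in> carrier \<Gamma>" and \<beta>: "\<beta> \<in> carrier \<Gamma>" and \<Phi>: "\<Phi> \<in> flags P" and eq: "\<alpha> ` \<Phi> = \<beta> ` \<Phi>"
  shows "\<alpha> = \<beta>"
proof -
  have "\<alpha> F = \<beta> F" if F: "F \<in> faces P" for F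
  proof -
    obtain \<Psi> where \<Psi>: "\<Psi> \<in> flags P" "F \<in> \<Psi>" using face_in_flag F by blast
    have "\<alpha> ` \<Psi> = \<beta> ` \<Psi>"
    proof (rule flags_connected[where Q = "\<lambda>\<Theta>. \<alpha> ` \<Theta> = \<beta> ` \<Theta>", OF \<Phi> \<Psi>(1) eq])
      fix \<Theta> j assume *: "\<Theta> \<in> flags P" "\<alpha> ` \<Theta> = \<beta> ` \<Theta>" "0 \<le> j" "j < n"
      then show "\<alpha> ` adj \<Theta> j = \<beta> ` adj \<Theta> j" using aut_adj[OF \<alpha>] aut_adj[OF \<beta>] by simp
    qed
    then show ?thesis using aut_image_eq_pointwise[OF \<alpha> \<beta> \<Psi>(1)] \<Psi>(2) by blast
  qed
  moreover have "\<alpha> \<in> extensional (faces P)" "\<beta> \<in> extensional (faces P)"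
    using \<alpha> \<beta> by (auto simp: aut_group_def Bij_def)
  ultimately show ?thesis by (rule extensionalityI[rotated 2])
qed

lemma aut_mult_apply: "F \<in> faces P \<Longrightarrow> (\<alpha> \<otimes>\<^bsub>\<Gamma>\<^esub> \<beta>) F = \<beta> (\<alpha> F)"
  by (simp add: aut_group_def compose_def)

lemma aut_one_apply: "F \<in> faces P \<Longrightarrow> \<one>\<^bsub>\<Gamma>\<^esub> F = F"
  by (simp add: aut_group_def)

lemma aut_mult_image: "\<Phi> \<subseteq> faces P \<Longrightarrow> (\<alpha> \<otimes>\<^bsub>\<Gamma>\<^esub> \<beta>) ` \<Phi> = \<beta> ` (\<alpha> ` \<Phi>)"
  by (force simp: aut_group_def compose_def)

lemma aut_one_image: "\<Phi> \<subseteq> faces P \<Longrightarrow> \<one>\<^bsub>\<Gamma>\<^esub> ` \<Phi> = \<Phi>"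
  by (force simp: aut_group_def)

lemma rho_props:
  assumes "regular P" "int i < n"
  shows "rho P i \<in> carrier \<Gamma>" "rho P i ` base P = adj (base P) (int i)"
proof -
  have "adj (base P) (int i) \<in> flags P" using adj_flag_flag base_flag assms by simp
  then obtain \<gamma> where \<gamma>: "\<gamma> \<in> carrier \<Gamma>" "\<gamma> ` base P = adj (base P) (int i)"
    using assms base_flag unfolding regular_def by blast
  have "\<exists>!\<gamma>. \<gamma> \<in> carrier \<Gamma> \<and> \<gamma> ` base P = adj (base P) (int i)"
    using \<gamma> aut_eqI[OF _ _ base_flag] by (intro ex1I[of _ \<gamma>]) auto
  from theI'[OF this] show "rho P i \<in> carrier \<Gamma>" "rho P i ` base P = adj (base P) (int i)"
    unfolding rho_def by auto
qed

text \<open>This erases the case distinction in the definition of \<open>sigma\<close>. In the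
  regular case \<open>rho P (i - 1)\<close> is applied first and changes rank \<open>i - 1\<close>
  of the base flag; \<open>rho P i\<close> commutes with that change and moves the base flag in rank
  \<open>i\<close>, which leaves the \<open>i\<close>-step inside.\<close>

lemma sigma_eqI:
  assumes i: "1 \<le> i" "int i < n" and \<gamma>: "\<gamma> \<in> carrier \<Gamma>"
    and base: "\<gamma> ` base P = adj (adj (base P) (int i)) (int i - 1)"
  shows "sigma P i = \<gamma>"
proof (cases "regular P")
  case False
  have "(THE \<gamma>. \<gamma> \<in> carrier \<Gamma> \<and> \<gamma> ` base P = adj (adj (base P) (int i)) (int i - 1)) = \<gamma>"
    using \<gamma> base aut_eqI[OF _ _ base_flag] by (intro the_equality) auto
  then show ?thesis using False by (simp add: sigma_def)
next
  case True
  have int: "int (i - 1) = int i - 1" using i by simp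
  note r0 = rho_props[OF True, of "i - 1"] and r1 = rho_props[OF True i(2)]
  have r0': "rho P (i - 1) \<in> carrier \<Gamma>" "rho P (i - 1) ` base P = adj (base P) (int i - 1)"
    using r0 i by (simp_all add: int)
  have "(rho P (i - 1) \<otimes>\<^bsub>\<Gamma>\<^esub> rho P i) ` base P = rho P i ` adj (base P) (int i - 1)"
    using aut_mult_image[OF flag_faces[OF base_flag]] r0' by simp
  also have "\<dots> = adj (adj (base P) (int i)) (int i - 1)"
    using aut_adj[OF r1(1) base_flag, of "int i - 1"] r1 i by simp
  also have "\<dots> = \<gamma> ` base P" by (simp add: base)
  finally have "rho P (i - 1) \<otimes>\<^bsub>\<Gamma>\<^esub> rho P i = \<gamma>"
    by (intro aut_eqI[OF _ \<gamma> base_flag])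
       (rule monoid.m_closed[OF group.is_monoid[OF group_aut_group] r0'(1) r1(1)])
  then show ?thesis using True by (simp add: sigma_def)
qed

end

section \<open>Duals and sections\<close>

lemma Chains_converse: "Chains (r\<inverse>) = Chains r"
  by (auto simp: Chains_def)

lemma dim_dual [simp]: "dim (dual P) = dim P" and base_dual [simp]: "base (dual P) = base P"
  and le_dual: "le (dual P) = (le P)\<inverse>" and rk_dual: "rk (dual P) F = int (dim P) - 1 - rk P F"
  by (simp_all add: dual_def)

lemma faces_dual [simp]: "faces (dual P) = faces P"
  by (simp add: faces_def le_dual)

lemma flags_dual [simp]: "flags (dual P) = flags P"
  by (simp add: flags_def le_dual Chains_converse)

lemma adjacent_flags_dual: "adjacent_flags (dual P) = adjacent_flags P"
  by (simp add: adjacent_flags_def fun_eq_iff)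

lemma aut_group_dual: "aut_group (dual P) = aut_group P"
  unfolding aut_group_def faces_dual by (auto simp: le_dual)

lemma adj_flag_dual: "adj_flag (dual P) \<Phi> j = adj_flag P \<Phi> (int (dim P) - 1 - j)"
proof -
  have "rk (dual P) F \<noteq> j \<longleftrightarrow> rk P F \<noteq> int (dim P) - 1 - j" for F by (auto simp: rk_dual)
  then show ?thesis by (simp add: adj_flag_def)
qed

lemma polytope_dual:
  assumes "polytope P"
  shows "polytope (dual P)"
proof -
  have "Partial_order (le (dual P))"
    using assms by (simp add: polytope_def le_dual)
  moreover have "diamond_condition (dual P)"
    unfolding diamond_condition_def
  proof (intro allI impI)
    fix F G assume *: "(F, G) \<in> le (dual P) \<and> rk (dual P) G = rk (dual P) F + 2"
    then have "(G, F) \<in> le P \<and> rk P F = rk P G + 2" by (auto simp: le_dual rk_dual)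
    then have "card {H. (G, H) \<in> le P \<and> (H, F) \<in> le P \<and> rk P H = rk P G + 1} = 2"
      using assms unfolding polytope_def diamond_condition_def by blast
    moreover have "{H. (F, H) \<in> le (dual P) \<and> (H, G) \<in> le (dual P) \<and> rk (dual P) H = rk (dual P) F + 1}
       = {H. (G, H) \<in> le P \<and> (H, F) \<in> le P \<and> rk P H = rk P G + 1}"
      using * by (auto simp: le_dual rk_dual)
    ultimately show "card {H. (F, H) \<in> le (dual P) \<and> (H, G) \<in> le (dual P) \<and>
        rk (dual P) H = rk (dual P) F + 1} = 2" by simp
  qed
  moreover have "strongly_flag_connected (dual P)"
    using assms by (simp add: polytope_def strongly_flag_connected_def adjacent_flags_dual)
  moreover have "\<forall>F \<in> faces (dual P). - 1 \<le> rk (dual P) F \<and> rk (dual P) F \<le> int (dim (dual P))"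
    using assms by (auto simp: polytope_def rk_dual)
  moreover have "\<forall>F G. (F, G) \<in> le (dual P) \<and> F \<noteq> G \<longrightarrow> rk (dual P) F < rk (dual P) G"
    using assms by (auto simp: polytope_def rk_dual le_dual)
  moreover have "\<exists>F \<in> faces (dual P). rk (dual P) F = - 1 \<and> (\<forall>G \<in> faces (dual P). (F, G) \<in> le (dual P))"
  proof -
    obtain T where "T \<in> faces P" "rk P T = int (dim P)" "\<forall>G \<in> faces P. (G, T) \<in> le P"
      using assms unfolding polytope_def by blast
    then show ?thesis by (intro bexI[of _ T]) (auto simp: rk_dual le_dual)
  qed
  moreover have "\<exists>F \<in> faces (dual P). rk (dual P) F = int (dim (dual P)) \<and>
      (\<forall>G \<in> faces (dual P). (G, F) \<in> le (dual P))"
  proof -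
    obtain B where "B \<in> faces P" "rk P B = -1" "\<forall>G \<in> faces P. (B, G) \<in> le P"
      using assms unfolding polytope_def by blast
    then show ?thesis by (intro bexI[of _ B]) (auto simp: rk_dual le_dual)
  qed
  moreover have "(\<forall>\<Phi> \<in> flags (dual P). card \<Phi> = dim (dual P) + 2) \<and> base (dual P) \<in> flags (dual P)"
    using assms by (simp add: polytope_def)
  ultimately show ?thesis unfolding polytope_def by blast
qed

section \<open>Sections between two faces of the base flag\<close>

locale base_section = abstract_polytope P for P :: "'a ranked_poset" +
  fixes F G :: 'a
  assumes F: "F \<in> base P" and G: "G \<in> base P" and rk_FG: "rk P F < rk P G"
begin

abbreviation Q :: "'a ranked_poset" where "Q \<equiv> section_poset P G F"

definition S :: "'a set" where "S = {H. (F, H) \<in> le P \<and> (H, G) \<in> le P}"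

text \<open>A fixed completion: flags of the section are compared with the flags of \<open>P\<close>
  that contain these faces.\<close>

definition outer :: "'a set" where "outer = base P - S"

lemma le_Q: "le Q = Restr (le P) S" and rk_Q: "rk Q H = rk P H - rk P F - 1"
  and dim_Q: "int (dim Q) = rk P G - rk P F - 1" and base_Q: "base Q = base P \<inter> S"
  using rk_FG by (simp_all add: section_poset_def S_def Let_def)

lemma S_faces: "S \<subseteq> faces P"
  using le_faces by (auto simp: S_def)

lemma FG_S: "F \<in> S" "G \<in> S" and F_le: "H \<in> S \<Longrightarrow> (F, H) \<in> le P" and le_G: "H \<in> S \<Longrightarrow> (H, G) \<in> le P"
  using chain_le[OF flag_chain[OF base_flag] F G] rk_FG le_refl flag_faces[OF base_flag] F G
  by (auto simp: S_def)

lemma S_rk: "H \<in> S \<Longrightarrow> rk P F \<le> rk P H \<and> rk P H \<le> rk P G"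
  using F_le le_G rk_mono by blast

lemma flag_in_S:
  "\<lbrakk>\<Phi> \<in> Chains (le P); F \<in> \<Phi>; G \<in> \<Phi>; H \<in> \<Phi>; rk P F \<le> rk P H; rk P H \<le> rk P G\<rbrakk> \<Longrightarrow> H \<in> S"
  using chain_le by (simp add: S_def)

lemma outer_iff: "H \<in> outer \<longleftrightarrow> H \<in> base P \<and> (rk P H < rk P F \<or> rk P G < rk P H)"
proof -
  have "H \<in> S \<longleftrightarrow> rk P F \<le> rk P H \<and> rk P H \<le> rk P G" if "H \<in> base P"
    using flag_in_S[OF flag_chain[OF base_flag] F G that] S_rk by blast
  then show ?thesis by (auto simp: outer_def)
qed

lemma outer_disjoint: "outer \<inter> S = {}"
  by (auto simp: outer_def)

lemma faces_Q: "faces Q = S"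
  unfolding faces_def le_Q using S_faces le_refl by (auto simp: Field_def)

lemma Chains_Q: "C \<in> Chains (le Q) \<longleftrightarrow> C \<in> Chains (le P) \<and> C \<subseteq> S"
  unfolding Chains_def le_Q by blast

lemma chain_union_outer:
  assumes C: "C \<in> Chains (le P)" "C \<subseteq> S"
  shows "C \<union> outer \<in> Chains (le P)"
proof -
  note b = flag_chain[OF base_flag]
  have "(H, K) \<in> le P \<or> (K, H) \<in> le P" if "H \<in> C" "K \<in> outer" for H K
  proof -
    have K: "K \<in> base P" "rk P K < rk P F \<or> rk P G < rk P K" using that outer_iff by auto
    then have "(K, F) \<in> le P \<or> (G, K) \<in> le P"
      using chain_le[OF b K(1) F] chain_le[OF b G K(1)] by auto
    then show ?thesis using that C F_le le_G le_trans by blast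
  qed
  then show ?thesis using C(1) b unfolding Chains_def outer_def by blast
qed

lemma flag_split:
  assumes \<Phi>: "\<Phi> \<in> flags P" "F \<in> \<Phi>" "G \<in> \<Phi>" "outer \<subseteq> \<Phi>"
  shows "\<Phi> = (\<Phi> \<inter> S) \<union> outer"
proof -
  have "H \<in> S \<or> H \<in> outer" if H: "H \<in> \<Phi>" for H
  proof (cases "rk P F \<le> rk P H \<and> rk P H \<le> rk P G")
    case True then show ?thesis using flag_in_S flag_chain \<Phi> H by blast
  next
    case False
    have "rk P H \<in> {-1..n}" using rk_range flag_faces \<Phi> H by blast
    then obtain K where K: "K \<in> base P" "rk P K = rk P H"
      using flag_face_ex1[OF base_flag, of "rk P H"] by auto
    then have "K \<in> outer" using outer_iff[of K] False by (simp only: K not_le de_Morgan_conj simp_thms)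
    then have "K = H" using K flag_inj[OF \<Phi>(1)] \<Phi>(4) H by blast
    then show ?thesis using \<open>K \<in> outer\<close> by simp
  qed
  then show ?thesis using \<Phi> by blast
qed

text \<open>Extend the chain together with \<open>outer\<close> to a flag of \<open>P\<close>. By
  maximality its part in \<open>S\<close> is the given flag of the section, and outside
  \<open>S\<close> there is no room, since those ranks are already occupied by
  \<open>outer\<close>.\<close>

lemma flags_Q: "\<Psi> \<in> flags Q \<longleftrightarrow> \<Psi> \<subseteq> S \<and> \<Psi> \<union> outer \<in> flags P"
proof
  assume fl: "\<Psi> \<in> flags Q"
  then have ch: "\<Psi> \<in> Chains (le P)" "\<Psi> \<subseteq> S"
    and mx: "\<And>\<Psi>'. \<lbrakk>\<Psi>' \<in> Chains (le P); \<Psi>' \<subseteq> S; \<Psi> \<subseteq> \<Psi>'\<rbrakk> \<Longrightarrow> \<Psi>' = \<Psi>"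
    by (auto simp: flags_def Chains_Q)
  have "insert F \<Psi> \<in> Chains (le P)" "insert G \<Psi> \<in> Chains (le P)"
    using ch F_le le_G FG_S unfolding Chains_def by blast+
  then have FG: "F \<in> \<Psi>" "G \<in> \<Psi>" using mx ch FG_S by blast+
  obtain \<Phi> where \<Phi>: "\<Phi> \<in> flags P" "\<Psi> \<union> outer \<subseteq> \<Phi>"
    using chain_in_flag[OF chain_union_outer[OF ch]] by blast
  have "\<Phi> \<inter> S \<in> Chains (le P)" using flag_chain[OF \<Phi>(1)] by (auto simp: Chains_def)
  then have "\<Phi> \<inter> S = \<Psi>" using mx \<Phi>(2) ch(2) by blast
  moreover have "\<Phi> = (\<Phi> \<inter> S) \<union> outer" by (rule flag_split) (use \<Phi> FG in auto)
  ultimately have "\<Phi> = \<Psi> \<union> outer" by metis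
  then show "\<Psi> \<subseteq> S \<and> \<Psi> \<union> outer \<in> flags P" using \<Phi> ch by metis
next
  assume *: "\<Psi> \<subseteq> S \<and> \<Psi> \<union> outer \<in> flags P"
  then have ch: "\<Psi> \<in> Chains (le P)" using flag_chain[of "\<Psi> \<union> outer"] by (auto simp: Chains_def)
  have "\<Psi>' = \<Psi>" if "\<Psi>' \<in> Chains (le P)" "\<Psi>' \<subseteq> S" "\<Psi> \<subseteq> \<Psi>'" for \<Psi>'
  proof -
    have "\<Psi>' \<union> outer = \<Psi> \<union> outer"
      using * chain_union_outer[OF that(1,2)] that(3) by (auto simp: flags_def)
    then show ?thesis using outer_disjoint that * by blast
  qed
  then show "\<Psi> \<in> flags Q" using * ch by (auto simp: flags_def Chains_Q)
qed

lemma FG_flag: "\<Psi> \<in> flags Q \<Longrightarrow> F \<in> \<Psi> \<and> G \<in> \<Psi>"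
proof -
  assume \<Psi>: "\<Psi> \<in> flags Q"
  then have fl: "\<Psi> \<union> outer \<in> flags P" "\<Psi> \<subseteq> S" using flags_Q by auto
  have "H \<in> \<Psi>" if H: "H \<in> S" "H = F \<or> H = G" for H
  proof -
    have "rk P H \<in> {-1..n}" using rk_range S_faces H by blast
    then obtain K where K: "K \<in> \<Psi> \<union> outer" "rk P K = rk P H"
      using flag_face_ex1[OF fl(1), of "rk P H"] by auto
    then have "K \<in> \<Psi>" using outer_iff S_rk[OF H(1)] by auto
    then have "(F, K) \<in> le P" "(K, G) \<in> le P" using fl F_le le_G by auto
    then have "K = H" using K(2) H(2) rk_less by fastforce
    then show ?thesis using \<open>K \<in> \<Psi>\<close> by simp
  qed
  then show ?thesis using FG_S by blast
qed

lemma flag_Int_S: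
  assumes "\<Phi> \<in> flags P" "F \<in> \<Phi>" "G \<in> \<Phi>" "outer \<subseteq> \<Phi>"
  shows "\<Phi> \<inter> S \<in> flags Q"
  using flag_split[OF assms] assms(1) by (auto simp: flags_Q)

lemma polytope_Q: "polytope Q"
proof -
  have "Partial_order (le Q)"
    using polytope Partial_order_Restr unfolding le_Q polytope_def by blast
  moreover have "\<forall>H \<in> faces Q. - 1 \<le> rk Q H \<and> rk Q H \<le> int (dim Q)"
    using S_rk by (fastforce simp: faces_Q rk_Q dim_Q)
  moreover have "\<forall>H K. (H, K) \<in> le Q \<and> H \<noteq> K \<longrightarrow> rk Q H < rk Q K"
    using rk_less by (auto simp: le_Q rk_Q)
  moreover have "\<exists>H \<in> faces Q. rk Q H = - 1 \<and> (\<forall>K \<in> faces Q. (H, K) \<in> le Q)"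
    using FG_S F_le by (intro bexI[of _ F]) (auto simp: faces_Q rk_Q le_Q)
  moreover have "\<exists>H \<in> faces Q. rk Q H = int (dim Q) \<and> (\<forall>K \<in> faces Q. (K, H) \<in> le Q)"
    using FG_S le_G by (intro bexI[of _ G]) (auto simp: faces_Q rk_Q dim_Q le_Q)
  moreover have "card \<Psi> = dim Q + 2" if \<Psi>: "\<Psi> \<in> flags Q" for \<Psi>
  proof -
    have fl: "\<Psi> \<union> outer \<in> flags P" "\<Psi> \<subseteq> S" using \<Psi> flags_Q by auto
    have "rk P ` \<Psi> = {rk P F..rk P G}"
    proof
      show "rk P ` \<Psi> \<subseteq> {rk P F..rk P G}" using fl S_rk by auto
      show "{rk P F..rk P G} \<subseteq> rk P ` \<Psi>"
      proof
        fix j assume j: "j \<in> {rk P F..rk P G}"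
        have "rk P F \<in> {-1..n}" "rk P G \<in> {-1..n}" using rk_range S_faces FG_S by auto
        then obtain K where "K \<in> \<Psi> \<union> outer" "rk P K = j"
          using flag_face_ex1[OF fl(1), of j] j by auto
        then show "j \<in> rk P ` \<Psi>" using outer_iff j by auto
      qed
    qed
    moreover have "inj_on (rk P) \<Psi>"
      using chain_inj[OF flag_chain[OF fl(1)]] by (rule inj_on_subset) blast
    ultimately have "card \<Psi> = card {rk P F..rk P G}" by (metis card_image)
    then show ?thesis using dim_Q by simp
  qed
  moreover have "diamond_condition Q"
    unfolding diamond_condition_def
  proof (intro allI impI)
    fix A B assume *: "(A, B) \<in> le Q \<and> rk Q B = rk Q A + 2"
    then have AB: "A \<in> S" "B \<in> S" "(A, B) \<in> le P" "rk P B = rk P A + 2" by (auto simp: le_Q rk_Q)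
    have "card {H. (A, H) \<in> le P \<and> (H, B) \<in> le P \<and> rk P H = rk P A + 1} = 2"
      using polytope AB unfolding polytope_def diamond_condition_def by blast
    moreover have "H \<in> S" if "(A, H) \<in> le P" "(H, B) \<in> le P" for H
      using that AB le_trans unfolding S_def by blast
    then have "{H. (A, H) \<in> le Q \<and> (H, B) \<in> le Q \<and> rk Q H = rk Q A + 1} =
      {H. (A, H) \<in> le P \<and> (H, B) \<in> le P \<and> rk P H = rk P A + 1}"
      using AB by (auto simp: le_Q rk_Q)
    ultimately show "card {H. (A, H) \<in> le Q \<and> (H, B) \<in> le Q \<and> rk Q H = rk Q A + 1} = 2" by simp
  qed
  moreover have "strongly_flag_connected Q"
    unfolding strongly_flag_connected_def
  proof (intro ballI)
    fix \<Psi> \<Psi>' assume \<Psi>: "\<Psi> \<in> flags Q" "\<Psi>' \<in> flags Q"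
    let ?D = "(\<Psi> \<union> outer) \<inter> (\<Psi>' \<union> outer)"
    let ?R = "{(A, B). adjacent_flags Q A B \<and> \<Psi> \<inter> \<Psi>' \<subseteq> A \<and> \<Psi> \<inter> \<Psi>' \<subseteq> B}"
    have sub: "\<Psi> \<subseteq> S" "\<Psi>' \<subseteq> S" using \<Psi> flags_Q by auto
    have Int: "(\<Psi> \<union> outer) \<inter> S = \<Psi>" "(\<Psi>' \<union> outer) \<inter> S = \<Psi>'" using sub outer_disjoint by auto
    have FG: "F \<in> ?D" "G \<in> ?D" using FG_flag \<Psi> by auto
    \<comment> \<open>All flags on this path keep the common faces, among them \<open>F\<close>,
      \<open>G\<close> and \<open>outer\<close>, so they differ only inside \<open>S\<close> and the
      path can be cut down to the section.\<close>
    have "(\<Psi> \<union> outer, \<Psi>' \<union> outer) \<in>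
        {(A, B). adjacent_flags P A B \<and> ?D \<subseteq> A \<and> ?D \<subseteq> B}\<^sup>*"
      using polytope \<Psi> flags_Q unfolding polytope_def strongly_flag_connected_def by blast
    then have "((\<Psi> \<union> outer) \<inter> S, (\<Psi>' \<union> outer) \<inter> S) \<in> ?R\<^sup>*"
    proof (induction rule: rtrancl_induct)
      case base then show ?case by simp
    next
      case (step A B)
      then have AB: "adjacent_flags P A B" "?D \<subseteq> A" "?D \<subseteq> B" by auto
      then have fl: "A \<in> flags P" "B \<in> flags P" by (auto simp: adjacent_flags_def)
      have sA: "A = (A \<inter> S) \<union> outer" and sB: "B = (B \<inter> S) \<union> outer"
        using flag_split fl AB FG by blast+
      have "(A \<inter> S) - (B \<inter> S) = A - B" "(B \<inter> S) - (A \<inter> S) = B - A"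
        using sA sB outer_disjoint by blast+
      moreover have "A \<inter> S \<in> flags Q" "B \<inter> S \<in> flags Q" using flag_Int_S fl AB FG by blast+
      ultimately have "adjacent_flags Q (A \<inter> S) (B \<inter> S)"
        using AB(1) by (simp add: adjacent_flags_def)
      then have "(A \<inter> S, B \<inter> S) \<in> ?R" using AB sub by blast
      then show ?case using step.IH by (rule rtrancl_into_rtrancl[rotated])
    qed
    then show "(\<Psi>, \<Psi>') \<in> ?R\<^sup>*" using Int by simp
  qed
  moreover have "base Q \<in> flags Q"
    using flag_Int_S[OF base_flag F G] by (simp add: base_Q outer_def)
  ultimately show ?thesis unfolding polytope_def by blast
qed

sublocale Q: abstract_polytope Q
  by unfold_locales (fact polytope_Q)

text \<open>The shift \<open>rk P F + 1\<close> accounts for \<open>F\<close> having rank -1 in the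
  section.\<close>

lemma adj_Q:
  assumes \<Psi>: "\<Psi> \<in> flags Q" and j: "0 \<le> j" "j < int (dim Q)"
  shows "adj_flag Q \<Psi> j = adj (\<Psi> \<union> outer) (j + rk P F + 1) \<inter> S"
proof -
  let ?j = "j + rk P F + 1"
  have fl: "\<Psi> \<union> outer \<in> flags P" and sub: "\<Psi> \<subseteq> S" using \<Psi> flags_Q by auto
  have rF: "rk P F \<in> {-1..n}" "rk P G \<in> {-1..n}" using rk_range S_faces FG_S by auto
  have j': "0 \<le> ?j" "?j < n" "rk P F < ?j" "?j < rk P G" using j rF dim_Q by auto
  let ?\<Theta> = "adj (\<Psi> \<union> outer) ?j"
  have \<Theta>: "?\<Theta> \<in> flags P" using adj_flag_flag[OF fl j'(1,2)] .
  note ag = adj_agree[OF fl j'(1,2)]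
  have FG: "F \<in> ?\<Theta>" "G \<in> ?\<Theta>" using ag[of F] ag[of G] FG_flag[OF \<Psi>] j' by auto
  have o: "outer \<subseteq> ?\<Theta>" using ag outer_iff j' by fastforce
  show ?thesis
  proof (rule Q.adj_unique[OF \<Psi> j flag_Int_S[OF \<Theta> FG o]])
    show "?\<Theta> \<inter> S \<noteq> \<Psi>"
      using flag_split[OF \<Theta> FG o] adj_neq[OF fl j'(1,2)] by metis
  next
    fix H assume "rk Q H \<noteq> j"
    then have "rk P H \<noteq> ?j" by (simp add: rk_Q)
    then show "H \<in> ?\<Theta> \<inter> S \<longleftrightarrow> H \<in> \<Psi>" using ag[of H] sub outer_disjoint by blast
  qed
qed

end

section \<open>Rotations of chiral and directly regular polytopes\<close>

context abstract_polytope
begin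

lemma group_Gamma: "group \<Gamma>"
  by (rule group_aut_group)

lemma adjacent_adj:
  assumes "\<Phi> \<in> flags P" "0 \<le> j" "j < n"
  shows "adjacent_flags P \<Phi> (adj \<Phi> j)"
proof -
  have one: "card (X - Y) = 1" if XY: "X \<in> flags P" "Y \<in> flags P" "X \<noteq> Y"
    "\<And>F. rk P F \<noteq> j \<Longrightarrow> F \<in> Y \<longleftrightarrow> F \<in> X" for X Y
  proof -
    have "\<not> X \<subseteq> Y" using XY flag_subset_eq by blast
    then obtain F where F: "F \<in> X" "F \<notin> Y" by blast
    have "F' = F" if "F' \<in> X" "F' \<notin> Y" for F'
      using that F XY(4) flag_inj[OF XY(1)] by metis
    then have "X - Y = {F}" using F by blast
    then show ?thesis by simp
  qed
  show ?thesis
    using one[of \<Phi> "adj \<Phi> j"] one[of "adj \<Phi> j" \<Phi>] adj_flag_flag[OF assms] adj_neq[OF assms]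
      adj_agree[OF assms] assms(1) by (simp add: adjacent_flags_def)
qed

text \<open>As the product of \<open>\<Gamma>\<close> applies its left factor first, taking images
  is a right action; replacing \<open>\<Phi>\<close> by its image under \<open>g\<close> amounts to
  multiplication by \<open>g\<close> on the left.\<close>

lemma orbit_image:
  assumes g: "g \<in> carrier \<Gamma>" and \<Phi>: "\<Phi> \<in> flags P"
  shows "orbit \<Gamma> (`) (g ` \<Phi>) = orbit \<Gamma> (`) \<Phi>"
proof -
  interpret group \<Gamma> by (rule group_Gamma)
  note sub = flag_faces[OF \<Phi>]
  have "\<gamma> ` (g ` \<Phi>) \<in> orbit \<Gamma> (`) \<Phi>" if "\<gamma> \<in> carrier \<Gamma>" for \<gamma>
  proof -
    have "\<gamma> ` (g ` \<Phi>) = (g \<otimes>\<^bsub>\<Gamma>\<^esub> \<gamma>) ` \<Phi>" using aut_mult_image[OF sub] by simp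
    then show ?thesis using that g m_closed unfolding orbit_def by blast
  qed
  moreover have "\<gamma> ` \<Phi> \<in> orbit \<Gamma> (`) (g ` \<Phi>)" if \<gamma>: "\<gamma> \<in> carrier \<Gamma>" for \<gamma>
  proof -
    have "g \<otimes>\<^bsub>\<Gamma>\<^esub> (inv\<^bsub>\<Gamma>\<^esub> g \<otimes>\<^bsub>\<Gamma>\<^esub> \<gamma>) = \<gamma>" using g \<gamma> by (simp flip: m_assoc)
    then have "\<gamma> ` \<Phi> = (inv\<^bsub>\<Gamma>\<^esub> g \<otimes>\<^bsub>\<Gamma>\<^esub> \<gamma>) ` (g ` \<Phi>)" using aut_mult_image[OF sub] by metis
    then show ?thesis using g \<gamma> by (auto simp: orbit_def)
  qed
  ultimately show ?thesis by (auto simp: orbit_def)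
qed

lemma mem_orbit_self: "\<Phi> \<in> flags P \<Longrightarrow> \<Phi> \<in> orbit \<Gamma> (`) \<Phi>"
  using aut_one_image[OF flag_faces] monoid.one_closed[OF group.is_monoid[OF group_Gamma]]
  by (fastforce simp: orbit_def)

end

section \<open>Rotations indexed by pairs of ranks\<close>

locale rotary_polytope = abstract_polytope +
  assumes rotary: "chiral P \<or> directly_regular P"
begin

interpretation group \<Gamma> by (rule group_Gamma)

text \<open>In the chiral case each adjacency changes the orbit, and there are only two orbits, so
  two steps return to the orbit of the base flag.\<close>

lemma rotation_exists:
  assumes a: "0 \<le> a" "a < n" and b: "0 \<le> b" "b < n"
  shows "\<exists>\<gamma> \<in> carrier \<Gamma>. \<gamma> ` base P = adj (adj (base P) b) a"
proof -
  note fb = adj_flag_flag[OF base_flag b]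
  note fa = adj_flag_flag[OF fb a]
  from rotary show ?thesis
  proof
    assume "directly_regular P"
    then have "regular P" by (simp add: directly_regular_def)
    then show ?thesis using base_flag fa by (simp add: regular_def)
  next
    assume ch: "chiral P"
    let ?o = "orbit \<Gamma> (`)"
    have ne: "?o (base P) \<noteq> ?o (adj (base P) b)" "?o (adj (base P) b) \<noteq> ?o (adj (adj (base P) b) a)"
      using ch adjacent_adj base_flag fb a b by (auto simp: chiral_def)
    have "card (orbits \<Gamma> (flags P) (`)) = 2" using ch by (simp add: chiral_def)
    then obtain X Y where XY: "orbits \<Gamma> (flags P) (`) = {X, Y}" by (auto simp: card_2_iff)
    have "?o (base P) \<in> {X, Y}" "?o (adj (base P) b) \<in> {X, Y}" "?o (adj (adj (base P) b) a) \<in> {X, Y}"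
      using base_flag fa fb by (auto simp: orbits_def simp flip: XY)
    then have "?o (base P) = ?o (adj (adj (base P) b) a)" using ne by auto
    then have "adj (adj (base P) b) a \<in> ?o (base P)" using mem_orbit_self[OF fa] by simp
    then show ?thesis by (auto simp: orbit_def)
  qed
qed

text \<open>
  In a regular polytope \<open>T a b = \<rho>\<^sub>a \<rho>\<^sub>b\<close>; the cocycle identity \<open>T a b T b c = T a c\<close> holds in the
  chiral case as well, where the \<open>\<rho>\<^sub>j\<close> do not exist. Only ranks \<open>0 \<le> a, b < n\<close> are meaningful.
\<close>

definition T :: "int \<Rightarrow> int \<Rightarrow> 'a \<Rightarrow> 'a" where
  "T a b = (SOME \<gamma>. \<gamma> \<in> carrier \<Gamma> \<and> \<gamma> ` base P = adj (adj (base P) b) a)"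

lemma
  assumes "0 \<le> a" "a < n" "0 \<le> b" "b < n"
  shows T_closed: "T a b \<in> carrier \<Gamma>" and T_base: "T a b ` base P = adj (adj (base P) b) a"
proof -
  obtain \<gamma> where "\<gamma> \<in> carrier \<Gamma> \<and> \<gamma> ` base P = adj (adj (base P) b) a"
    using rotation_exists[OF assms] by blast
  from someI[of "\<lambda>\<gamma>. \<gamma> \<in> carrier \<Gamma> \<and> \<gamma> ` base P = adj (adj (base P) b) a", OF this]
  show "T a b \<in> carrier \<Gamma>" "T a b ` base P = adj (adj (base P) b) a" by (simp_all add: T_def)
qed

text \<open>Automorphisms commute with taking adjacent flags, so the image of the base flag under
  the product has steps in ranks \<open>c\<close>, \<open>b\<close>, \<open>b\<close>,
  \<open>a\<close>, and the two middle ones cancel.\<close>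

lemma T_mult:
  assumes a: "0 \<le> a" "a < n" and b: "0 \<le> b" "b < n" and c: "0 \<le> c" "c < n"
  shows "T a b \<otimes>\<^bsub>\<Gamma>\<^esub> T b c = T a c"
proof (rule aut_eqI[OF _ _ base_flag])
  note fc = adj_flag_flag[OF base_flag c] and fb = adj_flag_flag[OF base_flag b]
  have "(T a b \<otimes>\<^bsub>\<Gamma>\<^esub> T b c) ` base P = T b c ` adj (adj (base P) b) a"
    using aut_mult_image[OF flag_faces[OF base_flag]] T_base a b by simp
  also have "\<dots> = adj (adj (T b c ` base P) b) a"
    using aut_adj[OF T_closed[OF b c]] base_flag fb a b by simp
  also have "\<dots> = adj (adj (base P) c) a"
    using T_base[OF b c] adj_adj[OF fc b] by simp
  finally show "(T a b \<otimes>\<^bsub>\<Gamma>\<^esub> T b c) ` base P = T a c ` base P" using T_base a c by simp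
qed (use T_closed a b c in auto)

lemma T_same: "\<lbrakk>0 \<le> a; a < n\<rbrakk> \<Longrightarrow> T a a = \<one>\<^bsub>\<Gamma>\<^esub>"
  using T_mult[of a a a] T_closed[of a a] by simp

lemma T_inv: "\<lbrakk>0 \<le> a; a < n; 0 \<le> b; b < n\<rbrakk> \<Longrightarrow> inv\<^bsub>\<Gamma>\<^esub> (T a b) = T b a"
  using T_mult[of b a b] T_same[of b] T_closed by (simp add: inv_equality)

lemma T_square:
  assumes a: "0 \<le> a" "a < n" and b: "0 \<le> b" "b < n" and ab: "a \<le> b - 2 \<or> b \<le> a - 2"
  shows "T a b \<otimes>\<^bsub>\<Gamma>\<^esub> T a b = \<one>\<^bsub>\<Gamma>\<^esub>"
proof (rule aut_eqI[OF _ _ base_flag])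
  note fb = adj_flag_flag[OF base_flag b] and fa = adj_flag_flag[OF base_flag a]
  have "(T a b \<otimes>\<^bsub>\<Gamma>\<^esub> T a b) ` base P = T a b ` adj (adj (base P) b) a"
    using aut_mult_image[OF flag_faces[OF base_flag]] T_base a b by simp
  also have "\<dots> = adj (adj (adj (adj (base P) b) a) b) a"
    using aut_adj[OF T_closed[OF a b]] base_flag fb a b T_base by simp
  also have "\<dots> = base P"
    using adj_commute[OF fb a b ab] adj_adj[OF base_flag b] adj_adj[OF base_flag a] by simp
  finally show "(T a b \<otimes>\<^bsub>\<Gamma>\<^esub> T a b) ` base P = \<one>\<^bsub>\<Gamma>\<^esub> ` base P"
    using aut_one_image[OF flag_faces[OF base_flag]] by simp
qed (use T_closed a b in auto)

lemma T_nontrivial: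
  assumes "0 \<le> a" "a < n" "0 \<le> b" "b < n" "a \<noteq> b"
  shows "T a b \<noteq> \<one>\<^bsub>\<Gamma>\<^esub>"
proof
  note fb = adj_flag_flag[OF base_flag assms(3,4)]
  assume "T a b = \<one>\<^bsub>\<Gamma>\<^esub>"
  then have e: "adj (adj (base P) b) a = base P"
    using T_base[OF assms(1-4)] aut_one_image[OF flag_faces[OF base_flag]] by simp
  obtain F where F: "F \<in> base P" "rk P F = a" using flag_face_ex1[OF base_flag, of a] assms by auto
  then have "F \<in> adj (base P) b" using adj_agree[OF base_flag assms(3,4)] assms(5) by auto
  then have "F \<notin> adj (adj (base P) b) a" using adj_rank_neq[OF fb assms(1,2)] F by blast
  then show False using e F by simp
qed

lemma sigma_T: "\<lbrakk>1 \<le> i; int i < n\<rbrakk> \<Longrightarrow> sigma P i = T (int i - 1) (int i)"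
  using T_closed[of "int i - 1" "int i"] T_base[of "int i - 1" "int i"] by (intro sigma_eqI) auto

lemma sigma_image_closed: "sigma P ` {1..dim P - 1} \<subseteq> carrier \<Gamma>"
  using sigma_T T_closed by fastforce

lemma rotation_carrier: "carrier (rotation_group P) = generate \<Gamma> (sigma P ` {1..dim P - 1})"
  using sigma_image_closed
  by (simp add: rotation_group_def carrier_subgroup_generated Int_absorb1)

lemma rotation_subgroup: "subgroup (carrier (rotation_group P)) \<Gamma>"
  unfolding rotation_carrier using generate_is_subgroup sigma_image_closed by blast

lemma rotation_subset: "carrier (rotation_group P) \<subseteq> carrier \<Gamma>"
  using rotation_subgroup subgroup.subset by blast

text \<open>For \<open>a \<le> b\<close> the cocycle identity writes \<open>T a b\<close> as the
  product of the \<open>sigma P i\<close> with \<open>i\<close> from \<open>a + 1\<close> to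
  \<open>b\<close>; exchanging the ranks gives the inverse.\<close>

lemma T_rotation:
  assumes "0 \<le> a" "a < n" "0 \<le> b" "b < n"
  shows "T a b \<in> carrier (rotation_group P)"
proof -
  have up: "b < n \<Longrightarrow> T a b \<in> carrier (rotation_group P)" if "a \<le> b" "0 \<le> a" for a b
    using that(1)
  proof (induction b rule: int_ge_induct)
    case base
    then show ?case using T_same that subgroup.one_closed[OF rotation_subgroup] by auto
  next
    case (step b)
    have "T b (b + 1) = sigma P (nat (b + 1))"
      using sigma_T[of "nat (b + 1)"] step that by simp
    moreover have "nat (b + 1) \<in> {1..dim P - 1}" using step that by auto
    ultimately have "T b (b + 1) \<in> carrier (rotation_group P)"
      unfolding rotation_carrier by (metis generate.incl imageI)
    moreover have "T a (b + 1) = T a b \<otimes>\<^bsub>\<Gamma>\<^esub> T b (b + 1)" using T_mult step that by simp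
    ultimately show ?case using step subgroup.m_closed[OF rotation_subgroup] by simp
  qed
  show ?thesis
  proof (cases "a \<le> b")
    case True then show ?thesis using up assms by blast
  next
    case False
    then have "T b a \<in> carrier (rotation_group P)" using up assms by simp
    then have "inv\<^bsub>\<Gamma>\<^esub> (T b a) \<in> carrier (rotation_group P)" by (rule subgroup.m_inv_closed[OF rotation_subgroup])
    then show ?thesis using T_inv assms by simp
  qed
qed

text \<open>In the regular case these are the products \<open>\<rho>\<^sub>b \<rho>\<^sub>c\<close>
  of two reflections with ranks in \<open>I\<close>. They generate the even words in these
  reflections, which will turn out to be the rotations fixing the base faces of all other
  ranks.\<close>

definition TI :: "int set \<Rightarrow> ('a \<Rightarrow> 'a) set" where "TI I = {T b c |b c. b \<in> I \<and> c \<in> I}"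

lemma TI_rotation: "I \<subseteq> {0..<n} \<Longrightarrow> generate \<Gamma> (TI I) \<subseteq> carrier (rotation_group P)"
  by (rule generate_subgroup_incl[OF _ rotation_subgroup]) (auto simp: TI_def intro!: T_rotation)

lemma reachable_flag:
  assumes I: "I \<subseteq> {0..<n}" and a: "a \<in> I" and \<Psi>: "\<Psi> \<in> flags P"
    and agree: "\<And>F. \<lbrakk>F \<in> base P; rk P F \<notin> I\<rbrakk> \<Longrightarrow> F \<in> \<Psi>"
  shows "\<exists>h \<in> generate \<Gamma> (TI I). \<Psi> = h ` base P \<or> \<Psi> = h ` adj (base P) a"
proof (rule flags_connected[where Q = "\<lambda>\<Theta>. \<exists>h \<in> generate \<Gamma> (TI I). \<Theta> = h ` base P \<or> \<Theta> = h ` adj (base P) a",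
      OF base_flag \<Psi>])
  show "\<exists>h \<in> generate \<Gamma> (TI I). base P = h ` base P \<or> base P = h ` adj (base P) a"
    using generate.one aut_one_image[OF flag_faces[OF base_flag]] by metis
next
  fix \<Theta> j
  assume \<Theta>: "\<Theta> \<in> flags P" and h: "\<exists>h \<in> generate \<Gamma> (TI I). \<Theta> = h ` base P \<or> \<Theta> = h ` adj (base P) a"
    and sub: "base P \<inter> \<Psi> \<subseteq> \<Theta>" "base P \<inter> \<Psi> \<subseteq> adj \<Theta> j" and j: "0 \<le> j" "j < n"
  \<comment> \<open>A step of rank outside \<open>I\<close> would remove a base face that
    \<open>\<Psi>\<close> contains as well, contrary to strong connectedness.\<close>
  have jI: "j \<in> I"
  proof (rule ccontr)
    assume "j \<notin> I"
    obtain F where F: "F \<in> base P" "rk P F = j" using flag_face_ex1[OF base_flag, of j] j by auto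
    then have "F \<in> base P \<inter> \<Psi>" using agree \<open>j \<notin> I\<close> by blast
    then show False using sub adj_rank_neq[OF \<Theta> j _ F(2)] by blast
  qed
  have a': "0 \<le> a" "a < n" using a I by auto
  note fa = adj_flag_flag[OF base_flag a'] and fj = adj_flag_flag[OF base_flag j]
  have Tg: "T a j \<in> generate \<Gamma> (TI I)" "T j a \<in> generate \<Gamma> (TI I)"
    using a jI by (auto intro!: generate.incl simp: TI_def)
  have Gc: "generate \<Gamma> (TI I) \<subseteq> carrier \<Gamma>" using TI_rotation[OF I] rotation_subset by blast
  from h obtain h where h: "h \<in> generate \<Gamma> (TI I)" "\<Theta> = h ` base P \<or> \<Theta> = h ` adj (base P) a" by blast
  have hc: "h \<in> carrier \<Gamma>" using h Gc by blast
  from h(2) show "\<exists>h \<in> generate \<Gamma> (TI I). adj \<Theta> j = h ` base P \<or> adj \<Theta> j = h ` adj (base P) a"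
  proof
    assume "\<Theta> = h ` base P"
    then have "adj \<Theta> j = h ` adj (base P) j" using aut_adj[OF hc base_flag j] by simp
    also have "adj (base P) j = T a j ` adj (base P) a"
      using aut_adj[OF T_closed[OF a' j] base_flag a'] T_base[OF a' j] adj_adj[OF fj a'] by simp
    also have "h ` (T a j ` adj (base P) a) = (T a j \<otimes>\<^bsub>\<Gamma>\<^esub> h) ` adj (base P) a"
      using aut_mult_image[OF flag_faces[OF fa]] by simp
    finally show ?thesis using generate.eng[OF Tg(1) h(1)] by blast
  next
    assume "\<Theta> = h ` adj (base P) a"
    then have "adj \<Theta> j = h ` adj (adj (base P) a) j" using aut_adj[OF hc fa j] by simp
    also have "\<dots> = h ` (T j a ` base P)" using T_base[OF j a'] by simp
    also have "\<dots> = (T j a \<otimes>\<^bsub>\<Gamma>\<^esub> h) ` base P"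
      using aut_mult_image[OF flag_faces[OF base_flag]] by simp
    finally show ?thesis using generate.eng[OF Tg(2) h(1)] by blast
  qed
qed

text \<open>
  If some rotation exchanged two adjacent flags, then rotations would be transitive on flags, so
  that the rotation group would be the whole group.
\<close>

lemma rotation_parity:
  assumes g: "g \<in> carrier (rotation_group P)" and a: "0 \<le> a" "a < n"
  shows "g ` base P \<noteq> adj (base P) a"
proof
  assume gb: "g ` base P = adj (base P) a"
  have gc: "g \<in> carrier \<Gamma>" using g rotation_subset by blast
  from rotary show False
  proof
    assume "chiral P"
    then have "orbit \<Gamma> (`) (base P) \<noteq> orbit \<Gamma> (`) (adj (base P) a)"
      using adjacent_adj[OF base_flag a] by (simp add: chiral_def)
    then show False using orbit_image[OF gc base_flag] gb by simp
  next
    assume dr: "directly_regular P"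
    have "\<gamma> \<in> carrier (rotation_group P)" if \<gamma>: "\<gamma> \<in> carrier \<Gamma>" for \<gamma>
    proof -
      have base_out: "rk P F \<in> {0..<n} \<or> rk P F = -1 \<or> rk P F = n" if "F \<in> base P" for F
        using rk_range flag_faces[OF base_flag] that by fastforce
      obtain h where h: "h \<in> generate \<Gamma> (TI {0..<n})"
        "\<gamma> ` base P = h ` base P \<or> \<gamma> ` base P = h ` adj (base P) a"
      proof -
        have "F \<in> \<gamma> ` base P" if F: "F \<in> base P" "rk P F \<notin> {0..<n}" for F
        proof -
          have "F \<in> faces P" using F flag_faces base_flag by blast
          moreover from this have "\<gamma> F \<in> faces P" "rk P (\<gamma> F) = rk P F" using aut_face aut_rk \<gamma> by auto
          ultimately have "\<gamma> F = F" using base_out F bottom_unique top_unique by metis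
          then show ?thesis using F by force
        qed
        then show thesis
          using that reachable_flag[of "{0..<n}" a "\<gamma> ` base P"] a aut_flag[OF \<gamma> base_flag] by auto
      qed
      have hr: "h \<in> carrier (rotation_group P)" using h TI_rotation by blast
      then have hc: "h \<in> carrier \<Gamma>" using rotation_subset by blast
      from h(2) show ?thesis
      proof
        assume "\<gamma> ` base P = h ` base P"
        then show ?thesis using aut_eqI[OF \<gamma> hc base_flag] hr by simp
      next
        assume "\<gamma> ` base P = h ` adj (base P) a"
        then have "\<gamma> ` base P = (g \<otimes>\<^bsub>\<Gamma>\<^esub> h) ` base P"
          using aut_mult_image[OF flag_faces[OF base_flag]] gb by simp
        then have "\<gamma> = g \<otimes>\<^bsub>\<Gamma>\<^esub> h" using aut_eqI[OF \<gamma> _ base_flag] gc hc by simp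
        then show ?thesis using g hr subgroup.m_closed[OF rotation_subgroup] by simp
      qed
    qed
    then have "carrier (rotation_group P) = carrier \<Gamma>" using rotation_subset by blast
    then have "rcosets\<^bsub>\<Gamma>\<^esub> carrier (rotation_group P) = {carrier \<Gamma>}"
      using coset_join2[OF _ subgroup_self] by (auto simp: RCOSETS_def)
    then show False using dr by (simp add: directly_regular_def)
  qed
qed

lemma rotation_stabilizer:
  assumes I: "I \<subseteq> {0..<n}" and g: "g \<in> carrier (rotation_group P)"
    and fix_g: "\<And>F. \<lbrakk>F \<in> base P; rk P F \<notin> I\<rbrakk> \<Longrightarrow> g F = F"
  shows "g \<in> generate \<Gamma> (TI I)"
proof -
  have gc: "g \<in> carrier \<Gamma>" using g rotation_subset by blast
  show ?thesis
  proof (cases "I = {}")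
    case True
    \<comment> \<open>No rank is available for \<open>reachable_flag\<close> here, but
      \<open>g\<close> fixes the base flag and freeness suffices.\<close>
    then have "g ` base P = \<one>\<^bsub>\<Gamma>\<^esub> ` base P"
      using fix_g aut_one_image[OF flag_faces[OF base_flag]] by simp
    then have "g = \<one>\<^bsub>\<Gamma>\<^esub>" using aut_eqI[OF gc _ base_flag] by simp
    then show ?thesis using generate.one by simp
  next
    case False
    then obtain a where a: "a \<in> I" by blast
    then have a': "0 \<le> a" "a < n" using I by auto
    have "F \<in> g ` base P" if "F \<in> base P" "rk P F \<notin> I" for F
      using fix_g[OF that] that by force
    then obtain h where h: "h \<in> generate \<Gamma> (TI I)" "g ` base P = h ` base P \<or> g ` base P = h ` adj (base P) a"
      using reachable_flag[OF I a aut_flag[OF gc base_flag]] by blast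
    have hr: "h \<in> carrier (rotation_group P)" using h TI_rotation[OF I] by blast
    then have hc: "h \<in> carrier \<Gamma>" using rotation_subset by blast
    have "g ` base P \<noteq> h ` adj (base P) a"
    proof
      assume "g ` base P = h ` adj (base P) a"
      then have "(g \<otimes>\<^bsub>\<Gamma>\<^esub> inv\<^bsub>\<Gamma>\<^esub> h) ` base P = (inv\<^bsub>\<Gamma>\<^esub> h) ` (h ` adj (base P) a)"
        using aut_mult_image[OF flag_faces[OF base_flag]] by simp
      also have "\<dots> = (h \<otimes>\<^bsub>\<Gamma>\<^esub> inv\<^bsub>\<Gamma>\<^esub> h) ` adj (base P) a"
        using aut_mult_image[OF flag_faces[OF adj_flag_flag[OF base_flag a']]] by simp
      also have "\<dots> = adj (base P) a"
        using hc aut_one_image[OF flag_faces[OF adj_flag_flag[OF base_flag a']]] by simp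
      finally have "(g \<otimes>\<^bsub>\<Gamma>\<^esub> inv\<^bsub>\<Gamma>\<^esub> h) ` base P = adj (base P) a" .
      moreover have "g \<otimes>\<^bsub>\<Gamma>\<^esub> inv\<^bsub>\<Gamma>\<^esub> h \<in> carrier (rotation_group P)"
        using g hr subgroup.m_closed[OF rotation_subgroup] subgroup.m_inv_closed[OF rotation_subgroup] by simp
      ultimately show False using rotation_parity a' by blast
    qed
    then have "g = h" using aut_eqI[OF gc hc base_flag] h by blast
    then show ?thesis using h by simp
  qed
qed

lemma T_fixes:
  assumes a: "0 \<le> a" "a < n" and b: "0 \<le> b" "b < n" and F: "F \<in> base P" "rk P F \<noteq> a" "rk P F \<noteq> b"
  shows "T a b F = F"
proof -
  note fb = adj_flag_flag[OF base_flag b]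
  have F1: "F \<in> T a b ` base P"
    using adj_agree[OF base_flag b] adj_agree[OF fb a] F T_base[OF a b] by simp
  have Ff: "F \<in> faces P" using F flag_faces base_flag by blast
  have "T a b F \<in> T a b ` base P" using F by blast
  moreover have "rk P (T a b F) = rk P F" using aut_rk[OF T_closed[OF a b] Ff] .
  ultimately show ?thesis
    using F1 flag_inj[OF aut_flag[OF T_closed[OF a b] base_flag]] by blast
qed

end

section \<open>The mix of a rotary polytope with its dual\<close>

text \<open>The mix is taken inside the product of two generated subgroups. Generation gives the
  same set in the ambient product, so all later computations can be made in a product of full
  automorphism groups.\<close>

lemma group_mix_eq:
  assumes "group G" "group H" and x: "x ` {1..k} \<subseteq> carrier G" and y: "y ` {1..k} \<subseteq> carrier H"
  shows "group_mix k (subgroup_generated G (x ` {1..k})) x (subgroup_generated H (y ` {1..k})) y =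
    (G \<times>\<times> H)\<lparr>carrier := generate (G \<times>\<times> H) ((\<lambda>i. (x i, y i)) ` {1..k})\<rparr>"
proof -
  interpret G: group G by fact
  interpret H: group H by fact
  interpret GH: group "G \<times>\<times> H" using DirProd_group assms(1,2) .
  let ?A = "generate G (x ` {1..k})" and ?B = "generate H (y ` {1..k})"
  let ?X = "(\<lambda>i. (x i, y i)) ` {1..k}"
  have "subgroup_generated G (x ` {1..k}) \<times>\<times> subgroup_generated H (y ` {1..k}) =
      (G \<times>\<times> H)\<lparr>carrier := ?A \<times> ?B\<rparr>"
    using x y by (simp add: subgroup_generated_def DirProd_def Int_absorb1)
  moreover have X: "?X \<subseteq> ?A \<times> ?B" by (auto intro: generate.incl)
  moreover have "subgroup (?A \<times> ?B) (G \<times>\<times> H)"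
    using DirProd_subgroups[OF assms(1) G.generate_is_subgroup[OF x] assms(2) H.generate_is_subgroup[OF y]] .
  ultimately show ?thesis
    using GH.generate_consistent[OF X]
    by (simp add: group_mix_def subgroup_generated_def Int_absorb1)
qed

section \<open>Restriction of automorphisms to a section\<close>

context base_section
begin

definition stab :: "('a \<Rightarrow> 'a) set" where "stab = {\<gamma> \<in> carrier \<Gamma>. \<gamma> F = F \<and> \<gamma> G = G}"

lemma FG_faces: "F \<in> faces P" "G \<in> faces P"
  using FG_S S_faces by auto

lemma stab_subgroup: "subgroup stab \<Gamma>"
proof -
  interpret group \<Gamma> by (rule group_Gamma)
  have "(inv\<^bsub>\<Gamma>\<^esub> \<gamma>) H = H" if "\<gamma> \<in> carrier \<Gamma>" "H \<in> faces P" "\<gamma> H = H" for \<gamma> H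
    using aut_mult_apply[OF that(2), of \<gamma> "inv\<^bsub>\<Gamma>\<^esub> \<gamma>"] aut_one_apply that by simp
  then show ?thesis
    using FG_faces aut_one_apply by (intro subgroupI) (auto simp: stab_def aut_mult_apply)
qed

lemma stab_S:
  assumes \<gamma>: "\<gamma> \<in> stab"
  shows "bij_betw \<gamma> S S"
proof -
  have \<gamma>c: "\<gamma> \<in> carrier \<Gamma>" and fix_\<gamma>: "\<gamma> F = F" "\<gamma> G = G" using \<gamma> by (auto simp: stab_def)
  have iff: "\<gamma> H \<in> S \<longleftrightarrow> H \<in> S" if "H \<in> faces P" for H
    using aut_le[OF \<gamma>c FG_faces(1) that] aut_le[OF \<gamma>c that FG_faces(2)] fix_\<gamma> by (simp add: S_def)
  have "S \<subseteq> \<gamma> ` S"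
  proof
    fix H assume H: "H \<in> S"
    then obtain K where "K \<in> faces P" "H = \<gamma> K"
      using aut_bij[OF \<gamma>c] S_faces by (metis bij_betw_imp_surj_on imageE subsetD)
    then show "H \<in> \<gamma> ` S" using iff H by blast
  qed
  moreover have "\<gamma> ` S \<subseteq> S" using iff S_faces by blast
  ultimately show ?thesis using aut_inj[OF \<gamma>c] S_faces by (auto simp: bij_betw_def intro: inj_on_subset)
qed

lemma restrict_aut: "\<gamma> \<in> stab \<Longrightarrow> restrict \<gamma> S \<in> carrier (aut_group Q)"
proof -
  assume \<gamma>: "\<gamma> \<in> stab"
  then have \<gamma>c: "\<gamma> \<in> carrier \<Gamma>" by (simp add: stab_def)
  have bij: "bij_betw (restrict \<gamma> S) S S" using stab_S[OF \<gamma>] by (simp add: bij_betw_restrict_eq)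
  have "\<gamma> H \<in> S" if "H \<in> S" for H using stab_S[OF \<gamma>] that by (auto dest: bij_betwE)
  then show ?thesis
    using bij aut_le[OF \<gamma>c] S_faces by (auto simp: aut_group_def faces_Q le_Q Bij_def)
qed

lemma restrict_mult:
  assumes "\<alpha> \<in> stab"
  shows "restrict (\<alpha> \<otimes>\<^bsub>\<Gamma>\<^esub> \<beta>) S = restrict \<alpha> S \<otimes>\<^bsub>aut_group Q\<^esub> restrict \<beta> S"
proof
  fix H
  have "\<alpha> H \<in> S" if "H \<in> S" using stab_S[OF assms] that by (auto dest: bij_betwE)
  moreover have "(\<alpha> \<otimes>\<^bsub>\<Gamma>\<^esub> \<beta>) H = \<beta> (\<alpha> H)" if "H \<in> S" using aut_mult_apply S_faces that by blast
  ultimately show "restrict (\<alpha> \<otimes>\<^bsub>\<Gamma>\<^esub> \<beta>) S H = (restrict \<alpha> S \<otimes>\<^bsub>aut_group Q\<^esub> restrict \<beta> S) H"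
    by (simp add: aut_group_def faces_Q compose_def)
qed

lemma restrict_base: "\<gamma> \<in> stab \<Longrightarrow> restrict \<gamma> S ` base Q = \<gamma> ` base P \<inter> S"
proof -
  assume \<gamma>: "\<gamma> \<in> stab"
  then have \<gamma>c: "\<gamma> \<in> carrier \<Gamma>" by (simp add: stab_def)
  have "H \<in> S" if H: "H \<in> base P" "\<gamma> H \<in> S" for H
  proof -
    obtain K where K: "K \<in> S" "\<gamma> H = \<gamma> K" using stab_S[OF \<gamma>] H(2) by (metis bij_betw_imp_surj_on imageE)
    then have "H = K"
      using aut_inj[OF \<gamma>c] H(1) flag_faces[OF base_flag] S_faces by (meson inj_onD subsetD)
    then show ?thesis using K by simp
  qed
  moreover have "\<gamma> H \<in> S" if "H \<in> S" for H using stab_S[OF \<gamma>] that by (auto dest: bij_betwE)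
  ultimately show ?thesis by (auto simp: base_Q)
qed

lemma restrict_inj:
  assumes "\<alpha> \<in> stab" "\<beta> \<in> stab" "restrict \<alpha> S = restrict \<beta> S" "\<And>H. H \<in> outer \<Longrightarrow> \<alpha> H = \<beta> H"
  shows "\<alpha> = \<beta>"
proof (rule aut_eqI[OF _ _ base_flag])
  have "\<alpha> H = \<beta> H" if "H \<in> base P" for H
  proof (cases "H \<in> S")
    case True then show ?thesis using assms(3) by (metis restrict_apply')
  next
    case False then show ?thesis using assms(4) that by (simp add: outer_def)
  qed
  then show "\<alpha> ` base P = \<beta> ` base P" by (simp cong: image_cong)
qed (use assms in \<open>auto simp: stab_def\<close>)

lemma adj_adj_Q:
  assumes i: "0 \<le> i" "i < int (dim Q)" and j: "0 \<le> j" "j < int (dim Q)"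
  shows "adj_flag Q (adj_flag Q (base Q) i) j =
    adj (adj (base P) (i + rk P F + 1)) (j + rk P F + 1) \<inter> S"
proof -
  have b: "base Q \<union> outer = base P" by (auto simp: base_Q outer_def)
  have rF: "rk P F \<in> {-1..n}" "rk P G \<in> {-1..n}" using rk_range FG_faces by auto
  have i': "0 \<le> i + rk P F + 1" "i + rk P F + 1 < n" "rk P F < i + rk P F + 1" "i + rk P F + 1 < rk P G"
    using i rF dim_Q by auto
  let ?\<Theta> = "adj (base P) (i + rk P F + 1)"
  note ag = adj_agree[OF base_flag i'(1,2)]
  have 1: "adj_flag Q (base Q) i = ?\<Theta> \<inter> S" using adj_Q[OF Q.base_flag i] b by simp
  have FG: "F \<in> ?\<Theta>" "G \<in> ?\<Theta>" using ag[of F] ag[of G] F G i' by auto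
  have o: "outer \<subseteq> ?\<Theta>" using ag outer_iff i' by fastforce
  have fl: "?\<Theta> \<in> flags P" using adj_flag_flag[OF base_flag i'(1,2)] .
  have 2: "(?\<Theta> \<inter> S) \<union> outer = ?\<Theta>" using flag_split[OF fl FG o] by simp
  show ?thesis using adj_Q[OF flag_Int_S[OF fl FG o] j] by (simp add: 1 2)
qed

lemma sigma_Q:
  assumes "\<gamma> \<in> stab" "1 \<le> i" "int i < int (dim Q)"
    and "\<gamma> ` base P = adj (adj (base P) (int i + rk P F + 1)) (int i + rk P F)"
  shows "sigma Q i = restrict \<gamma> S"
proof (rule Q.sigma_eqI)
  show "restrict \<gamma> S ` base Q = Q.adj (Q.adj (base Q) (int i)) (int i - 1)"
    unfolding restrict_base[OF assms(1)] assms(4)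
    using adj_adj_Q[of "int i" "int i - 1"] assms(2,3) by (simp add: algebra_simps)
qed (use assms restrict_aut in auto)

text \<open>Rank \<open>i\<close> of the dual is rank \<open>dim Q - 1 - i\<close> of the section;
  the shift by \<open>rk P F + 1\<close> turns this into \<open>rk P G - 1 - i\<close>, so that
  ranks are counted downwards from \<open>G\<close>.\<close>

lemma sigma_dual_Q:
  assumes "\<gamma> \<in> stab" "1 \<le> i" "int i < int (dim Q)"
    and "\<gamma> ` base P = adj (adj (base P) (rk P G - 1 - int i)) (rk P G - int i)"
  shows "sigma (dual Q) i = restrict \<gamma> S"
proof -
  interpret D: abstract_polytope "dual Q" by unfold_locales (rule polytope_dual[OF polytope_Q])
  let ?d = "int (dim Q)"
  have "adj_flag (dual Q) (adj_flag (dual Q) (base (dual Q)) (int i)) (int i - 1) =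
    adj_flag Q (adj_flag Q (base Q) (?d - 1 - int i)) (?d - int i)"
    by (simp add: adj_flag_dual algebra_simps)
  also have "\<dots> = adj (adj (base P) (?d - 1 - int i + rk P F + 1)) (?d - int i + rk P F + 1) \<inter> S"
    by (rule adj_adj_Q) (use assms in auto)
  also have "\<dots> = restrict \<gamma> S ` base (dual Q)"
    unfolding base_dual restrict_base[OF assms(1)] assms(4) by (simp add: dim_Q algebra_simps)
  finally have "restrict \<gamma> S ` base (dual Q) =
    adj_flag (dual Q) (adj_flag (dual Q) (base (dual Q)) (int i)) (int i - 1)" by simp
  then show ?thesis using assms restrict_aut by (intro D.sigma_eqI) (auto simp: aut_group_dual)
qed

end

context abstract_polytope
begin

lemma aut_fixes_extreme:
  assumes "\<gamma> \<in> carrier \<Gamma>" "F \<in> faces P" "rk P F = -1 \<or> rk P F = n"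
  shows "\<gamma> F = F"
  using assms aut_face aut_rk bottom_unique top_unique by metis

lemma base_face:
  assumes "-1 \<le> j" "j \<le> n"
  shows "base_face P j \<in> base P" "rk P (base_face P j) = j"
  using theI'[OF flag_face_ex1[OF base_flag assms]] by (simp_all add: base_face_def)

lemma finite_aut: "finite (faces P) \<Longrightarrow> finite (carrier \<Gamma>)"
proof -
  assume "finite (faces P)"
  then have "finite (faces P \<rightarrow>\<^sub>E faces P)" by (simp add: finite_PiE)
  moreover have "carrier \<Gamma> \<subseteq> faces P \<rightarrow>\<^sub>E faces P"
    using aut_face by (auto simp: PiE_def aut_group_def Bij_def)
  ultimately show ?thesis by (rule rev_finite_subset)
qed

end

lemma (in group) card_subgroup_dvd:
  assumes "subgroup A G" "subgroup B G" "A \<subseteq> B"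
  shows "card A dvd card B"
proof -
  have "subgroup A (G\<lparr>carrier := B\<rparr>)" using subgroup_incl assms by blast
  from group.lagrange[OF subgroup_imp_group[OF assms(2)] this]
  have "card (rcosets\<^bsub>G\<lparr>carrier := B\<rparr>\<^esub> A) * card A = card B" by (simp add: order_def)
  then show ?thesis by (metis dvd_triv_right)
qed

section \<open>The mix with the dual in rank four\<close>

locale rotary_polytope4 = rotary_polytope +
  assumes dim4: "dim P = 4"
begin

interpretation \<Gamma>: group \<Gamma> by (rule group_Gamma)

abbreviation \<Gamma>\<Gamma> where "\<Gamma>\<Gamma> \<equiv> \<Gamma> \<times>\<times> \<Gamma>"

interpretation \<Gamma>\<Gamma>: group \<Gamma>\<Gamma> by (rule DirProd_group[OF group_Gamma group_Gamma])

text \<open>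
  With \<open>R a b\<close> for \<open>T a b\<close>, the generators of the mix satisfy the same cocycle identity, because
  dualizing turns rank \<open>j\<close> into rank \<open>3 - j\<close>.
\<close>

definition R :: "int \<Rightarrow> int \<Rightarrow> ('a \<Rightarrow> 'a) \<times> ('a \<Rightarrow> 'a)" where "R a b = (T a b, T (3 - a) (3 - b))"

abbreviation x :: "nat \<Rightarrow> ('a \<Rightarrow> 'a) \<times> ('a \<Rightarrow> 'a)" where "x i \<equiv> (sigma P i, sigma (dual P) i)"

abbreviation mix where "mix \<equiv> rotation_mix P (dual P)"

abbreviation H :: "int \<Rightarrow> (('a \<Rightarrow> 'a) \<times> ('a \<Rightarrow> 'a)) set" where "H \<equiv> face_stabilizer 4 mix x"

lemma n4: "n = 4"
  using dim4 by simp

text \<open>This is the inverse of \<open>sigma P (4 - i)\<close>, the expected generator for the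
  dual. It is obtained from the action on the base flag, as \<open>sigma\<close> of the dual is
  computed from the dual poset itself.\<close>

lemma sigma_dual: "\<lbrakk>1 \<le> i; i \<le> 3\<rbrakk> \<Longrightarrow> sigma (dual P) i = T (4 - int i) (3 - int i)"
proof -
  assume i: "1 \<le> i" "i \<le> 3"
  interpret D: abstract_polytope "dual P" by unfold_locales (rule polytope_dual[OF polytope])
  have "T (4 - int i) (3 - int i) ` base P = adj (adj (base P) (3 - int i)) (4 - int i)"
    using T_base[of "4 - int i" "3 - int i"] i n4 by simp
  then show ?thesis
    using i n4 T_closed[of "4 - int i" "3 - int i"]
    by (intro D.sigma_eqI) (auto simp: aut_group_dual adj_flag_dual)
qed

lemma x_R: "\<lbrakk>1 \<le> i; i \<le> 3\<rbrakk> \<Longrightarrow> x i = R (int i - 1) (int i)"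
  using sigma_dual sigma_T[of i] n4 by (simp add: R_def)

lemma R_closed: "\<lbrakk>a \<in> {0..3}; b \<in> {0..3}\<rbrakk> \<Longrightarrow> R a b \<in> carrier \<Gamma>\<Gamma>"
  using T_closed n4 by (simp add: R_def)

lemma R_mult: "\<lbrakk>a \<in> {0..3}; b \<in> {0..3}; c \<in> {0..3}\<rbrakk> \<Longrightarrow> R a b \<otimes>\<^bsub>\<Gamma>\<Gamma>\<^esub> R b c = R a c"
  using T_mult n4 by (simp add: R_def)

lemma R_square: "\<lbrakk>a \<in> {0..3}; b \<in> {0..3}; a \<le> b - 2\<rbrakk> \<Longrightarrow> R a b \<otimes>\<^bsub>\<Gamma>\<Gamma>\<^esub> R a b = \<one>\<^bsub>\<Gamma>\<Gamma>\<^esub>"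
  using T_square[of a b] T_square[of "3 - a" "3 - b"] n4 by (simp add: R_def)

lemma R_same: "a \<in> {0..3} \<Longrightarrow> R a a = \<one>\<^bsub>\<Gamma>\<Gamma>\<^esub>"
  using T_same n4 by (simp add: R_def)

lemma R_nontrivial: "\<lbrakk>a \<in> {0..3}; b \<in> {0..3}; a \<noteq> b\<rbrakk> \<Longrightarrow> R a b \<noteq> \<one>\<^bsub>\<Gamma>\<Gamma>\<^esub>"
  using T_nontrivial[of a b] n4 by (simp add: R_def)

lemma x_closed: "x ` {1..3} \<subseteq> carrier \<Gamma>\<Gamma>"
  using x_R R_closed by (simp add: image_subset_iff)

lemma mix_eq: "mix = \<Gamma>\<Gamma>\<lparr>carrier := generate \<Gamma>\<Gamma> (x ` {1..3})\<rparr>"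
proof -
  have "sigma (dual P) ` {1..3} \<subseteq> carrier \<Gamma>" "sigma P ` {1..3} \<subseteq> carrier \<Gamma>"
    using x_closed by auto
  then show ?thesis
    using group_mix_eq[OF group_Gamma group_Gamma, of "sigma P" 3 "sigma (dual P)"]
    by (simp add: rotation_mix_def rotation_group_def dim4 aut_group_dual)
qed

lemma mix_mult [simp]: "a \<otimes>\<^bsub>mix\<^esub> b = a \<otimes>\<^bsub>\<Gamma>\<Gamma>\<^esub> b" and mix_one [simp]: "\<one>\<^bsub>mix\<^esub> = \<one>\<^bsub>\<Gamma>\<Gamma>\<^esub>"
  and mix_carrier: "carrier mix = generate \<Gamma>\<Gamma> (x ` {1..3})"
  by (simp_all add: mix_eq)

lemma mix_subgroup: "subgroup (carrier mix) \<Gamma>\<Gamma>"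
  unfolding mix_carrier using \<Gamma>\<Gamma>.generate_is_subgroup x_closed .

lemma group_mix: "group mix"
  using \<Gamma>\<Gamma>.subgroup_imp_group[OF mix_subgroup] mix_eq by simp

lemma generate_mix: "Y \<subseteq> carrier mix \<Longrightarrow> generate mix Y = generate \<Gamma>\<Gamma> Y"
  using \<Gamma>\<Gamma>.generate_consistent[OF _ mix_subgroup] by (simp add: mix_eq)

text \<open>The bound \<open>i \<le> Suc k\<close> admits the empty product, where
  \<open>R k k\<close> is the identity; the induction starts there and prepends one generator at a
  time.\<close>

lemma tau_R:
  assumes "1 \<le> i" "i \<le> Suc k" "k \<le> 3"
  shows "tau mix x i k = R (int i - 1) (int k)"
  using assms(2,1)
proof (induction i rule: inc_induct)
  case base
  then show ?case using assms by (simp add: tau_def R_same)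
next
  case (step i)
  then have "tau mix x i k = x i \<otimes>\<^bsub>\<Gamma>\<Gamma>\<^esub> tau mix x (Suc i) k"
    by (simp add: tau_def upt_conv_Cons del: upt_Suc)
  also have "\<dots> = R (int i - 1) (int i) \<otimes>\<^bsub>\<Gamma>\<Gamma>\<^esub> R (int i) (int k)"
    using step assms x_R[of i] by simp
  also have "\<dots> = R (int i - 1) (int k)" using R_mult step assms by simp
  finally show ?case .
qed

text \<open>The bound \<open>m\<close> is kept variable: 3 places the generators of the stabilizers
  in the mix, while 2 places those of \<open>H 3\<close> in the group generated by
  \<open>x 1\<close> and \<open>x 2\<close>.\<close>

lemma R_generated:
  assumes "1 \<le> i" "i \<le> Suc k" "k \<le> m" "m \<le> 3"
  shows "R (int i - 1) (int k) \<in> generate \<Gamma>\<Gamma> (x ` {1..m})"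
  using assms(2,1)
proof (induction i rule: inc_induct)
  case base
  then show ?case using assms R_same[of "int k"] generate.one[of \<Gamma>\<Gamma>] by simp
next
  case (step i)
  have "R (int i - 1) (int k) = R (int i - 1) (int i) \<otimes>\<^bsub>\<Gamma>\<Gamma>\<^esub> R (int i) (int k)"
    using R_mult step assms by simp
  moreover have "R (int i - 1) (int i) \<in> generate \<Gamma>\<Gamma> (x ` {1..m})"
    using x_R[of i] step assms by (auto intro!: generate.incl simp flip: x_R)
  ultimately show ?case using step generate.eng by fastforce
qed

lemma H_eq: "H j = generate \<Gamma>\<Gamma> {R (int i - 1) (int k) |i k. 1 \<le> i \<and> i \<le> k \<and> k \<le> 3 \<and> int i - 1 \<noteq> j \<and> int k \<noteq> j}"
    (is "_ = generate _ ?Y")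
proof -
  have "{tau mix x i k |i k. 1 \<le> i \<and> i \<le> k \<and> k \<le> 4 - 1 \<and> i - 1 \<in> {m. m < 4 \<and> int m \<noteq> j} \<and>
     k \<in> {m. m < 4 \<and> int m \<noteq> j}} = ?Y"
    by (intro Collect_cong ex_cong1) (auto simp: tau_R of_nat_diff)
  moreover have "?Y \<subseteq> carrier mix"
    unfolding mix_carrier using R_generated[where m = 3] by fastforce
  ultimately show ?thesis
    unfolding face_stabilizer_def gen_subgroup_def using generate_mix[of ?Y] by simp
qed

lemma H_subgroup: "subgroup (H j) \<Gamma>\<Gamma>"
  unfolding H_eq by (rule \<Gamma>\<Gamma>.generate_is_subgroup) (auto simp del: carrier_DirProd intro!: R_closed)

lemma x2_mem_H: "j = 0 \<or> j = 3 \<Longrightarrow> x 2 \<in> H j"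
  unfolding H_eq using x_R[of 2] by (auto intro!: generate.incl exI[of _ 2])

definition rot_stab :: "int \<Rightarrow> ('a \<Rightarrow> 'a) set" where
  "rot_stab j = {\<gamma> \<in> carrier (rotation_group P). \<forall>F \<in> base P. rk P F = j \<longrightarrow> \<gamma> F = F}"

lemma rot_stab_subgroup: "subgroup (rot_stab j) \<Gamma>"
proof (rule \<Gamma>.subgroupI)
  note one = aut_one_apply and mult = aut_mult_apply
  have bf: "F \<in> faces P" if "F \<in> base P" for F using that flag_faces base_flag by blast
  show "rot_stab j \<subseteq> carrier \<Gamma>" using rotation_subset by (auto simp: rot_stab_def)
  show "rot_stab j \<noteq> {}" using one bf subgroup.one_closed[OF rotation_subgroup] by (auto simp: rot_stab_def)
  show "inv\<^bsub>\<Gamma>\<^esub> \<gamma> \<in> rot_stab j" if g: "\<gamma> \<in> rot_stab j" for \<gamma>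
  proof -
    have gr: "\<gamma> \<in> carrier (rotation_group P)" using g by (simp add: rot_stab_def)
    have "(inv\<^bsub>\<Gamma>\<^esub> \<gamma>) F = F" if F: "F \<in> base P" "rk P F = j" for F
      using mult[OF bf[OF F(1)], of \<gamma> "inv\<^bsub>\<Gamma>\<^esub> \<gamma>"] one bf g F gr rotation_subset by (auto simp: rot_stab_def)
    then show ?thesis using subgroup.m_inv_closed[OF rotation_subgroup gr] by (simp add: rot_stab_def)
  qed
  show "\<alpha> \<otimes>\<^bsub>\<Gamma>\<^esub> \<beta> \<in> rot_stab j" if "\<alpha> \<in> rot_stab j" "\<beta> \<in> rot_stab j" for \<alpha> \<beta>
    using that mult bf subgroup.m_closed[OF rotation_subgroup] by (auto simp: rot_stab_def)
qed

lemma T_mem_rot_stab: "\<lbrakk>a \<in> {0..3}; b \<in> {0..3}; j \<noteq> a; j \<noteq> b\<rbrakk> \<Longrightarrow> T a b \<in> rot_stab j"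
  using T_rotation[of a b] T_fixes[of a b] n4 by (auto simp: rot_stab_def)

lemma H_subset: "H j \<subseteq> rot_stab j \<times> rot_stab (3 - j)"
proof -
  have D: "subgroup (rot_stab j \<times> rot_stab (3 - j)) \<Gamma>\<Gamma>"
    using DirProd_subgroups[OF group_Gamma rot_stab_subgroup group_Gamma rot_stab_subgroup] .
  show ?thesis
    unfolding H_eq by (rule \<Gamma>\<Gamma>.generate_subgroup_incl[OF _ D]) (auto simp: R_def intro!: T_mem_rot_stab)
qed

lemma rot_stab_generate:
  assumes I: "I \<subseteq> {0..3}" and g: "g \<in> carrier (rotation_group P)" "\<And>j. j \<in> {0..3} - I \<Longrightarrow> g \<in> rot_stab j"
  shows "g \<in> generate \<Gamma> (TI I)"
proof (rule rotation_stabilizer)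
  fix F assume F: "F \<in> base P" "rk P F \<notin> I"
  have Ff: "F \<in> faces P" using F flag_faces base_flag by blast
  show "g F = F"
  proof (cases "rk P F \<in> {0..3}")
    case True then show ?thesis using g(2)[of "rk P F"] F by (auto simp: rot_stab_def)
  next
    case False
    then have "rk P F = -1 \<or> rk P F = n" using rk_range[OF Ff] n4 by auto
    then show ?thesis using aut_fixes_extreme Ff g(1) rotation_subset by blast
  qed
qed (use I g n4 in auto)

lemma rot_stab_rotation: "g \<in> rot_stab j \<Longrightarrow> g \<in> carrier (rotation_group P)"
  by (simp add: rot_stab_def)

lemma triple_trivial:
  assumes a: "a \<in> {0..3}" and g: "\<forall>j \<in> {0..3} - {a}. g \<in> H j"
  shows "g = \<one>\<^bsub>\<Gamma>\<Gamma>\<^esub>"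
proof -
  have triv: "h = \<one>\<^bsub>\<Gamma>\<^esub>" if b: "b \<in> {0..3}" and h: "\<And>j. j \<in> {0..3} - {b} \<Longrightarrow> h \<in> rot_stab j" for b :: int and h
  proof -
    \<comment> \<open>Any rank other than \<open>b\<close> would do; it only serves to see that
      \<open>h\<close> is a rotation.\<close>
    have "(if b = 0 then 1 else 0) \<in> {0..3} - {b}" by auto
    then have "h \<in> carrier (rotation_group P)" using h rot_stab_rotation by blast
    then have "h \<in> generate \<Gamma> (TI {b})" using rot_stab_generate[of "{b}"] b h by simp
    moreover have "TI {b} = {\<one>\<^bsub>\<Gamma>\<^esub>}" using T_same[of b] b n4 by (simp add: TI_def)
    ultimately show ?thesis using \<Gamma>.generate_one by simp
  qed
  have m: "fst g \<in> rot_stab j" "snd g \<in> rot_stab (3 - j)" if "j \<in> {0..3} - {a}" for j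
    using subsetD[OF H_subset bspec[OF g that]] by (simp_all add: mem_Times_iff)
  have "fst g = \<one>\<^bsub>\<Gamma>\<^esub>" using triv[OF a] m by blast
  moreover have "snd g = \<one>\<^bsub>\<Gamma>\<^esub>"
  proof (rule triv)
    show "3 - a \<in> {0..3}" using a by auto
    fix j assume "j \<in> {0..3} - {3 - a}"
    then have "3 - j \<in> {0..3} - {a}" by auto
    then show "snd g \<in> rot_stab j" using m(2)[of "3 - j"] by simp
  qed
  ultimately show ?thesis by (simp add: prod_eq_iff)
qed

lemma rot_stab_middle:
  assumes "g \<in> rot_stab 0" "g \<in> rot_stab 3"
  shows "g \<in> generate \<Gamma> {sigma P 2}"
proof -
  have "j = 0 \<or> j = 3" if "j \<in> {0..3} - {1, 2}" for j :: int using that by auto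
  then have "g \<in> generate \<Gamma> (TI {1, 2})"
    using assms rot_stab_rotation by (intro rot_stab_generate) auto
  moreover have s2: "sigma P 2 = T 1 2" using sigma_T[of 2] n4 by simp
  have "TI {1, 2} \<subseteq> generate \<Gamma> {sigma P 2}"
  proof -
    have "T 1 1 = \<one>\<^bsub>\<Gamma>\<^esub>" "T 2 2 = \<one>\<^bsub>\<Gamma>\<^esub>" "T 2 1 = inv\<^bsub>\<Gamma>\<^esub> (sigma P 2)"
      using T_same[of 1] T_same[of 2] T_inv[of 1 2] n4 s2 by auto
    then show ?thesis
      using s2 generate.one[of \<Gamma>] generate.incl[of "sigma P 2" "{sigma P 2}" \<Gamma>]
        generate.inv[of "sigma P 2" "{sigma P 2}" \<Gamma>] by (auto simp: TI_def)
  qed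
  moreover have "subgroup (generate \<Gamma> {sigma P 2}) \<Gamma>"
    using \<Gamma>.generate_is_subgroup T_closed[of 1 2] s2 n4 by simp
  ultimately show ?thesis using \<Gamma>.generate_subgroup_incl by blast
qed

lemma H3_subset: "H 3 \<subseteq> generate \<Gamma>\<Gamma> (x ` {1..2})"
  unfolding H_eq
proof (rule \<Gamma>\<Gamma>.generate_subgroup_incl)
  show "subgroup (generate \<Gamma>\<Gamma> (x ` {1..2})) \<Gamma>\<Gamma>"
    by (rule \<Gamma>\<Gamma>.generate_is_subgroup) (rule subset_trans[OF image_mono x_closed], simp)
qed (use R_generated[where m = 2] in fastforce)

text \<open>The elements \<open>x 1\<close> and \<open>x 2\<close> move ranks 0 to 2 in the first
  component and 1 to 3 in the second, so they fix the base facet and the base vertex there.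
  Restriction \<open>\<phi>\<close> of the components to the two sections carries them to the
  specified generators. It is injective on the group they generate, since the only base face outside
  each section is the greatest or the least face, which every automorphism fixes.\<close>

lemma order_facet_vertex_figure_mix:
  "order (rotation_mix (facet P) (dual (vertex_figure P))) = card (generate \<Gamma>\<Gamma> (x ` {1..2}))"
proof -
  define A where "A j = base_face P j" for j
  have A: "A j \<in> base P" "rk P (A j) = j" if "-1 \<le> j" "j \<le> 4" for j
    using base_face[of j] that n4 by (simp_all add: A_def)
  interpret K: base_section P "A (-1)" "A 3" by unfold_locales (use A in auto)
  interpret L: base_section P "A 0" "A 4" by unfold_locales (use A in auto)
  have K: "facet P = K.Q" and L: "vertex_figure P = L.Q"
    by (simp_all add: facet_def vertex_figure_def A_def dim4)
  have dims: "dim K.Q = 3" "dim L.Q = 3" using K.dim_Q L.dim_Q A by auto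
  have rks: "rk P (A (-1)) = -1" "rk P (A 4) = 4" using A by auto
  define \<phi> :: "('a \<Rightarrow> 'a) \<times> ('a \<Rightarrow> 'a) \<Rightarrow> ('a \<Rightarrow> 'a) \<times> ('a \<Rightarrow> 'a)"
    where "\<phi> = (\<lambda>(g, h). (restrict g K.S, restrict h L.S))"
  let ?D = "\<Gamma>\<Gamma>\<lparr>carrier := K.stab \<times> L.stab\<rparr>"
  let ?A = "aut_group K.Q \<times>\<times> aut_group L.Q"
  have D: "subgroup (K.stab \<times> L.stab) \<Gamma>\<Gamma>"
    using DirProd_subgroups[OF group_Gamma K.stab_subgroup group_Gamma L.stab_subgroup] .
  have gA: "group ?A" by (rule DirProd_group[OF group_aut_group group_aut_group])
  have hom: "group_hom ?D ?A \<phi>"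
  proof (intro group_hom.intro group_hom_axioms.intro homI)
    show "group ?D" using \<Gamma>\<Gamma>.subgroup_imp_group[OF D] .
    show "group ?A" by (rule gA)
  next
    fix g assume "g \<in> carrier ?D"
    then show "\<phi> g \<in> carrier ?A" using K.restrict_aut L.restrict_aut by (auto simp: \<phi>_def)
  next
    fix g h assume "g \<in> carrier ?D" "h \<in> carrier ?D"
    then show "\<phi> (g \<otimes>\<^bsub>?D\<^esub> h) = \<phi> g \<otimes>\<^bsub>?A\<^esub> \<phi> h"
      by (auto simp: \<phi>_def K.restrict_mult L.restrict_mult)
  qed
  have T_K: "T a b \<in> K.stab" if "a \<in> {0..2}" "b \<in> {0..2}" for a b
    using that T_closed[of a b] T_fixes[of a b] A n4 by (auto simp: K.stab_def)
  have T_L: "T a b \<in> L.stab" if "a \<in> {1..3}" "b \<in> {1..3}" for a b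
    using that T_closed[of a b] T_fixes[of a b] A n4 by (auto simp: L.stab_def)
  have xD: "x i \<in> K.stab \<times> L.stab" and x\<phi>: "(sigma K.Q i, sigma (dual L.Q) i) = \<phi> (x i)"
    if i: "i \<in> {1..2}" for i
  proof -
    have s: "sigma P i = T (int i - 1) (int i)" "sigma (dual P) i = T (4 - int i) (3 - int i)"
      using i sigma_T[of i] sigma_dual[of i] n4 by auto
    have st: "T (int i - 1) (int i) \<in> K.stab" "T (4 - int i) (3 - int i) \<in> L.stab"
      using i by (auto intro!: T_K T_L)
    show "x i \<in> K.stab \<times> L.stab" using s st by simp
    have "sigma K.Q i = restrict (T (int i - 1) (int i)) K.S"
      using i n4 T_base[of "int i - 1" "int i"] by (intro K.sigma_Q[OF st(1)]) (auto simp: dims rks)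
    \<comment> \<open>The upper end of the vertex-figure has rank 4, so the ranks
      \<open>rk P G - 1 - i\<close> and \<open>rk P G - i\<close> of \<open>sigma_dual_Q\<close>
      become the \<open>3 - i\<close> and \<open>4 - i\<close> of \<open>sigma_dual\<close>.\<close>
    moreover have "sigma (dual L.Q) i = restrict (T (4 - int i) (3 - int i)) L.S"
      using i n4 T_base[of "4 - int i" "3 - int i"] by (intro L.sigma_dual_Q[OF st(2)]) (auto simp: dims rks)
    ultimately show "(sigma K.Q i, sigma (dual L.Q) i) = \<phi> (x i)" using s by (simp add: \<phi>_def)
  qed
  let ?W = "generate \<Gamma>\<Gamma> (x ` {1..2})"
  have xD': "x ` {1..2} \<subseteq> K.stab \<times> L.stab" using xD by auto
  have img: "generate ?A (\<phi> ` x ` {1..2}) = \<phi> ` ?W"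
    using group_hom.generate_img[OF hom, of "x ` {1..2}"] xD' \<Gamma>\<Gamma>.generate_consistent[OF xD' D] by simp
  have W: "?W \<subseteq> K.stab \<times> L.stab" by (rule \<Gamma>\<Gamma>.generate_subgroup_incl[OF xD' D])
  have ext: "\<alpha> F = \<beta> F" if "\<alpha> \<in> carrier \<Gamma>" "\<beta> \<in> carrier \<Gamma>" "F \<in> faces P" "rk P F = -1 \<or> rk P F = n"
    for \<alpha> \<beta> F
    using aut_fixes_extreme[OF that(1,3,4)] aut_fixes_extreme[OF that(2-4)] by simp
  have base_rk: "F \<in> faces P \<and> -1 \<le> rk P F \<and> rk P F \<le> 4" if "F \<in> base P" for F
    using that flag_faces[OF base_flag] rk_range n4 by fastforce
  have inj_K: "g = g'" if "g \<in> K.stab" "g' \<in> K.stab" "restrict g K.S = restrict g' K.S" for g g'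
  proof (rule K.restrict_inj[OF that])
    fix F assume "F \<in> K.outer"
    then have "F \<in> faces P" "rk P F = n" using K.outer_iff base_rk A n4 by force+
    then show "g F = g' F" using ext that by (auto simp: K.stab_def)
  qed
  have inj_L: "g = g'" if "g \<in> L.stab" "g' \<in> L.stab" "restrict g L.S = restrict g' L.S" for g g'
  proof (rule L.restrict_inj[OF that])
    fix F assume "F \<in> L.outer"
    then have "F \<in> faces P" "rk P F = -1" using L.outer_iff base_rk A n4 by force+
    then show "g F = g' F" using ext that by (auto simp: L.stab_def)
  qed
  have inj: "inj_on \<phi> ?W"
  proof (rule inj_onI)
    fix u v assume uv: "u \<in> ?W" "v \<in> ?W" "\<phi> u = \<phi> v"
    then have "u \<in> K.stab \<times> L.stab" "v \<in> K.stab \<times> L.stab" using W by auto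
    then show "u = v" using uv(3) inj_K inj_L by (auto simp: \<phi>_def)
  qed
  have "(\<lambda>i. (sigma K.Q i, sigma (dual L.Q) i)) ` {1..2} = \<phi> ` x ` {1..2}"
    using x\<phi> by (auto simp: image_image)
  moreover have "sigma K.Q ` {1..2} \<subseteq> carrier (aut_group K.Q)"
    "sigma (dual L.Q) ` {1..2} \<subseteq> carrier (aut_group L.Q)"
  proof -
    have "(sigma K.Q i, sigma (dual L.Q) i) \<in> carrier ?A" if "i \<in> {1..2}" for i
      using x\<phi>[OF that] xD[OF that] hom by (auto simp: group_hom_def group_hom_axioms_def hom_def)
    then show "sigma K.Q ` {1..2} \<subseteq> carrier (aut_group K.Q)"
      "sigma (dual L.Q) ` {1..2} \<subseteq> carrier (aut_group L.Q)" by auto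
  qed
  ultimately have "rotation_mix (facet P) (dual (vertex_figure P)) = ?A\<lparr>carrier := \<phi> ` ?W\<rparr>"
    using group_mix_eq[OF group_aut_group[of K.Q] group_aut_group[of L.Q], of "sigma K.Q" 2 "sigma (dual L.Q)"] img
    by (simp add: rotation_mix_def rotation_group_def K L dims aut_group_dual)
  then show ?thesis using card_image[OF inj] by (simp add: order_def)
qed

lemma middle_intersection:
  assumes fin: "finite (faces P)" and q: "prime q" and ord: "group.ord (rotation_group P) (sigma P 2) = q"
    and ndvd: "\<not> q\<^sup>2 dvd order (rotation_mix (facet P) (dual (vertex_figure P)))"
  shows "H 0 \<inter> H 3 \<subseteq> generate mix {x 2}"
proof -
  have fin\<Gamma>: "finite (carrier \<Gamma>\<Gamma>)" using finite_aut[OF fin] by simp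
  define Z where "Z = generate \<Gamma> {sigma P 2}"
  define W where "W = generate \<Gamma>\<Gamma> (x ` {1..2})"
  define N where "N = H 0 \<inter> H 3"
  have x2: "x 2 \<in> carrier \<Gamma>\<Gamma>" using x_closed by (rule subsetD) auto
  then have s2: "sigma P 2 \<in> carrier \<Gamma>" by simp
  have s2r: "{sigma P 2} \<subseteq> carrier (rotation_group P)"
    unfolding rotation_carrier using dim4 by (auto intro!: generate.incl)
  have Z: "subgroup Z \<Gamma>" unfolding Z_def using \<Gamma>.generate_is_subgroup s2 by simp
  have W: "subgroup W \<Gamma>\<Gamma>" unfolding W_def by (rule \<Gamma>\<Gamma>.generate_is_subgroup) (rule subset_trans[OF image_mono x_closed], simp)
  have ZZ: "subgroup (Z \<times> Z) \<Gamma>\<Gamma>" using DirProd_subgroups[OF group_Gamma Z group_Gamma Z] .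
  have "card Z = q"
  proof -
    have rg: "rotation_group P = \<Gamma>\<lparr>carrier := carrier (rotation_group P)\<rparr>"
      by (simp add: rotation_group_def subgroup_generated_def)
    have "generate (rotation_group P) {sigma P 2} = Z"
      using \<Gamma>.generate_consistent[OF s2r rotation_subgroup] rg by (simp add: Z_def)
    moreover have "group (rotation_group P)"
      using \<Gamma>.subgroup_imp_group[OF rotation_subgroup] rg by simp
    ultimately show ?thesis using group.generate_pow_card[of "rotation_group P" "sigma P 2"] s2r ord by simp
  qed
  have N: "subgroup N \<Gamma>\<Gamma>"
  proof -
    show ?thesis unfolding N_def by (rule \<Gamma>\<Gamma>.subgroups_Inter_pair[OF H_subgroup H_subgroup])
  qed
  have "N \<subseteq> Z \<times> Z"
  proof
    fix g assume "g \<in> N"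
    then have "g \<in> rot_stab 0 \<times> rot_stab 3" "g \<in> rot_stab 3 \<times> rot_stab 0"
      using H_subset[of 0] H_subset[of 3] by (auto simp: N_def)
    then show "g \<in> Z \<times> Z" using rot_stab_middle unfolding Z_def by auto
  qed
  then have "card N dvd q\<^sup>2"
    using \<Gamma>\<Gamma>.card_subgroup_dvd[OF N ZZ] \<open>card Z = q\<close> by (simp add: card_cartesian_product power2_eq_square)
  then obtain i where i: "i \<le> 2" "card N = q ^ i" using divides_primepow_nat[OF q] by blast
  have "card N dvd card W"
    using \<Gamma>\<Gamma>.card_subgroup_dvd[OF N W] H3_subset by (auto simp: N_def W_def)
  then have "i \<noteq> 2" using i ndvd order_facet_vertex_figure_mix by (auto simp: W_def)
  then have "q ^ i \<le> q ^ 1" using i q by (intro power_increasing) (auto simp: prime_gt_0_nat Suc_leI)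
  then have cN: "card N \<le> q" using i by simp
  let ?X = "generate \<Gamma>\<Gamma> {x 2}"
  have XN: "?X \<subseteq> N"
  proof -
    show ?thesis using \<Gamma>\<Gamma>.generate_subgroup_incl[OF _ N] x2_mem_H by (simp add: N_def)
  qed
  \<comment> \<open>The first projection maps \<open>?X\<close> onto \<open>Z\<close>, which has
    order \<open>q\<close>. With \<open>card N \<le> q\<close> and \<open>?X \<subseteq> N\<close>
    this forces \<open>?X = N\<close>.\<close>
  have "q \<le> card ?X"
  proof -
    have "group_hom \<Gamma>\<Gamma> \<Gamma> fst"
      using group_Gamma \<Gamma>\<Gamma>.is_group by (auto simp: group_hom_def group_hom_axioms_def hom_def)
    then have "fst ` ?X = Z"
      using group_hom.generate_img[of \<Gamma>\<Gamma> \<Gamma> fst "{x 2}"] x2 by (simp add: Z_def)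
    moreover have "finite ?X" using XN N fin\<Gamma> finite_subset subgroup.subset by metis
    ultimately show ?thesis using card_image_le[of ?X fst] \<open>card Z = q\<close> by simp
  qed
  moreover have "finite N" using finite_subset[OF subgroup.subset[OF N] fin\<Gamma>] .
  ultimately have "?X = N" using XN cN by (intro card_seteq) auto
  moreover have "x 2 \<in> carrier mix" unfolding mix_carrier by (rule generate.incl) auto
  ultimately show ?thesis using generate_mix[of "{x 2}"] by (simp add: N_def)
qed

lemma polytope_mix_dual:
  assumes fin: "finite (faces P)" and q: "prime q" and ord: "group.ord (rotation_group P) (sigma P 2) = q"
    and ndvd: "\<not> q\<^sup>2 dvd order (rotation_mix (facet P) (dual (vertex_figure P)))"
  shows "polytope (polytope_mix P (dual P))"
proof -
  have s: "{1..3} = {1, 2, 3::nat}" by auto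
  have xs: "x 1 = R 0 1" "x 2 = R 1 2" "x 3 = R 2 3" using x_R[of 1] x_R[of 2] x_R[of 3] by auto
  have x_mix: "{x 1, x 2, x 3} \<subseteq> carrier mix"
    unfolding mix_carrier s by (auto intro: generate.incl)
  have p12: "x 1 \<otimes>\<^bsub>mix\<^esub> x 2 = R 0 2" unfolding xs mix_mult by (rule R_mult) auto
  have p23: "x 2 \<otimes>\<^bsub>mix\<^esub> x 3 = R 1 3" unfolding xs mix_mult by (rule R_mult) auto
  have p13: "x 1 \<otimes>\<^bsub>mix\<^esub> x 2 \<otimes>\<^bsub>mix\<^esub> x 3 = R 0 3"
    unfolding p12 unfolding xs mix_mult by (rule R_mult) auto
  interpret M: rotation_generators mix x
  proof (intro rotation_generators.intro group_with_generators.intro group_mix rotation_generators_axioms.intro)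
    show "x 1 \<in> carrier mix" "x 2 \<in> carrier mix" "x 3 \<in> carrier mix" using x_mix by auto
    show "carrier mix = generate mix {x 1, x 2, x 3}"
      by (simp only: generate_mix[OF x_mix] mix_carrier s image_insert image_empty)
    show "x 1 \<otimes>\<^bsub>mix\<^esub> x 2 \<otimes>\<^bsub>mix\<^esub> (x 1 \<otimes>\<^bsub>mix\<^esub> x 2) = \<one>\<^bsub>mix\<^esub>"
      unfolding p12 unfolding mix_mult mix_one by (rule R_square) auto
    show "x 2 \<otimes>\<^bsub>mix\<^esub> x 3 \<otimes>\<^bsub>mix\<^esub> (x 2 \<otimes>\<^bsub>mix\<^esub> x 3) = \<one>\<^bsub>mix\<^esub>"
      unfolding p23 unfolding mix_mult mix_one by (rule R_square) auto
    show "x 1 \<otimes>\<^bsub>mix\<^esub> x 2 \<otimes>\<^bsub>mix\<^esub> x 3 \<otimes>\<^bsub>mix\<^esub> (x 1 \<otimes>\<^bsub>mix\<^esub> x 2 \<otimes>\<^bsub>mix\<^esub> x 3) = \<one>\<^bsub>mix\<^esub>"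
      unfolding p13 unfolding mix_mult mix_one by (rule R_square) auto
    show "x 1 \<otimes>\<^bsub>mix\<^esub> x 2 \<noteq> \<one>\<^bsub>mix\<^esub>" unfolding p12 mix_one by (rule R_nontrivial) auto
    show "x 2 \<otimes>\<^bsub>mix\<^esub> x 3 \<noteq> \<one>\<^bsub>mix\<^esub>" unfolding p23 mix_one by (rule R_nontrivial) auto
    show "g = \<one>\<^bsub>mix\<^esub>" if "a \<in> {0..3}" "\<forall>j \<in> {0..3} - {a}. g \<in> H j" for a g
      using triple_trivial[OF that] by (simp only: mix_one)
    show "H 0 \<inter> H 3 \<subseteq> generate mix {x 2}" by (rule middle_intersection[OF assms])
  qed
  show ?thesis using M.polytope_coset_poset by (simp add: polytope_mix_def dim4)
qed

end

theorem proposition4p3: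
  fixes P :: "'a ranked_poset" and p q r :: nat
  assumes "polytope P" and "dim P = 4" and "finite (faces P)"
    and "chiral P \<or> directly_regular P"
    and "schlafli_type P = [p, q, r]"
    and "prime q"
    and "\<not> q\<^sup>2 dvd order (rotation_mix (facet P) (dual (vertex_figure P)))"
  shows "polytope (polytope_mix P (dual P))"
proof -
  interpret rotary_polytope4 P by unfold_locales (use assms in auto)
  have "[1..<4] = [1, 2, 3]" by (simp add: upt_rec)
  then have "group.ord (rotation_group P) (sigma P 2) = q"
    using assms(5) by (simp add: schlafli_type_def dim4)
  then show ?thesis using polytope_mix_dual assms by blast
qed

end
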